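(* For any sequence $(\varepsilon_k)_{k\ge 1}$ of positive numbers tending to $0$, there exist a sequence $(n_k)_{k\ge 1}$ of positive integers and an index $k_0$ such that $$\frac{n_{k+1}}{n_k}\ \ge\ 1+\varepsilon_k \qquad (k\ge k_0)$$ and such that both of the following hold. (i) There exist a permutation $\sigma:\mathbb{N}\to\mathbb{N}$ of the positive integers and a bounded sequence of real numbers $(b_N)_{N\ge 1}$ (i.e. $b_N=O(1)$) such that $$N^{-1/2}\sum_{k=1}^N \cos\left(2\pi n_{\sigma(k)}x\right)-b_N\ \stackrel{\mathcal D}{\longrightarrow}\ G \qquad (N\to\infty),$$ where $G$ is the nongaussian probability distribution on $\mathbb{R}$ with characteristic function $$t\mapsto \exp\left\{\int_{\mathbb{R}\setminus\{0\}}\left(e^{itx}-1-\frac{itx}{1+x^2}\right)dL(x)\right\},$$ with the function $L$ defined in the context. (ii) There exists a permutation $\sigma:\mathbb{N}\to\mathbb{N}$ of the positive integers such that $$\limsup_{N\to\infty}\frac{\sum_{k=1}^N\cos\left(2\pi n_{\sigma(k)}x\right)}{\sqrt{2N\log\log N}}=+\infty \qquad\text{for almost every } x.$$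
   Context: Random variables are considered on the probability space $[0,1]$ equipped with Lebesgue measure (functions of $x\in[0,1]$); $\stackrel{\mathcal D}{\longrightarrow}$ denotes convergence in distribution with respect to this measure, and "almost every" refers to Lebesgue measure. The function $L:\mathbb{R}\setminus\{0\}\to\mathbb{R}$ is defined by $$L(x)=\begin{cases}-\dfrac1\pi\displaystyle\int_x^1\frac{F(t)}{t}\,dt & \text{if } 0<x\le 1,\\[2mm] \dfrac1\pi\displaystyle\int_{-x}^1\frac{H(t)}{t}\,dt & \text{if } -1\le x<0,\\[2mm] 0 & \text{if } |x|>1,\end{cases}$$ where, for $t>0$, $$F(t)=\lambda\{x>0:\ \sin x/x\ge t\},\qquad H(t)=\lambda\{x>0:\ \sin x/x\le -t\},$$ and $\lambda$ is Lebesgue measure. $L$ is nondecreasing on $(-\infty,0)$ and on $(0,\infty)$, and $dL$ denotes the corresponding Lebesgue–Stieltjes measure on $\mathbb{R}\setminus\{0\}$. *)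

theory Defs
  imports "HOL-Probability.Probability"
begin

definition unit_space :: "real measure" where
  "unit_space = restrict_space lborel {0..1}"

definition sinc_upper :: "real \<Rightarrow> real" where
  "sinc_upper t = measure lborel {x. x > 0 \<and> sin x / x \<ge> t}"

definition sinc_lower :: "real \<Rightarrow> real" where
  "sinc_lower t = measure lborel {x. x > 0 \<and> sin x / x \<le> - t}"

text \<open>The value at \<open>0\<close> is a dummy: the function is only ever used on the punctured line.\<close>

definition L :: "real \<Rightarrow> real" where
  "L x =
    (if 0 < x \<and> x \<le> 1 then - (1 / pi) * (LBINT t:{x..1}. sinc_upper t / t)
     else if - 1 \<le> x \<and> x < 0 then (1 / pi) * (LBINT t:{-x..1}. sinc_lower t / t)
     else 0)"

text \<open>The Lebesgue--Stieltjes measure on the punctured line. It is the analogue of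
  \<^const>\<open>interval_measure\<close>, restricted to the half-open intervals whose
  closure avoids \<open>0\<close>. The mass near \<open>0\<close> may be infinite, and the two branches of
  \<open>f\<close> need not fit together to a monotone function on the whole line.\<close>

definition punctured_stieltjes :: "(real \<Rightarrow> real) \<Rightarrow> real measure" where
  "punctured_stieltjes f =
    extend_measure (UNIV - {0}) {(a, b). a \<le> b \<and> (0 < a \<or> b < 0)}
      (\<lambda>(a, b). {a<..b}) (\<lambda>(a, b). ennreal (f b - f a))"

definition G_char :: "real \<Rightarrow> complex" where
  "G_char t =
    exp (CLINT x|punctured_stieltjes L.
      iexp (t * x) - 1 - \<i> * complex_of_real (t * x / (1 + x\<^sup>2)))"

text \<open>Uniqueness is \<open>Levy_uniqueness\<close>; existence is not built in and has to be proved.\<close>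

definition G :: "real measure" where
  "G = (THE M. real_distribution M \<and> (\<forall>t. char M t = G_char t))"

text \<open>Degenerate (point mass) laws count as Gaussian here.\<close>

definition gaussian :: "real measure \<Rightarrow> bool" where
  "gaussian M \<longleftrightarrow>
    (\<exists>m. M = return borel m) \<or>
    (\<exists>m s. s > 0 \<and> M = density lborel (\<lambda>x. ennreal (normal_density m s x)))"

definition permutation_of_pos :: "(nat \<Rightarrow> nat) \<Rightarrow> bool" where
  "permutation_of_pos \<sigma> \<longleftrightarrow> bij_betw \<sigma> {1..} {1..}"

definition cos_sum :: "(nat \<Rightarrow> nat) \<Rightarrow> nat \<Rightarrow> real \<Rightarrow> real" where
  "cos_sum m N x = (\<Sum>k=1..N. cos (2 * pi * real (m k) * x))"

end

(*
  Idea. A block m, 2m, ..., rm of frequencies sums to the Dirichlet kernel D_r(mx), which has a peak of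
  height r on a set of measure of order 1/r. If the base frequencies m grow fast enough, kernels of
  different blocks are nearly independent, so a rearranged sum behaves like a sum of independent
  heavy-tailed variables. The set of frequencies contains blocks of every length infinitely often, but a
  block of length r occurs only when the gap condition allows the ratio 1 + 1/r; most of its blocks have
  length 1.

  (i) Since D_r(w / (2 pi R)) / R tends to sin(sw)/w for r/R -> s, the blocks of length 1, ..., R, divided
  by R, have characteristic exponent close to
    (1/pi) int_0^1 int_0^infinity (exp(i t x) - 1 - i t x) dw ds  with  x = sin(sw)/w,
  and the image of dw ds / pi under (s, w) -> sin(sw)/w is dL. These blocks use R^2/2 terms; as many terms
  are taken from exponentially long blocks, which contribute nothing in the limit, so that N is about R^2.

  (ii) Blocks of length r_b ~ b ln b satisfy sum 1/r_b = infinity, so infinitely many of their kernels peak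
  almost surely, while sum N_b / r_b^3 < infinity for the number N_b of preceding terms, so at almost all
  these peaks the preceding partial sum is small compared with r_b. But r_b / sqrt (N_b ln ln N_b) is
  unbounded.

  In both cases all other frequencies are inserted at the very sparse positions 2^i.
*)

theory Submission
  imports Defs "HOL-Real_Asymp.Real_Asymp"
begin

subsection \<open>Integration over the unit interval and mixing\<close>

text \<open>Independence is replaced by the estimate \<open>mixing\<close>: a function with
  Lipschitz constant \<open>K\<close> and a periodic function run at frequency \<open>m\<close>
  decouple up to an error of order \<open>K / m\<close>. Hence test functions have to be Lipschitz,
  which is why indicators of peaks give way to \<open>peak\<close>, and each base dominates the
  square of all earlier slopes, since (ii) decouples a squared partial sum from a squared kernel.
  Each kernel has mean \<open>0\<close>, so the limit exponent arises with compensator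
  \<open>i t x\<close>; passing to \<open>x / (1 + x^2)\<close> is a translation, and this is the
  whole content of \<open>b\<close>. The law \<open>G\<close> is found as a weak limit of the sums
  themselves, which are tight by orthogonality. In (i), variances cannot be used to discard terms,
  because the long blocks carry a fixed share of the variance; smallness is measured by the integral
  of \<open>min 1 |X|\<close>. In (ii), \<open>N_b\<close> is of order \<open>b^2 ln b\<close>, so
  \<open>r_b / sqrt (N_b ln ln N_b)\<close> grows like \<open>sqrt (ln b / ln ln b)\<close>. The
  factor \<open>ln b\<close> in the length is what makes this unbounded, and the sum of
  \<open>1 / r_b\<close> still diverges.\<close>

lemma prob_space_unit: "prob_space unit_space"
  unfolding unit_space_def by (rule prob_space_restrict_space) auto

lemma space_unit [simp]: "space unit_space = {0..1}"
  by (simp add: unit_space_def space_restrict_space)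

lemma borel_measurable_unit [measurable_dest]:
  "f \<in> borel_measurable borel \<Longrightarrow> f \<in> borel_measurable unit_space"
  unfolding unit_space_def by (intro measurable_restrict_space1) simp

lemma unit_integral_eq:
  fixes f :: "real \<Rightarrow> 'a::{banach,second_countable_topology}"
  shows "integral\<^sup>L unit_space f = (LINT x|lborel. indicator {0..1} x *\<^sub>R f x)"
  unfolding unit_space_def by (rule integral_restrict_space) simp

lemma unit_integrable_eq:
  fixes f :: "real \<Rightarrow> 'a::{banach,second_countable_topology}"
  shows "integrable unit_space f \<longleftrightarrow> integrable lborel (\<lambda>x. indicator {0..1} x *\<^sub>R f x)"
  unfolding unit_space_def by (rule integrable_restrict_space) simp

lemma integrable_unit_continuous:
  fixes f :: "real \<Rightarrow> 'a::{banach,second_countable_topology}"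
  assumes "continuous_on UNIV f"
  shows "integrable unit_space f"
  unfolding unit_integrable_eq
  by (rule borel_integrable_compact) (auto intro: continuous_on_subset[OF assms])

text \<open>Integrability alone is assumed because the split serves continuous integrands in
  \<open>mixing\<close> and a discontinuous step function in
  \<open>integral_unit_step\<close>.\<close>

lemma
  fixes f :: "real \<Rightarrow> 'a::{banach,second_countable_topology}"
  assumes f: "integrable unit_space f" and m: "m > (0::nat)"
  shows integrable_unit_piece: "\<And>j. j < m \<Longrightarrow> integrable unit_space (\<lambda>y. f ((real j + y) / real m))"
    and integral_unit_split: "integral\<^sup>L unit_space f =
      (1 / real m) *\<^sub>R (\<Sum>j<m. LINT y|unit_space. f ((real j + y) / real m))"
proof -
  \<comment> \<open>Half-open cells partition \<open>{0..<1}\<close> exactly; the point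
    \<open>1\<close> is a null set, so closed and half-open indicators are exchanged through
    \<open>ind1\<close>.\<close>
  define I where "I j = {real j / real m ..< (real j + 1) / real m}" for j
  have f': "integrable lborel (\<lambda>x. indicator {0..1} x *\<^sub>R f x)"
    using f by (simp add: unit_integrable_eq)
  have sub: "I j \<subseteq> {0..1}" if "j < m" for j
  proof -
    have "(real j + 1) / real m \<le> 1" using that m by (simp add: field_simps)
    moreover have "0 \<le> real j / real m" by simp
    ultimately show ?thesis unfolding I_def
      by (meson atLeastLessThan_subseteq_atLeastAtMost_iff order_trans atLeastatMost_subset_iff
          atLeastLessThan_iff atLeastAtMost_iff subsetI less_imp_le le_less_trans)
  qed
  have int_piece: "integrable lborel (\<lambda>x. indicator (I j) x *\<^sub>R f x)" if "j < m" for j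
  proof -
    have "integrable lborel (\<lambda>x. indicator (I j) x *\<^sub>R (indicator {0..1} x *\<^sub>R f x))"
      by (intro integrable_mult_indicator f') (auto simp: I_def)
    moreover have "(\<lambda>x. indicator (I j) x *\<^sub>R (indicator {0..1} x *\<^sub>R f x)) =
        (\<lambda>x. indicator (I j) x *\<^sub>R f x)"
      using sub[OF that] by (fastforce simp: indicator_def fun_eq_iff)
    ultimately show ?thesis by simp
  qed
  have trans: "indicator (I j) ((real j + y) / real m) = (indicator {0..<1} y :: real)" for j y
    using m by (auto simp: I_def indicator_def field_simps)
  have arg: "real j / real m + (1 / real m) * y = (real j + y) / real m" for j y
    by (simp add: add_divide_distrib)
  have ind1: "AE y::real in lborel. indicator {0..<1} y *\<^sub>R g y = indicator {0..1} y *\<^sub>R (g y :: 'a)" for g :: "real \<Rightarrow> 'a"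
    using AE_lborel_singleton[of 1] by eventually_elim (auto simp: indicator_def)
  have int2: "integrable lborel (\<lambda>y. indicator {0..<1} y *\<^sub>R f ((real j + y) / real m))" if "j < m" for j
    using lborel_integrable_real_affine[OF int_piece[OF that], of "1 / real m" "real j / real m"] m
    unfolding arg trans by simp
  \<comment> \<open>\<open>f\<close> is known to be measurable only on the unit interval, so the
    value at the endpoint \<open>y = 1\<close> is added by hand to the half-open piece.\<close>
  have meas: "(\<lambda>y. indicator {0..1} y *\<^sub>R f ((real j + y) / real m)) \<in> borel_measurable lborel"
    if "j < m" for j
  proof -
    have "(\<lambda>y. indicator {0..<1} y *\<^sub>R f ((real j + y) / real m) +
        indicator {1} y *\<^sub>R f ((real j + 1) / real m)) \<in> borel_measurable lborel"
      using borel_measurable_integrable[OF int2[OF that]] by measurable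
    also have "(\<lambda>y. indicator {0..<1} y *\<^sub>R f ((real j + y) / real m) +
        indicator {1} y *\<^sub>R f ((real j + 1) / real m)) =
        (\<lambda>y. indicator {0..1} y *\<^sub>R f ((real j + y) / real m))"
      by (auto simp: indicator_def fun_eq_iff)
    finally show ?thesis .
  qed
  show A: "integrable unit_space (\<lambda>y. f ((real j + y) / real m))" if "j < m" for j
    unfolding unit_integrable_eq
    using integrable_cong_AE_imp[OF int2[OF that] meas[OF that]] ind1 by (auto elim: AE_mp)
  have part: "(\<Sum>j<m. indicator (I j) x) = (indicator {0..<1} x :: real)" for x :: real
  proof (cases "0 \<le> x \<and> x < 1")
    case True
    define k where "k = nat \<lfloor>x * real m\<rfloor>"
    have k: "real k \<le> x * real m" "x * real m < real k + 1"
      using True m unfolding k_def by auto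
    have "x * real m < 1 * real m" using True m by (intro mult_strict_right_mono) auto
    hence "real k < real m" using k(1) by linarith
    hence km: "k < m" by simp
    have "x \<in> I j \<longleftrightarrow> j = k" for j
    proof
      assume "x \<in> I j"
      hence "real j \<le> x * real m" "x * real m < real j + 1"
        using m by (auto simp: I_def field_simps)
      with k show "j = k" by linarith
    next
      assume "j = k" thus "x \<in> I j" using k m by (auto simp: I_def field_simps)
    qed
    hence "(\<Sum>j<m. indicator (I j) x) = (\<Sum>j<m. if j = k then 1 else 0 :: real)"
      by (intro sum.cong) (auto simp: indicator_def)
    thus ?thesis using True km by (simp add: indicator_def)
  next
    case False
    have "x \<notin> I j" if "j < m" for j
    proof
      assume "x \<in> I j"
      hence "0 \<le> x" "x < (real j + 1) / real m"
        by (auto simp: I_def intro: order_trans[rotated])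
      moreover have "(real j + 1) / real m \<le> 1" using that m by (simp add: field_simps)
      ultimately show False using False by linarith
    qed
    thus ?thesis using False by (auto simp: indicator_def)
  qed
  have "integral\<^sup>L unit_space f = (LINT x|lborel. indicator {0..<1} x *\<^sub>R f x)"
    unfolding unit_integral_eq
  proof (rule integral_cong_AE)
    show "(\<lambda>x. indicator {0..1} x *\<^sub>R f x) \<in> borel_measurable lborel"
      using borel_measurable_integrable[OF f'] .
    have "(\<lambda>x. indicator {0..<1::real} x *\<^sub>R (indicator {0..1} x *\<^sub>R f x)) \<in> borel_measurable lborel"
      using borel_measurable_integrable[OF f'] by measurable
    also have "(\<lambda>x. indicator {0..<1} x *\<^sub>R (indicator {0..1} x *\<^sub>R f x)) = (\<lambda>x. indicator {0..<1} x *\<^sub>R f x)"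
      by (auto simp: indicator_def fun_eq_iff)
    finally show "(\<lambda>x. indicator {0..<1} x *\<^sub>R f x) \<in> borel_measurable lborel" .
    show "AE x in lborel. indicator {0..1} x *\<^sub>R f x = indicator {0..<1} x *\<^sub>R f x"
      using ind1[of f] by eventually_elim (rule sym)
  qed
  also have "\<dots> = (LINT x|lborel. (\<Sum>j<m. indicator (I j) x *\<^sub>R f x))"
    by (simp add: part[symmetric] scaleR_sum_left)
  also have "\<dots> = (\<Sum>j<m. (LINT x|lborel. indicator (I j) x *\<^sub>R f x))"
    by (rule Bochner_Integration.integral_sum) (use int_piece in auto)
  also have "\<dots> = (\<Sum>j<m. (1 / real m) *\<^sub>R (LINT y|unit_space. f ((real j + y) / real m)))"
  proof (rule sum.cong)
    fix j assume "j \<in> {..<m}"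
    hence j: "j < m" by simp
    have "(LINT x|lborel. indicator (I j) x *\<^sub>R f x) =
        (1 / real m) *\<^sub>R (LINT y|lborel. indicator {0..<1} y *\<^sub>R f ((real j + y) / real m))"
      using m by (subst lborel_integral_real_affine[where c = "1 / real m" and t = "real j / real m"])
        (simp_all only: arg trans, simp_all add: abs_of_pos)
    also have "(LINT y|lborel. indicator {0..<1} y *\<^sub>R f ((real j + y) / real m)) =
        (LINT y|unit_space. f ((real j + y) / real m))"
      unfolding unit_integral_eq
      using borel_measurable_integrable[OF int2[OF j]] meas[OF j] ind1 by (intro integral_cong_AE) auto
    finally show "(LINT x|lborel. indicator (I j) x *\<^sub>R f x) =
        (1 / real m) *\<^sub>R (LINT y|unit_space. f ((real j + y) / real m))" .
  qed simp
  finally show "integral\<^sup>L unit_space f =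
      (1 / real m) *\<^sub>R (\<Sum>j<m. LINT y|unit_space. f ((real j + y) / real m))"
    by (simp add: scaleR_sum_right)
qed

lemma periodic_nat:
  assumes "\<And>x::real. g (x + 1) = g x"
  shows "g (real j + x) = g x"
proof (induction j)
  case (Suc j)
  have "real (Suc j) + x = (real j + x) + 1" by simp
  thus ?case using assms Suc by metis
qed simp

lemma norm_integral_unit_le:
  fixes f :: "real \<Rightarrow> 'a::{banach,second_countable_topology}"
  assumes "integrable unit_space f" and "\<And>x. x \<in> {0..1} \<Longrightarrow> norm (f x) \<le> B"
  shows "norm (integral\<^sup>L unit_space f) \<le> B"
proof -
  interpret prob_space unit_space by (rule prob_space_unit)
  have "norm (integral\<^sup>L unit_space f) \<le> (LINT x|unit_space. norm (f x))"
    by (rule integral_norm_bound)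
  also have "\<dots> \<le> (LINT x|unit_space. B)"
    using assms by (intro integral_mono) auto
  finally show ?thesis using prob_space by simp
qed

text \<open>Cutting into \<open>m\<close> cells makes the periodic factor the same on each of them
  and replaces \<open>h\<close> by its average \<open>A y\<close> over the points
  \<open>(j + y) / m\<close>. This average varies by at most \<open>K / m\<close>, so it may be
  replaced by its mean. The \<open>L1\<close> norm of \<open>g\<close> in the error, in place of a
  supremum, matters for squared Dirichlet kernels: their integral is \<open>r / 2\<close>, their
  maximum \<open>r^2\<close>.\<close>

lemma mixing:
  fixes h g :: "real \<Rightarrow> 'a::{real_normed_field,banach,second_countable_topology}"
  assumes h: "continuous_on UNIV h" "\<And>x y. norm (h x - h y) \<le> K * \<bar>x - y\<bar>"
    and g: "continuous_on UNIV g" "\<And>x. g (x + 1) = g x" and m: "m > (0::nat)"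
  shows "norm ((LINT x|unit_space. h x * g (real m * x)) - integral\<^sup>L unit_space h * integral\<^sup>L unit_space g)
    \<le> K / real m * (LINT x|unit_space. norm (g x))"
proof -
  interpret prob_space unit_space by (rule prob_space_unit)
  define A where "A y = (1 / real m) *\<^sub>R (\<Sum>j<m. h ((real j + y) / real m))" for y
  have ch: "continuous_on UNIV (\<lambda>y. h ((real j + y) / real m))" for j
    by (intro continuous_on_compose2[OF h(1)] continuous_intros) (use m in auto)
  have cA: "continuous_on UNIV A" unfolding A_def
    by (intro continuous_intros ch)
  have gp: "g (real j + x) = g x" for j x by (rule periodic_nat) (rule g(2))
  have K: "K \<ge> 0" using h(2)[of 0 1] norm_ge_zero[of "h 0 - h 1"] by (simp del: norm_ge_zero)
  have 1: "(LINT x|unit_space. h x * g (real m * x)) = (LINT y|unit_space. A y * g y)"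
  proof -
    have "integrable unit_space (\<lambda>x. h x * g (real m * x))"
      by (intro integrable_unit_continuous continuous_intros h(1) continuous_on_compose2[OF g(1)]) auto
    from integral_unit_split[OF this m]
    have "(LINT x|unit_space. h x * g (real m * x)) = (1 / real m) *\<^sub>R
        (\<Sum>j<m. LINT y|unit_space. h ((real j + y) / real m) * g (real m * ((real j + y) / real m)))" .
    also have "\<dots> = (1 / real m) *\<^sub>R (\<Sum>j<m. LINT y|unit_space. h ((real j + y) / real m) * g y)"
      using m by (simp add: gp)
    also have "\<dots> = (1 / real m) *\<^sub>R (LINT y|unit_space. (\<Sum>j<m. h ((real j + y) / real m) * g y))"
      by (subst Bochner_Integration.integral_sum)
        (auto intro!: integrable_unit_continuous continuous_intros ch g(1))
    also have "\<dots> = (LINT y|unit_space. A y * g y)"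
      by (simp add: A_def sum_distrib_right flip: integral_scaleR_right)
    finally show ?thesis .
  qed
  have 2: "integral\<^sup>L unit_space h = integral\<^sup>L unit_space A"
    unfolding A_def
    by (subst integral_unit_split[OF integrable_unit_continuous[OF h(1)] m])
      (subst integral_scaleR_right, subst Bochner_Integration.integral_sum,
       auto intro!: integrable_unit_continuous ch)
  have lip: "norm (A y - A z) \<le> K / real m" if "y \<in> {0..1}" "z \<in> {0..1}" for y z
  proof -
    have "A y - A z = (1 / real m) *\<^sub>R (\<Sum>j<m. h ((real j + y) / real m) - h ((real j + z) / real m))"
      by (simp add: A_def sum_subtractf scaleR_diff_right)
    also have "norm \<dots> \<le> (1 / real m) * (\<Sum>j<m. norm (h ((real j + y) / real m) - h ((real j + z) / real m)))"
      by (simp add: divide_right_mono norm_sum)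
    also have "\<dots> \<le> (1 / real m) * (\<Sum>j<m. K / real m)"
    proof (intro mult_left_mono sum_mono)
      fix j
      have "norm (h ((real j + y) / real m) - h ((real j + z) / real m))
          \<le> K * \<bar>(real j + y) / real m - (real j + z) / real m\<bar>" by (rule h(2))
      also have "(real j + y) / real m - (real j + z) / real m = (y - z) / real m"
        by (simp flip: diff_divide_distrib)
      also have "K * \<bar>(y - z) / real m\<bar> \<le> K * (1 / real m)"
        using that K m by (intro mult_left_mono) (auto simp: abs_divide divide_right_mono)
      finally show "norm (h ((real j + y) / real m) - h ((real j + z) / real m)) \<le> K / real m" by simp
    qed simp
    also have "\<dots> = K / real m" using m by simp
    finally show ?thesis .
  qed
  define a where "a = integral\<^sup>L unit_space A"
  have dev: "norm (A y - a) \<le> K / real m" if "y \<in> {0..1}" for y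
  proof -
    have "(LINT z|unit_space. A y - A z) = A y - a"
      using prob_space unfolding a_def
      by (subst Bochner_Integration.integral_diff) (auto intro: integrable_unit_continuous cA)
    moreover have "norm (LINT z|unit_space. A y - A z) \<le> K / real m"
      using lip that by (intro norm_integral_unit_le integrable_unit_continuous continuous_intros cA) auto
    ultimately show ?thesis by simp
  qed
  have "(LINT x|unit_space. h x * g (real m * x)) - integral\<^sup>L unit_space h * integral\<^sup>L unit_space g
      = (LINT y|unit_space. A y * g y) - (LINT y|unit_space. a * g y)"
    by (simp add: 1 2 a_def)
  also have "\<dots> = (LINT y|unit_space. (A y - a) * g y)"
    by (subst Bochner_Integration.integral_diff[symmetric])
      (auto intro!: integrable_unit_continuous continuous_intros cA g(1) simp: algebra_simps)
  also have "norm \<dots> \<le> (LINT y|unit_space. norm ((A y - a) * g y))"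
    by (rule integral_norm_bound)
  also have "\<dots> \<le> (LINT y|unit_space. K / real m * norm (g y))"
    by (intro integral_mono integrable_unit_continuous continuous_intros cA g(1))
      (simp only: norm_mult, intro mult_right_mono dev, auto)
  finally show ?thesis by simp
qed

text \<open>Induction splits off the factor with the last frequency by \<open>mixing\<close>. The
  other factors are bounded by \<open>1\<close>, so the Lipschitz constant of their product is at
  most the sum of the single ones; the error compares this accumulated slope with the next
  frequency.\<close>

lemma mixing_prod:
  fixes f :: "nat \<Rightarrow> real \<Rightarrow> 'a::{real_normed_field,banach,second_countable_topology}"
    and m :: "nat \<Rightarrow> nat"
  assumes cont: "\<And>i. continuous_on UNIV (f i)" and le1: "\<And>i x. norm (f i x) \<le> 1"
    and lip: "\<And>i x y. norm (f i x - f i y) \<le> K i * \<bar>x - y\<bar>"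
    and per: "\<And>i x. f i (x + 1) = f i x" and m: "\<And>i. m i > 0"
  shows "norm ((LINT x|unit_space. (\<Prod>i<n. f i (real (m i) * x))) - (\<Prod>i<n. integral\<^sup>L unit_space (f i)))
    \<le> (\<Sum>i<n. (\<Sum>j<i. K j * real (m j)) / real (m i))"
proof (induction n)
  case 0
  interpret prob_space unit_space by (rule prob_space_unit)
  show ?case using prob_space by simp
next
  case (Suc n)
  interpret prob_space unit_space by (rule prob_space_unit)
  define h where "h x = (\<Prod>i<n. f i (real (m i) * x))" for x
  define Kn where "Kn = (\<Sum>j<n. K j * real (m j))"
  have ch: "continuous_on UNIV h" unfolding h_def
    by (intro continuous_intros continuous_on_compose2[OF cont]) auto
  have lh: "norm (h x - h y) \<le> Kn * \<bar>x - y\<bar>" for x y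
  proof -
    have "norm (h x - h y) \<le> (\<Sum>i<n. norm (f i (real (m i) * x) - f i (real (m i) * y)))"
      unfolding h_def by (rule norm_prod_diff) (auto simp: le1)
    also have "\<dots> \<le> (\<Sum>i<n. K i * real (m i) * \<bar>x - y\<bar>)"
    proof (rule sum_mono)
      fix i
      have "norm (f i (real (m i) * x) - f i (real (m i) * y)) \<le> K i * \<bar>real (m i) * x - real (m i) * y\<bar>"
        by (rule lip)
      also have "\<bar>real (m i) * x - real (m i) * y\<bar> = real (m i) * \<bar>x - y\<bar>"
        by (simp add: abs_mult flip: right_diff_distrib)
      finally show "norm (f i (real (m i) * x) - f i (real (m i) * y)) \<le> K i * real (m i) * \<bar>x - y\<bar>"
        by simp
    qed
    finally show ?thesis by (simp add: Kn_def sum_distrib_right)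
  qed
  have Kn: "Kn \<ge> 0" using lh[of 0 1] norm_ge_zero[of "h 0 - h 1"] by (simp del: norm_ge_zero)
  have f1: "(LINT x|unit_space. norm (f n x)) \<le> 1"
    using norm_integral_unit_le[of "\<lambda>x. norm (f n x)" 1] le1
    by (auto intro!: integrable_unit_continuous continuous_intros cont simp: abs_le_iff)
  have f2: "norm (integral\<^sup>L unit_space (f n)) \<le> 1"
    using integral_norm_bound[of unit_space "f n"] f1 by linarith
  have "norm ((LINT x|unit_space. h x * f n (real (m n) * x)) - integral\<^sup>L unit_space h * integral\<^sup>L unit_space (f n))
    \<le> Kn / real (m n) * (LINT x|unit_space. norm (f n x))"
    by (rule mixing[OF ch lh cont per m])
  also have "\<dots> \<le> Kn / real (m n)"
    using mult_left_mono[OF f1, of "Kn / real (m n)"] Kn by simp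
  finally have 1: "norm ((LINT x|unit_space. h x * f n (real (m n) * x)) - integral\<^sup>L unit_space h * integral\<^sup>L unit_space (f n))
    \<le> Kn / real (m n)" .
  have "norm (integral\<^sup>L unit_space h * integral\<^sup>L unit_space (f n) -
      (\<Prod>i<n. integral\<^sup>L unit_space (f i)) * integral\<^sup>L unit_space (f n))
      = norm (integral\<^sup>L unit_space h - (\<Prod>i<n. integral\<^sup>L unit_space (f i))) * norm (integral\<^sup>L unit_space (f n))"
    by (simp add: norm_mult flip: left_diff_distrib)
  also have "\<dots> \<le> norm (integral\<^sup>L unit_space h - (\<Prod>i<n. integral\<^sup>L unit_space (f i)))"
    using mult_left_mono[OF f2, of "norm (integral\<^sup>L unit_space h - (\<Prod>i<n. integral\<^sup>L unit_space (f i)))"] by simp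
  also have "\<dots> \<le> (\<Sum>i<n. (\<Sum>j<i. K j * real (m j)) / real (m i))"
    using Suc unfolding h_def .
  finally have 2: "norm (integral\<^sup>L unit_space h * integral\<^sup>L unit_space (f n) -
      (\<Prod>i<n. integral\<^sup>L unit_space (f i)) * integral\<^sup>L unit_space (f n))
      \<le> (\<Sum>i<n. (\<Sum>j<i. K j * real (m j)) / real (m i))" .
  show ?case
    using norm_diff_triangle_le[OF 1 2] by (simp add: h_def Kn_def)
qed

lemma integral_unit_scale:
  fixes g :: "real \<Rightarrow> 'a::{real_normed_field,banach,second_countable_topology}"
  assumes g: "continuous_on UNIV g" "\<And>x. g (x + 1) = g x" and m: "m > (0::nat)"
  shows "(LINT x|unit_space. g (real m * x)) = integral\<^sup>L unit_space g"
proof -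
  interpret prob_space unit_space by (rule prob_space_unit)
  show ?thesis using mixing[where h = "\<lambda>_. 1" and K = 0, OF _ _ g m] prob_space by simp
qed

subsection \<open>The Dirichlet kernel\<close>

definition dirichlet :: "nat \<Rightarrow> real \<Rightarrow> real" where
  "dirichlet r y = (\<Sum>j=1..r. cos (2 * pi * real j * y))"

lemma continuous_on_dirichlet [continuous_intros]:
  fixes f :: "'a::t2_space \<Rightarrow> real"
  shows "continuous_on A f \<Longrightarrow> continuous_on A (\<lambda>x. dirichlet r (f x))"
  unfolding dirichlet_def by (auto intro!: continuous_intros)

lemma borel_measurable_dirichlet [measurable]: "dirichlet r \<in> borel_measurable borel"
  by (intro borel_measurable_continuous_onI continuous_intros)

lemma cos_2pi_periodic: "cos (2 * pi * real j * (y + 1)) = cos (2 * pi * real j * y)"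
proof -
  have "2 * pi * real j * (y + 1) = 2 * pi * real j * y + 2 * real j * pi" by (simp add: algebra_simps)
  thus ?thesis by (simp only: cos_add sin_2npi cos_2npi mult_1_right mult_zero_right diff_0_right)
qed

lemma dirichlet_periodic [simp]: "dirichlet r (y + 1) = dirichlet r y"
  by (simp only: dirichlet_def cos_2pi_periodic)

lemma dirichlet_minus [simp]: "dirichlet r (- y) = dirichlet r y"
  by (simp add: dirichlet_def)

lemma dirichlet_reflect [simp]: "dirichlet r (1 - y) = dirichlet r y"
  using dirichlet_periodic[of r "-y"] by (simp add: add.commute)

lemma abs_dirichlet_le: "\<bar>dirichlet r y\<bar> \<le> real r"
proof -
  have "\<bar>dirichlet r y\<bar> \<le> (\<Sum>j=1..r. 1)"
    unfolding dirichlet_def by (rule order_trans[OF sum_abs]) (rule sum_mono, simp)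
  thus ?thesis by simp
qed

lemma abs_cos_diff_le: "\<bar>cos x - cos y\<bar> \<le> \<bar>x - y\<bar>" for x y :: real
proof -
  have "\<bar>cos x - cos y\<bar> = \<bar>2 * sin ((x + y) / 2) * sin ((y - x) / 2)\<bar>"
    by (simp add: cos_diff_cos)
  also have "\<dots> \<le> 2 * 1 * \<bar>(y - x) / 2\<bar>"
    unfolding abs_mult by (intro mult_mono abs_sin_x_le_abs_x) auto
  finally show ?thesis by simp
qed

text \<open>The quadratic constant is the origin of the weights \<open>m * r^2\<close> in the growth
  conditions for the bases.\<close>

lemma dirichlet_lipschitz: "\<bar>dirichlet r x - dirichlet r y\<bar> \<le> 2 * pi * real (r\<^sup>2) * \<bar>x - y\<bar>"
proof -
  have "\<bar>dirichlet r x - dirichlet r y\<bar> \<le> (\<Sum>j=1..r. \<bar>cos (2 * pi * real j * x) - cos (2 * pi * real j * y)\<bar>)"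
    unfolding dirichlet_def by (simp add: sum_abs flip: sum_subtractf)
  also have "\<dots> \<le> (\<Sum>j=1..r. 2 * pi * real r * \<bar>x - y\<bar>)"
  proof (rule sum_mono)
    fix j assume j: "j \<in> {1..r}"
    have "\<bar>cos (2 * pi * real j * x) - cos (2 * pi * real j * y)\<bar> \<le> \<bar>2 * pi * real j * x - 2 * pi * real j * y\<bar>"
      by (rule abs_cos_diff_le)
    also have "\<dots> = 2 * pi * real j * \<bar>x - y\<bar>" by (simp add: abs_mult flip: right_diff_distrib)
    also have "\<dots> \<le> 2 * pi * real r * \<bar>x - y\<bar>" using j by (intro mult_right_mono mult_left_mono) auto
    finally show "\<bar>cos (2 * pi * real j * x) - cos (2 * pi * real j * y)\<bar> \<le> 2 * pi * real r * \<bar>x - y\<bar>" .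
  qed
  finally show ?thesis by (simp add: power2_eq_square algebra_simps)
qed

text \<open>Kept as a product, without division by \<open>sin (pi * y)\<close>, so that it
  telescopes and holds also at the integers.\<close>

lemma dirichlet_closed: "2 * sin (pi * y) * dirichlet r y = sin ((2 * real r + 1) * pi * y) - sin (pi * y)"
proof (induction r)
  case (Suc r)
  have "sin (2 * pi * real (Suc r) * y + pi * y) - sin (2 * pi * real (Suc r) * y - pi * y) =
      2 * sin (pi * y) * cos (2 * pi * real (Suc r) * y)"
    unfolding sin_add sin_diff by simp
  moreover have "2 * pi * real (Suc r) * y + pi * y = (2 * real r + 3) * pi * y"
    "2 * pi * real (Suc r) * y - pi * y = (2 * real r + 1) * pi * y" by (simp_all add: algebra_simps)
  ultimately have "sin ((2 * real r + 3) * pi * y) - sin ((2 * real r + 1) * pi * y) =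
      2 * sin (pi * y) * cos (2 * pi * real (Suc r) * y)" by simp
  thus ?case using Suc by (simp add: dirichlet_def algebra_simps)
qed (simp add: dirichlet_def)

lemma jordan_sin: "2 * y \<le> sin (pi * y)" if "0 \<le> y" "y \<le> 1 / 2" for y :: real
proof -
  have "concave_on {0..pi} sin"
    by (rule f''_le0_imp_concave[where f' = cos and f'' = "\<lambda>x. - sin x"])
      (auto intro!: derivative_eq_intros sin_ge_zero)
  hence "(1 - 2 * y) * sin 0 + 2 * y * sin (pi / 2) \<le> sin ((1 - 2 * y) *\<^sub>R 0 + (2 * y) *\<^sub>R (pi / 2))"
    using that pi_gt_zero by (intro concave_onD[of "{0..pi}"]) auto
  thus ?thesis by (simp add: mult.commute)
qed

text \<open>The bound does not depend on \<open>r\<close>. It controls kernels of any length away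
  from the integers, which is what makes unfinished and exponentially long blocks harmless.\<close>

lemma abs_dirichlet_le_inverse:
  assumes "0 < y" "y \<le> 1 / 2"
  shows "\<bar>dirichlet r y\<bar> \<le> 1 / (2 * y)"
proof -
  have s: "2 * y \<le> sin (pi * y)" using jordan_sin assms by simp
  have "\<bar>2 * sin (pi * y) * dirichlet r y\<bar> \<le> 1 + 1"
    unfolding dirichlet_closed by (rule order_trans[OF abs_triangle_ineq4 add_mono]) auto
  hence "sin (pi * y) * \<bar>dirichlet r y\<bar> \<le> 1" using s assms by (simp add: abs_mult)
  moreover have "2 * y * \<bar>dirichlet r y\<bar> \<le> sin (pi * y) * \<bar>dirichlet r y\<bar>"
    using s by (intro mult_right_mono) auto
  ultimately show ?thesis using assms by (simp add: field_simps)
qed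

lemma integral_unit_cos:
  assumes "k \<noteq> (0::int)"
  shows "(LINT x|unit_space. cos (2 * pi * real_of_int k * x)) = 0"
proof -
  have "(LBINT x=0..1. cos (2 * pi * real_of_int k * x)) =
      sin (2 * pi * real_of_int k * 1) / (2 * pi * real_of_int k) -
      sin (2 * pi * real_of_int k * 0) / (2 * pi * real_of_int k)"
    unfolding zero_ereal_def one_ereal_def
    by (rule interval_integral_FTC_finite)
      (use assms in \<open>auto intro!: derivative_eq_intros continuous_intros
        simp flip: has_real_derivative_iff_has_vector_derivative\<close>)
  also have "sin (2 * pi * real_of_int k * 1) = 0"
    using sin_int_2pin[of k] by simp
  finally show ?thesis
    by (simp add: unit_integral_eq interval_integral_Icc[of 0 1] set_lebesgue_integral_def
        zero_ereal_def one_ereal_def)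
qed

lemma integral_unit_cos_cos:
  fixes a b :: nat
  assumes "a > 0" "b > 0"
  shows "(LINT x|unit_space. cos (2 * pi * real a * x) * cos (2 * pi * real b * x)) = (if a = b then 1 / 2 else 0)"
proof -
  interpret prob_space unit_space by (rule prob_space_unit)
  have i: "integrable unit_space (\<lambda>x. cos (2 * pi * real_of_int k * x))" for k
    by (intro integrable_unit_continuous continuous_intros)
  have eq: "cos (2 * pi * real a * x) * cos (2 * pi * real b * x) =
      cos (2 * pi * real_of_int (int a - int b) * x) / 2 + cos (2 * pi * real_of_int (int a + int b) * x) / 2" for x
    by (subst cos_times_cos) (simp add: algebra_simps add_divide_distrib)
  have "(LINT x|unit_space. cos (2 * pi * real a * x) * cos (2 * pi * real b * x)) =
     (LINT x|unit_space. cos (2 * pi * real_of_int (int a - int b) * x)) / 2 +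
     (LINT x|unit_space. cos (2 * pi * real_of_int (int a + int b) * x)) / 2"
    unfolding eq by (subst Bochner_Integration.integral_add) (intro integrable_divide i, intro integrable_divide i, simp)
  also have "(LINT x|unit_space. cos (2 * pi * real_of_int (int a + int b) * x)) = 0"
    using assms by (intro integral_unit_cos) auto
  also have "(LINT x|unit_space. cos (2 * pi * real_of_int (int a - int b) * x)) = (if a = b then 1 else 0)"
    using integral_unit_cos[of "int a - int b"] prob_space by auto
  finally show ?thesis by (auto simp del: mult_eq_if)
qed

lemma integral_unit_cos_sum_sq:
  fixes f :: "'b \<Rightarrow> nat"
  assumes A: "finite A" and inj: "inj_on f A" and pos: "\<And>a. a \<in> A \<Longrightarrow> f a > 0"
  shows "(LINT x|unit_space. (\<Sum>a\<in>A. cos (2 * pi * real (f a) * x))\<^sup>2) = real (card A) / 2"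
proof -
  have "(LINT x|unit_space. (\<Sum>a\<in>A. cos (2 * pi * real (f a) * x))\<^sup>2) =
     (LINT x|unit_space. (\<Sum>a\<in>A. \<Sum>b\<in>A. cos (2 * pi * real (f a) * x) * cos (2 * pi * real (f b) * x)))"
    by (simp add: power2_eq_square sum_product)
  also have "\<dots> = (\<Sum>a\<in>A. \<Sum>b\<in>A. LINT x|unit_space. cos (2 * pi * real (f a) * x) * cos (2 * pi * real (f b) * x))"
    by (subst Bochner_Integration.integral_sum Bochner_Integration.integral_sum;
        (intro Bochner_Integration.integral_sum sum.cong refl)?)
      (auto intro!: integrable_unit_continuous continuous_intros)
  also have "\<dots> = (\<Sum>a\<in>A. \<Sum>b\<in>A. if b = a then 1 / 2 else 0)"
    using pos inj by (intro sum.cong refl) (auto simp: integral_unit_cos_cos inj_on_eq_iff)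
  also have "\<dots> = real (card A) / 2" using A by simp
  finally show ?thesis .
qed

lemma integral_unit_dirichlet: "integral\<^sup>L unit_space (dirichlet r) = 0"
proof -
  have "integral\<^sup>L unit_space (dirichlet r) = (\<Sum>j=1..r. LINT x|unit_space. cos (2 * pi * real j * x))"
    unfolding dirichlet_def
    by (rule Bochner_Integration.integral_sum) (intro integrable_unit_continuous continuous_intros)
  also have "\<dots> = 0" using integral_unit_cos[of "int j" for j] by (intro sum.neutral) auto
  finally show ?thesis .
qed

lemma integral_unit_dirichlet_sq: "(LINT x|unit_space. (dirichlet r x)\<^sup>2) = real r / 2"
  unfolding dirichlet_def using integral_unit_cos_sum_sq[of "{1..r}" "\<lambda>j. j"] by auto

subsection \<open>The Levy measure\<close>

text \<open>The density of \<open>dL\<close>, found by differentiating the two branches of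
  \<open>L\<close>. It vanishes outside \<open>[-1, 1]\<close> and is bounded by
  \<open>1 / (pi * x^2)\<close>.\<close>

definition levy_density :: "real \<Rightarrow> real" where
  "levy_density x = (if 0 < x then sinc_upper x / (pi * x)
    else if x < 0 then sinc_lower (- x) / (pi * (- x)) else 0)"

lemma sinc_upper_set_subset: "(t::real) > 0 \<Longrightarrow> {x. x > 0 \<and> sin x / x \<ge> t} \<subseteq> {0..1 / t}"
proof safe
  fix x :: real assume "t > 0" "x > 0" "t \<le> sin x / x"
  hence "x * t \<le> 1" using sin_le_one[of x] by (simp add: field_simps del: sin_le_one)
  thus "x \<in> {0..1 / t}" using \<open>t > 0\<close> \<open>x > 0\<close> by (simp add: field_simps)
qed

lemma sinc_lower_set_subset: "(t::real) > 0 \<Longrightarrow> {x. x > 0 \<and> sin x / x \<le> - t} \<subseteq> {0..1 / t}"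
proof safe
  fix x :: real assume "t > 0" "x > 0" "sin x / x \<le> - t"
  hence "x * t \<le> 1" using sin_ge_minus_one[of x] by (simp add: field_simps del: sin_ge_minus_one)
  thus "x \<in> {0..1 / t}" using \<open>t > 0\<close> \<open>x > 0\<close> by (simp add: field_simps)
qed

lemma emeasure_sinc_upper: "t > 0 \<Longrightarrow> emeasure lborel {x. x > 0 \<and> sin x / x \<ge> t} = ennreal (sinc_upper t)"
  and sinc_upper_le: "t > 0 \<Longrightarrow> sinc_upper t \<le> 1 / t"
proof -
  assume t: "t > 0"
  have le: "emeasure lborel {x. x > 0 \<and> sin x / x \<ge> t} \<le> ennreal (1 / t)"
    using emeasure_mono[OF sinc_upper_set_subset[OF t], of lborel] t by simp
  show eq: "emeasure lborel {x. x > 0 \<and> sin x / x \<ge> t} = ennreal (sinc_upper t)"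
    unfolding sinc_upper_def using le by (intro emeasure_eq_ennreal_measure) (auto simp: top_unique)
  show "sinc_upper t \<le> 1 / t" using le t unfolding eq by simp
qed

lemma emeasure_sinc_lower: "t > 0 \<Longrightarrow> emeasure lborel {x. x > 0 \<and> sin x / x \<le> - t} = ennreal (sinc_lower t)"
  and sinc_lower_le: "t > 0 \<Longrightarrow> sinc_lower t \<le> 1 / t"
proof -
  assume t: "t > 0"
  have le: "emeasure lborel {x. x > 0 \<and> sin x / x \<le> - t} \<le> ennreal (1 / t)"
    using emeasure_mono[OF sinc_lower_set_subset[OF t], of lborel] t by simp
  show eq: "emeasure lborel {x. x > 0 \<and> sin x / x \<le> - t} = ennreal (sinc_lower t)"
    unfolding sinc_lower_def using le by (intro emeasure_eq_ennreal_measure) (auto simp: top_unique)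
  show "sinc_lower t \<le> 1 / t" using le t unfolding eq by simp
qed

lemma abs_sinc_le_1: "\<bar>sin x / x\<bar> \<le> 1" for x :: real
  using abs_sin_x_le_abs_x[of x] by (cases "x = 0") (auto simp: abs_divide)

lemma sinc_upper_eq_0: "t > 1 \<Longrightarrow> sinc_upper t = 0"
  and sinc_lower_eq_0: "t > 1 \<Longrightarrow> sinc_lower t = 0"
proof -
  assume t: "t > 1"
  have "{x. x > 0 \<and> sin x / x \<ge> t} = {}" "{x. x > 0 \<and> sin x / x \<le> - t} = {}"
  proof -
    have "\<not> sin x / x \<ge> t" "\<not> sin x / x \<le> - t" for x using abs_sinc_le_1[of x] t by linarith+
    thus "{x. x > 0 \<and> sin x / x \<ge> t} = {}" "{x. x > 0 \<and> sin x / x \<le> - t} = {}" by auto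
  qed
  thus "sinc_upper t = 0" "sinc_lower t = 0" unfolding sinc_upper_def sinc_lower_def by (simp_all only: measure_empty)
qed

lemma sinc_upper_nonneg: "sinc_upper t \<ge> 0" and sinc_lower_nonneg: "sinc_lower t \<ge> 0"
  by (simp_all add: sinc_upper_def sinc_lower_def)

lemma borel_measurable_sinc_upper [measurable]: "sinc_upper \<in> borel_measurable borel"
proof -
  have "(\<lambda>t. enn2real (emeasure lborel (Pair t -` {(t, x). x > 0 \<and> sin x / x \<ge> t}))) \<in> borel_measurable (borel::real measure)"
    by measurable
  thus ?thesis by (simp add: sinc_upper_def[abs_def] measure_def vimage_def)
qed

lemma borel_measurable_sinc_lower [measurable]: "sinc_lower \<in> borel_measurable borel"
proof -
  have "(\<lambda>t. enn2real (emeasure lborel (Pair t -` {(t, x). x > 0 \<and> sin x / x \<le> - t}))) \<in> borel_measurable (borel::real measure)"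
    by measurable
  thus ?thesis by (simp add: sinc_lower_def[abs_def] measure_def vimage_def)
qed

lemma borel_measurable_levy_density [measurable]: "levy_density \<in> borel_measurable borel"
  unfolding levy_density_def by measurable

lemma levy_density_nonneg: "levy_density x \<ge> 0"
  by (auto simp: levy_density_def sinc_upper_nonneg sinc_lower_nonneg divide_nonneg_neg
      intro!: divide_nonneg_nonneg divide_nonneg_nonpos mult_nonneg_nonpos)

lemma levy_density_eq_0: "\<bar>x\<bar> > 1 \<Longrightarrow> levy_density x = 0"
  by (auto simp: levy_density_def sinc_upper_eq_0 sinc_lower_eq_0)

lemma levy_density_0 [simp]: "levy_density 0 = 0"
  by (simp add: levy_density_def)

lemma sq_levy_density_le: "x\<^sup>2 * levy_density x \<le> 1 / pi"
proof -
  consider "x > 0" | "x < 0" | "x = 0" by linarith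
  thus ?thesis
  proof cases
    case 1
    have "x * sinc_upper x \<le> 1" using sinc_upper_le[OF 1] 1 by (simp add: field_simps)
    thus ?thesis using 1 by (simp add: levy_density_def power2_eq_square divide_right_mono)
  next
    case 2
    have "- x * sinc_lower (- x) \<le> 1" using sinc_lower_le[of "-x"] 2 by (simp add: field_simps)
    moreover have "x\<^sup>2 * levy_density x = (- x * sinc_lower (- x)) / pi"
      using 2 by (simp add: levy_density_def power2_eq_square)
    ultimately show ?thesis by (metis divide_right_mono pi_ge_zero)
  qed simp
qed

text \<open>A zero of order two at the origin cancels the bound \<open>1 / (pi * x^2)\<close> on the
  density, and the density lives on \<open>[-1, 1]\<close>; the integrand is therefore bounded with
  bounded support.\<close>

lemma integrable_levy_density:
  fixes f :: "real \<Rightarrow> 'a::{banach,second_countable_topology}"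
  assumes [measurable]: "f \<in> borel_measurable borel" and f: "\<And>x. norm (f x) \<le> C * x\<^sup>2"
  shows "integrable lborel (\<lambda>x. levy_density x *\<^sub>R f x)"
proof (rule Bochner_Integration.integrable_bound)
  have C: "C \<ge> 0" using f[of 1] norm_ge_zero[of "f 1"] by (simp del: norm_ge_zero)
  show "integrable lborel (\<lambda>x. C / pi * indicator {-1..1::real} x)"
    by (intro integrable_mult_right) simp
  show "AE x in lborel. norm (levy_density x *\<^sub>R f x) \<le> norm (C / pi * indicator {- 1..1} x :: real)"
  proof (rule AE_I2)
    fix x :: real
    show "norm (levy_density x *\<^sub>R f x) \<le> norm (C / pi * indicator {- 1..1} x :: real)"
    proof (cases "\<bar>x\<bar> > 1")
      case True thus ?thesis by (simp add: levy_density_eq_0)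
    next
      case False
      have "norm (levy_density x *\<^sub>R f x) \<le> levy_density x * (C * x\<^sup>2)"
        using levy_density_nonneg f by (simp add: mult_left_mono)
      also have "\<dots> = C * (x\<^sup>2 * levy_density x)" by simp
      also have "\<dots> \<le> C * (1 / pi)" using C sq_levy_density_le by (rule mult_left_mono[rotated])
      finally show ?thesis using False C by (auto simp: indicator_def)
    qed
  qed
qed measurable

text \<open>The substitution \<open>x = s \<cdot> sin u / u\<close> with \<open>u = s w\<close>: the Levy measure is the image of the
  measure \<open>ds dw / pi\<close> on \<open>(0,1] \<times> (0,\<infinity>)\<close> under \<open>(s, w) \<mapsto> sin (s w) / w\<close>.\<close>

lemma nn_integral_levy_density:
  fixes g :: "real \<Rightarrow> ennreal"
  assumes g [measurable]: "g \<in> borel_measurable borel" and g0: "g 0 = 0"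
  shows "(\<integral>\<^sup>+s. \<integral>\<^sup>+w. indicator {0<..1} s * indicator {0<..} w * g (sin (s * w) / w) \<partial>lborel \<partial>lborel)
    = (\<integral>\<^sup>+x. ennreal (pi * levy_density x) * g x \<partial>lborel)"
proof -
  have "(\<integral>\<^sup>+s. \<integral>\<^sup>+w. indicator {0<..1} s * indicator {0<..} w * g (sin (s * w) / w) \<partial>lborel \<partial>lborel)
     = (\<integral>\<^sup>+s. \<integral>\<^sup>+u. indicator {0<..1} s * indicator {0<..} u * (ennreal (1 / s) * g (s * (sin u / u))) \<partial>lborel \<partial>lborel)"
  proof (rule nn_integral_cong)
    fix s :: real
    show "(\<integral>\<^sup>+w. indicator {0<..1} s * indicator {0<..} w * g (sin (s * w) / w) \<partial>lborel)
     = (\<integral>\<^sup>+u. indicator {0<..1} s * indicator {0<..} u * (ennreal (1 / s) * g (s * (sin u / u))) \<partial>lborel)"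
    proof (cases "0 < s \<and> s \<le> 1")
      case True
      have "(\<integral>\<^sup>+w. indicator {0<..1} s * indicator {0<..} w * g (sin (s * w) / w) \<partial>lborel)
        = ennreal \<bar>1 / s\<bar> * (\<integral>\<^sup>+u. indicator {0<..1} s * indicator {0<..} (0 + 1 / s * u) *
            g (sin (s * (0 + 1 / s * u)) / (0 + 1 / s * u)) \<partial>lborel)"
        using True by (intro nn_integral_real_affine) simp_all
      also have "\<dots> = (\<integral>\<^sup>+u. ennreal (1 / s) * (indicator {0<..1} s * indicator {0<..} u * g (s * (sin u / u))) \<partial>lborel)"
        using True by (subst nn_integral_cmult)
          (simp_all add: indicator_def mult.commute zero_less_divide_iff)
      finally show ?thesis by (simp add: mult_ac)
    qed (auto simp: indicator_def)
  qed
  also have "\<dots> = (\<integral>\<^sup>+u. \<integral>\<^sup>+s. indicator {0<..1} s * indicator {0<..} u * (ennreal (1 / s) * g (s * (sin u / u))) \<partial>lborel \<partial>lborel)"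
    by (rule lborel_pair.Fubini') measurable
  \<comment> \<open>After \<open>w = u / s\<close>, the variable \<open>s\<close> is replaced by
    \<open>x = s * sin u / u\<close> for fixed \<open>u\<close>; the factors \<open>1 / s\<close>
    and \<open>1 / |v|\<close> combine to \<open>1 / |x|\<close>. Where \<open>v = 0\<close> both
    sides vanish, the left by \<open>g 0 = 0\<close>, the right because
    \<open>x / 0 = 0\<close>.\<close>
  also have "\<dots> = (\<integral>\<^sup>+u. \<integral>\<^sup>+x. indicator {0<..} u * indicator {0<..1} (x / (sin u / u)) * (ennreal (1 / \<bar>x\<bar>) * g x) \<partial>lborel \<partial>lborel)"
  proof (rule nn_integral_cong)
    fix u :: real
    define v where "v = sin u / u"
    have "(\<integral>\<^sup>+s. indicator {0<..1} s * indicator {0<..} u * (ennreal (1 / s) * g (s * v)) \<partial>lborel) =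
      (\<integral>\<^sup>+x. indicator {0<..} u * indicator {0<..1} (x / v) * (ennreal (1 / \<bar>x\<bar>) * g x) \<partial>lborel)"
    proof (cases "v = 0")
      case False
      have "(\<integral>\<^sup>+s. indicator {0<..1} s * indicator {0<..} u * (ennreal (1 / s) * g (s * v)) \<partial>lborel)
         = ennreal \<bar>1 / v\<bar> * (\<integral>\<^sup>+x. indicator {0<..1} (0 + 1 / v * x) * indicator {0<..} u *
             (ennreal (1 / (0 + 1 / v * x)) * g ((0 + 1 / v * x) * v)) \<partial>lborel)"
        using False by (intro nn_integral_real_affine) simp_all
      also have "\<dots> = (\<integral>\<^sup>+x. ennreal \<bar>1 / v\<bar> * (indicator {0<..1} (x / v) * indicator {0<..} u *
             (ennreal (v / x) * g x)) \<partial>lborel)"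
        using False by (subst nn_integral_cmult) simp_all
      also have "\<dots> = (\<integral>\<^sup>+x. indicator {0<..} u * indicator {0<..1} (x / v) * (ennreal (1 / \<bar>x\<bar>) * g x) \<partial>lborel)"
      proof (rule nn_integral_cong)
        fix x :: real
        show "ennreal \<bar>1 / v\<bar> * (indicator {0<..1} (x / v) * indicator {0<..} u * (ennreal (v / x) * g x)) =
          indicator {0<..} u * indicator {0<..1} (x / v) * (ennreal (1 / \<bar>x\<bar>) * g x)"
        proof (cases "x / v > 0")
          case True
          hence "v / x > 0" by (auto simp: zero_less_divide_iff)
          have "ennreal \<bar>1 / v\<bar> * ennreal (v / x) = ennreal (\<bar>1 / v\<bar> * (v / x))"
            using \<open>v / x > 0\<close> by (intro ennreal_mult'[symmetric]) auto
          also have "\<bar>1 / v\<bar> * (v / x) = 1 / \<bar>x\<bar>"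
            using True by (auto simp: zero_less_divide_iff)
          finally have "ennreal \<bar>1 / v\<bar> * ennreal (v / x) = ennreal (1 / \<bar>x\<bar>)" .
          show ?thesis
            unfolding \<open>ennreal \<bar>1 / v\<bar> * ennreal (v / x) = ennreal (1 / \<bar>x\<bar>)\<close>[symmetric] by (simp only: mult_ac)
        qed auto
      qed
      finally show ?thesis .
    qed (simp add: g0)
    thus "(\<integral>\<^sup>+s. indicator {0<..1} s * indicator {0<..} u * (ennreal (1 / s) * g (s * (sin u / u))) \<partial>lborel) =
      (\<integral>\<^sup>+x. indicator {0<..} u * indicator {0<..1} (x / (sin u / u)) * (ennreal (1 / \<bar>x\<bar>) * g x) \<partial>lborel)"
      by (simp add: v_def)
  qed
  also have "\<dots> = (\<integral>\<^sup>+x. \<integral>\<^sup>+u. indicator {0<..} u * indicator {0<..1} (x / (sin u / u)) * (ennreal (1 / \<bar>x\<bar>) * g x) \<partial>lborel \<partial>lborel)"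
    by (rule lborel_pair.Fubini') measurable
  also have "\<dots> = (\<integral>\<^sup>+x. ennreal (pi * levy_density x) * g x \<partial>lborel)"
  proof (rule nn_integral_cong)
    fix x :: real
    have "(\<integral>\<^sup>+u. indicator {0<..} u * indicator {0<..1} (x / (sin u / u)) * (ennreal (1 / \<bar>x\<bar>) * g x) \<partial>lborel) =
       (\<integral>\<^sup>+u. (ennreal (1 / \<bar>x\<bar>) * g x) * indicator {u. u > 0 \<and> 0 < x / (sin u / u) \<and> x / (sin u / u) \<le> 1} u \<partial>lborel)"
      by (rule nn_integral_cong) (auto simp: indicator_def)
    also have "\<dots> = (ennreal (1 / \<bar>x\<bar>) * g x) * emeasure lborel {u. u > 0 \<and> 0 < x / (sin u / u) \<and> x / (sin u / u) \<le> 1}"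
      by (rule nn_integral_cmult_indicator) measurable
    also have "\<dots> = ennreal (pi * levy_density x) * g x"
    proof -
      \<comment> \<open>\<open>x / v\<close> lies in \<open>(0, 1]\<close> exactly if
        \<open>v\<close> has the sign of \<open>x\<close> and is at least as large in modulus. The
        admissible \<open>u\<close> thus form the level set measured by \<open>sinc_upper\<close> or
        \<open>sinc_lower\<close>.\<close>
      consider "x > 0" | "x < 0" | "x = 0" by linarith
      thus ?thesis
      proof cases
        case 1
        have "0 < x / v \<and> x / v \<le> 1 \<longleftrightarrow> x \<le> v" for v
          using 1 by (auto simp: zero_less_divide_iff divide_le_eq_1)
        hence "{u. u > 0 \<and> 0 < x / (sin u / u) \<and> x / (sin u / u) \<le> 1} = {u. u > 0 \<and> sin u / u \<ge> x}"
          by (simp only:)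
        with 1 have e: "emeasure lborel {u. u > 0 \<and> 0 < x / (sin u / u) \<and> x / (sin u / u) \<le> 1} = ennreal (sinc_upper x)"
          by (simp only: emeasure_sinc_upper)
        have p: "ennreal (1 / \<bar>x\<bar>) * ennreal (sinc_upper x) = ennreal (pi * levy_density x)"
          using 1 sinc_upper_nonneg by (subst ennreal_mult'[symmetric]) (auto simp: levy_density_def)
        show ?thesis unfolding e p[symmetric] by (simp only: mult_ac)
      next
        case 2
        have "0 < x / v \<and> x / v \<le> 1 \<longleftrightarrow> v \<le> x" for v
          using 2 by (auto simp: zero_less_divide_iff divide_le_eq_1)
        hence "{u. u > 0 \<and> 0 < x / (sin u / u) \<and> x / (sin u / u) \<le> 1} = {u. u > 0 \<and> sin u / u \<le> - (- x)}"
          by (simp only: minus_minus)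
        with 2 have e: "emeasure lborel {u. u > 0 \<and> 0 < x / (sin u / u) \<and> x / (sin u / u) \<le> 1} = ennreal (sinc_lower (- x))"
          using emeasure_sinc_lower[of "- x"] by simp
        have p: "ennreal (1 / \<bar>x\<bar>) * ennreal (sinc_lower (- x)) = ennreal (pi * levy_density x)"
          using 2 sinc_lower_nonneg by (subst ennreal_mult'[symmetric]) (auto simp: levy_density_def)
        show ?thesis unfolding e p[symmetric] by (simp only: mult_ac)
      qed (simp add: g0)
    qed
    finally show "(\<integral>\<^sup>+u. indicator {0<..} u * indicator {0<..1} (x / (sin u / u)) * (ennreal (1 / \<bar>x\<bar>) * g x) \<partial>lborel) =
      ennreal (pi * levy_density x) * g x" .
  qed
  finally show ?thesis .
qed

text \<open>The formula for nonnegative functions, applied to indicators, identifies the image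
  measure; Bochner integrals of vector-valued functions are then transported along it.\<close>

lemma integral_levy_density:
  fixes f :: "real \<Rightarrow> 'a::{banach,second_countable_topology}"
  assumes f [measurable]: "f \<in> borel_measurable borel" and f0: "f 0 = 0"
  shows "(LINT p|(lborel \<Otimes>\<^sub>M lborel). indicator ({0<..1} \<times> {0<..}) p *\<^sub>R f (sin (fst p * snd p) / snd p))
    = pi *\<^sub>R (LINT x|lborel. levy_density x *\<^sub>R f x)"
proof -
  define q :: "real \<times> real \<Rightarrow> real" where "q p = sin (fst p * snd p) / snd p" for p
  \<comment> \<open>Points with \<open>q p = 0\<close> are removed so that the indicator of
    \<open>A - {0}\<close> can serve as \<open>g\<close>, which has to vanish at \<open>0\<close>.
    Nothing is lost, since \<open>f 0 = 0\<close>.\<close>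
  define d :: "real \<times> real \<Rightarrow> real" where
    "d p = indicator ({0<..1} \<times> {0<..}) p * indicator (- {0}) (q p)" for p
  have [measurable]: "q \<in> borel_measurable (lborel \<Otimes>\<^sub>M lborel)" unfolding q_def by measurable
  have [measurable]: "{0<..1::real} \<times> ({0<..} :: real set) \<in> sets (lborel \<Otimes>\<^sub>M lborel)" by (rule pair_measureI) auto
  have [measurable]: "d \<in> borel_measurable (lborel \<Otimes>\<^sub>M lborel)" unfolding d_def by measurable
  have eq: "distr (density (lborel \<Otimes>\<^sub>M lborel) d) borel q = density lborel (\<lambda>x. ennreal (pi * levy_density x))"
  proof (rule measure_eqI)
    show "sets (distr (density (lborel \<Otimes>\<^sub>M lborel) (\<lambda>x. ennreal (d x))) borel q) =
       sets (density lborel (\<lambda>x. ennreal (pi * levy_density x)))" by simp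
    fix A assume "A \<in> sets (distr (density (lborel \<Otimes>\<^sub>M lborel) (\<lambda>x. ennreal (d x))) borel q)"
    hence A [measurable]: "A \<in> sets borel" by simp
    have "emeasure (distr (density (lborel \<Otimes>\<^sub>M lborel) d) borel q) A =
       emeasure (density (lborel \<Otimes>\<^sub>M lborel) d) (q -` A \<inter> space (lborel \<Otimes>\<^sub>M lborel))"
      by (subst emeasure_distr) (auto simp: space_pair_measure)
    also have "\<dots> = (\<integral>\<^sup>+p. ennreal (d p) * indicator (q -` A \<inter> space (lborel \<Otimes>\<^sub>M lborel)) p \<partial>(lborel \<Otimes>\<^sub>M lborel))"
      by (rule emeasure_density) measurable
    also have "\<dots> = (\<integral>\<^sup>+p. indicator {0<..1} (fst p) * indicator {0<..} (snd p) * indicator (A - {0}) (sin (fst p * snd p) / snd p)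
        \<partial>(lborel \<Otimes>\<^sub>M lborel))"
      by (rule nn_integral_cong) (auto simp: d_def q_def indicator_def space_pair_measure)
    also have "\<dots> = (\<integral>\<^sup>+s. \<integral>\<^sup>+w. indicator {0<..1} s * indicator {0<..} w * indicator (A - {0}) (sin (s * w) / w) \<partial>lborel \<partial>lborel)"
      by (subst lborel.nn_integral_fst[symmetric]) simp_all
    also have "\<dots> = (\<integral>\<^sup>+x. ennreal (pi * levy_density x) * indicator (A - {0}) x \<partial>lborel)"
      by (rule nn_integral_levy_density) auto
    also have "\<dots> = (\<integral>\<^sup>+x. ennreal (pi * levy_density x) * indicator A x \<partial>lborel)"
      by (rule nn_integral_cong) (auto simp: indicator_def)
    also have "\<dots> = emeasure (density lborel (\<lambda>x. ennreal (pi * levy_density x))) A"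
      by (rule emeasure_density[symmetric]) auto
    finally show "emeasure (distr (density (lborel \<Otimes>\<^sub>M lborel) d) borel q) A = \<dots>" .
  qed
  have "pi *\<^sub>R (LINT x|lborel. levy_density x *\<^sub>R f x) = (LINT x|lborel. (pi * levy_density x) *\<^sub>R f x)"
    by (simp flip: integral_scaleR_right)
  also have "\<dots> = (LINT x|density lborel (\<lambda>x. ennreal (pi * levy_density x)). f x)"
    by (rule integral_density[symmetric]) (auto simp: levy_density_nonneg)
  also have "\<dots> = (LINT p|density (lborel \<Otimes>\<^sub>M lborel) d. f (q p))"
    unfolding eq[symmetric] by (rule integral_distr) auto
  also have "\<dots> = (LINT p|(lborel \<Otimes>\<^sub>M lborel). d p *\<^sub>R f (q p))"
    by (rule integral_density) (auto simp: d_def)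
  also have "\<dots> = (LINT p|(lborel \<Otimes>\<^sub>M lborel). indicator ({0<..1} \<times> {0<..}) p *\<^sub>R f (sin (fst p * snd p) / snd p))"
    by (rule Bochner_Integration.integral_cong) (auto simp: d_def q_def f0 indicator_def)
  finally show ?thesis by simp
qed

section \<open>The Stieltjes measure of \<open>L\<close> on the punctured line\<close>

lemma set_integrable_levy_density:
  assumes [measurable]: "A \<in> sets borel" and A: "\<And>x. x \<in> A \<Longrightarrow> c \<le> \<bar>x\<bar>" and c: "c > 0"
  shows "set_integrable lborel A levy_density"
proof -
  have "integrable lborel (\<lambda>x. levy_density x *\<^sub>R (indicator A x :: real))"
  proof (rule integrable_levy_density)
    fix x :: real
    show "norm (indicator A x :: real) \<le> 1 / c\<^sup>2 * x\<^sup>2"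
    proof (cases "x \<in> A")
      case True
      hence "c\<^sup>2 \<le> x\<^sup>2" using A[of x] c by (metis abs_of_pos abs_le_square_iff)
      thus ?thesis using c True by (simp add: field_simps)
    qed auto
  qed measurable
  thus ?thesis by (simp add: set_integrable_def mult.commute)
qed

lemma L_pos:
  assumes "x > 0"
  shows "L x = - (LINT t:{x<..}|lborel. levy_density t)"
proof (cases "x \<le> 1")
  case True
  have "(LINT t:{x<..}|lborel. levy_density t) = (LINT t|lborel. (1 / pi) * (indicator {x..1} t *\<^sub>R (sinc_upper t / t)))"
    unfolding set_lebesgue_integral_def
  proof (rule integral_cong_AE)
    show "AE t in lborel. indicator {x<..} t *\<^sub>R levy_density t = (1 / pi) * (indicator {x..1} t *\<^sub>R (sinc_upper t / t))"
      using AE_lborel_singleton[of x]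
    proof eventually_elim
      case (elim t)
      thus ?case using assms by (auto simp: indicator_def levy_density_def sinc_upper_eq_0)
    qed
  qed measurable
  also have "\<dots> = (1 / pi) * (LBINT t:{x..1}. sinc_upper t / t)"
    unfolding set_lebesgue_integral_def by (rule integral_mult_right_zero)
  finally show ?thesis using assms True by (simp add: L_def)
next
  case False
  have "(LINT t:{x<..}|lborel. levy_density t) = (LINT t:{x<..}|lborel. 0)"
    using False by (intro set_lebesgue_integral_cong) (auto simp: levy_density_eq_0)
  thus ?thesis using False assms by (simp add: L_def)
qed

lemma L_neg:
  assumes "x < 0"
  shows "L x = (LINT t:{..x}|lborel. levy_density t)"
proof (cases "- 1 \<le> x")
  case True
  have "(LBINT t:{-x..1}. sinc_lower t / t) = (LINT y|lborel. indicator {-x..1} (- y) *\<^sub>R (sinc_lower (- y) / (- y)))"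
    unfolding set_lebesgue_integral_def
    by (subst lborel_integral_real_affine[where c = "-1" and t = 0]) auto
  also have "\<dots> = (LINT y|lborel. pi * (indicator {..x} y *\<^sub>R levy_density y))"
    using assms True
    by (intro Bochner_Integration.integral_cong) (auto simp: indicator_def levy_density_def sinc_lower_eq_0)
  finally show ?thesis using assms True by (simp add: L_def set_lebesgue_integral_def)
next
  case False
  have "(LINT t:{..x}|lborel. levy_density t) = (LINT t:{..x}|lborel. 0)"
    using False by (intro set_lebesgue_integral_cong) (auto simp: levy_density_eq_0)
  thus ?thesis using False assms by (simp add: L_def)
qed

lemma emeasure_levy_Ioc:
  assumes ab: "a \<le> b" "0 < a \<or> b < 0"
  shows "emeasure (density lborel (\<lambda>x. ennreal (levy_density x))) {a<..b} = ennreal (L b - L a)"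
proof -
  have "L b - L a = (LINT t:{a<..b}|lborel. levy_density t)"
  proof (cases "0 < a")
    case True
    have un: "{a<..} = {a<..b} \<union> {b<..}" using ab by auto
    have "(LINT t:{a<..}|lborel. levy_density t) =
        (LINT t:{a<..b}|lborel. levy_density t) + (LINT t:{b<..}|lborel. levy_density t)"
      unfolding un by (rule set_integral_Un)
        (use True ab in \<open>auto intro!: set_integrable_levy_density[of _ a]\<close>)
    thus ?thesis using True ab by (simp add: L_pos)
  next
    case False
    hence b: "b < 0" using ab by auto
    have un: "{..b} = {..a} \<union> {a<..b}" using ab by auto
    have "(LINT t:{..b}|lborel. levy_density t) =
        (LINT t:{..a}|lborel. levy_density t) + (LINT t:{a<..b}|lborel. levy_density t)"
      unfolding un by (rule set_integral_Un)
        (use b ab in \<open>auto intro!: set_integrable_levy_density[of _ "- b"]\<close>)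
    thus ?thesis using b ab by (simp add: L_neg)
  qed
  moreover have "set_integrable lborel {a<..b} levy_density"
    using ab by (intro set_integrable_levy_density[where c = "if 0 < a then a else - b"]) auto
  hence "(\<integral>\<^sup>+x. ennreal (indicator {a<..b} x *\<^sub>R levy_density x) \<partial>lborel) = ennreal (LINT t:{a<..b}|lborel. levy_density t)"
    unfolding set_integrable_def set_lebesgue_integral_def
    by (intro nn_integral_eq_integral) (auto simp: levy_density_nonneg)
  moreover have "(\<integral>\<^sup>+x. ennreal (indicator {a<..b} x *\<^sub>R levy_density x) \<partial>lborel) =
      emeasure (density lborel (\<lambda>x. ennreal (levy_density x))) {a<..b}"
    by (subst emeasure_density) (auto intro!: nn_integral_cong simp: indicator_def)
  ultimately show ?thesis by simp
qed

abbreviation punctured_Ioc :: "real set set" where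
  "punctured_Ioc \<equiv> (\<lambda>(a, b). {a<..b}) ` {(a, b). a \<le> b \<and> (0 < a \<or> b < 0)}"

lemma punctured_IocI: "0 < a \<or> b < 0 \<Longrightarrow> {a<..b} \<in> punctured_Ioc"
proof (cases "a \<le> b")
  case False
  \<comment> \<open>The empty interval needs a representation that meets the side condition.\<close>
  have "{a<..b} = {1<..1::real}" using False by auto
  thus ?thesis by (force intro!: image_eqI[where x = "(1, 1)"])
qed (force intro!: image_eqI[where x = "(a, b)"])

text \<open>A countable cover by intervals that stay away from \<open>0\<close> and hence have
  finite mass. It serves both the generated sigma-algebra and the uniqueness of the measure.\<close>

lemma punctured_line_decomp: "UNIV - {0::real} = (\<Union>n. {- (real n + 1)<..- 1 / (real n + 1)}) \<union> (\<Union>n. {1 / (real n + 1)<..real n + 1})"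
proof -
  have "\<exists>n. 1 / (real n + 1) < x \<and> x \<le> real n + 1" if "x > 0" for x :: real
  proof -
    obtain n where n: "x + 1 / x < real n" using reals_Archimedean2 by blast
    moreover have "0 < 1 / x" using that by simp
    ultimately have "1 / x < real n + 1" "x \<le> real n + 1" using that by linarith+
    thus ?thesis using that by (intro exI[of _ n]) (auto simp: field_simps)
  qed
  note A = this
  have B: "\<exists>n. - (real n + 1) < x \<and> x \<le> - 1 / (real n + 1)" if "x < 0" for x :: real
  proof -
    obtain n where n: "- x + 1 / (- x) < real n" using reals_Archimedean2 by blast
    moreover have "0 < 1 / (- x)" using that by simp
    ultimately have "1 / (- x) < real n + 1" "- x < real n + 1" using that by linarith+
    thus ?thesis using that by (intro exI[of _ n]) (auto simp: field_simps)
  qed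
  have C: "x \<noteq> 0" if "1 / (real n + 1) < x" for x n
  proof -
    have "0 < 1 / (real n + 1)" by simp
    thus ?thesis using that by linarith
  qed
  have D: "x \<noteq> 0" if "x \<le> - 1 / (real n + 1)" for x n
  proof -
    have "0 < 1 / (real n + 1)" by simp
    moreover have "- 1 / (real n + 1) = - (1 / (real n + 1))" by simp
    ultimately show ?thesis using that by linarith
  qed
  show ?thesis
  proof (intro equalityI subsetI)
    fix x :: real assume "x \<in> UNIV - {0}"
    hence "x > 0 \<or> x < 0" by auto
    thus "x \<in> (\<Union>n. {- (real n + 1)<..- 1 / (real n + 1)}) \<union> (\<Union>n. {1 / (real n + 1)<..real n + 1})"
      using A[of x] B[of x] by (simp only: UN_iff Un_iff greaterThanAtMost_iff UNIV_I) blast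
  next
    fix x :: real
    assume "x \<in> (\<Union>n. {- (real n + 1)<..- 1 / (real n + 1)}) \<union> (\<Union>n. {1 / (real n + 1)<..real n + 1})"
    thus "x \<in> UNIV - {0}"
      using C[of _ x] D[of x] by (simp only: UN_iff Un_iff greaterThanAtMost_iff UNIV_I) blast
  qed
qed

text \<open>Half-lines, restricted to the punctured line and cut along the countable cover, are
  countable unions of generators, so the identity is Borel measurable for the generated
  sigma-algebra.\<close>

lemma sets_punctured_Ioc: "sigma_sets (UNIV - {0}) punctured_Ioc = sets (restrict_space borel (UNIV - {0}))"
proof -
  let ?M = "sigma (UNIV - {0::real}) punctured_Ioc"
  have sub: "punctured_Ioc \<subseteq> Pow (UNIV - {0})" by auto
  have setsM: "sets ?M = sigma_sets (UNIV - {0}) punctured_Ioc" using sub by simp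
  have gen: "{a<..b} \<in> sets ?M" if "0 < a \<or> b < 0" for a b
    unfolding setsM using punctured_IocI[OF that] by (rule sigma_sets.Basic)
  have "(\<lambda>x. x) \<in> borel_measurable ?M"
  proof (subst borel_measurable_iff_le, safe)
    fix c :: real
    have "{w \<in> space ?M. w \<le> c} = (\<Union>n. {- (real n + 1)<..min c (- 1 / (real n + 1))}) \<union> (\<Union>n. {1 / (real n + 1)<..min c (real n + 1)})"
      using punctured_line_decomp sub by (auto simp: set_eq_iff)
    also have "\<dots> \<in> sets ?M"
      by (intro sets.Un sets.countable_UN) (auto intro!: gen divide_neg_pos simp: min_less_iff_disj)
    finally show "{w \<in> space ?M. w \<le> c} \<in> sets ?M" .
  qed
  hence "A \<inter> (UNIV - {0}) \<in> sets ?M" if "A \<in> sets borel" for A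
    using measurable_sets[OF _ that, of "\<lambda>x. x" ?M] sub by auto
  hence "sets (restrict_space borel (UNIV - {0})) \<subseteq> sets ?M"
    by (auto simp: sets_restrict_space Int_commute)
  moreover have "sigma_sets (UNIV - {0}) punctured_Ioc \<subseteq> sets (restrict_space borel (UNIV - {0}))"
  proof -
    have "punctured_Ioc \<subseteq> sets (restrict_space borel (UNIV - {0::real}))"
      by (auto simp: sets_restrict_space_iff)
    thus ?thesis using sets.sigma_sets_subset[of punctured_Ioc "restrict_space borel (UNIV - {0::real})"]
      by (simp add: space_restrict_space)
  qed
  ultimately show ?thesis using setsM by auto
qed

text \<open>\<open>extend_measure\<close> takes the prescribed values as soon as some measure on the
  generated sigma-algebra does. The measure with density \<open>levy_density\<close> is such a
  witness, and uniqueness on an intersection-stable generator with a countable cover of finite mass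
  gives equality.\<close>

lemma punctured_stieltjes_L:
  "punctured_stieltjes L = restrict_space (density lborel (\<lambda>x. ennreal (levy_density x))) (UNIV - {0})"
    (is "?P = ?N")
proof -
  have sub: "punctured_Ioc \<subseteq> Pow (UNIV - {0})" by auto
  have setsP: "sets ?P = sigma_sets (UNIV - {0}) punctured_Ioc"
    unfolding punctured_stieltjes_def by (rule sets_extend_measure[OF sub])
  have setsN: "sets ?N = sigma_sets (UNIV - {0}) punctured_Ioc"
    by (subst sets_punctured_Ioc) (rule sets_restrict_space_cong, simp)
  have N: "emeasure ?N {a<..b} = ennreal (L b - L a)" if "a \<le> b" "0 < a \<or> b < 0" for a b
    using emeasure_levy_Ioc[OF that] that by (subst emeasure_restrict_space) auto
  have P: "emeasure ?P {a<..b} = ennreal (L b - L a)" if "a \<le> b" "0 < a \<or> b < 0" for a b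
  proof (rule emeasure_extend_measure_Pair[where I = "\<lambda>a b. a \<le> b \<and> (0 < a \<or> b < 0)" and
        G = "\<lambda>a b. {a<..b}" and \<mu> = "\<lambda>a b. ennreal (L b - L a)" and \<mu>' = "emeasure ?N" and \<Omega> = "UNIV - {0}"])
    show "positive (sets ?P) (emeasure ?N)" "countably_additive (sets ?P) (emeasure ?N)"
      using emeasure_positive[of ?N] emeasure_countably_additive[of ?N] by (simp_all add: setsP setsN)
  qed (use N that in \<open>auto simp: punctured_stieltjes_def\<close>)
  show ?thesis
  proof (rule measure_eqI_generator_eq_countable[where E = punctured_Ioc and \<Omega> = "UNIV - {0}" and
      A = "range (\<lambda>n. {- (real n + 1)<..- 1 / (real n + 1)}) \<union> range (\<lambda>n. {1 / (real n + 1)<..real n + 1})"])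
    show "Int_stable punctured_Ioc"
    proof (rule Int_stableI)
      fix A B assume "A \<in> punctured_Ioc" "B \<in> punctured_Ioc"
      then obtain a b c d where "A = {a<..b}" "B = {c<..d}" and *: "0 < a \<or> b < 0" by auto
      hence eq: "A \<inter> B = {max a c<..min b d}" by auto
      show "A \<inter> B \<in> punctured_Ioc" unfolding eq using * by (intro punctured_IocI) auto
    qed
    show "sets ?P = sigma_sets (UNIV - {0}) punctured_Ioc" "sets ?N = sigma_sets (UNIV - {0}) punctured_Ioc"
      by (fact setsP setsN)+
    show "emeasure ?P X = emeasure ?N X" if "X \<in> punctured_Ioc" for X
      using that N P by auto
    show "range (\<lambda>n. {- (real n + 1)<..- 1 / (real n + 1)}) \<union> range (\<lambda>n. {1 / (real n + 1)<..real n + 1}) \<subseteq> punctured_Ioc"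
      by (intro Un_least image_subsetI punctured_IocI) (auto intro!: divide_neg_pos)
    show "\<Union> (range (\<lambda>n. {- (real n + 1)<..- 1 / (real n + 1)}) \<union> range (\<lambda>n. {1 / (real n + 1)<..real n + 1})) = UNIV - {0}"
      unfolding punctured_line_decomp by simp
    fix X assume "X \<in> range (\<lambda>n. {- (real n + 1)<..- 1 / (real n + 1)}) \<union> range (\<lambda>n. {1 / (real n + 1)<..real n + 1})"
    hence "X \<in> punctured_Ioc"
      by (elim UnE rangeE, hypsubst) (rule punctured_IocI, auto intro!: divide_neg_pos)+
    thus "emeasure ?P X \<noteq> \<infinity>" using P by auto
  qed (use sub in auto)
qed

subsection \<open>The characteristic exponent\<close>

text \<open>Compensated by \<open>t * x\<close> and not by \<open>t * x / (1 + x^2)\<close>: the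
  Dirichlet kernels have mean \<open>0\<close>, so this is the form in which their characteristic
  functions produce an exponent.\<close>

definition xi :: "real \<Rightarrow> real \<Rightarrow> complex" where
  "xi t x = iexp (t * x) - 1 - \<i> * complex_of_real (t * x)"

definition psi :: "real \<Rightarrow> complex" where
  "psi t = (LINT x|lborel. levy_density x *\<^sub>R xi t x)"

text \<open>The integral of the difference of the two compensators, which is at most
  \<open>x^2\<close> in modulus. It moves from the exponent into the centring of the limit theorem,
  as \<open>b N = - levy_shift\<close>.\<close>

definition levy_shift :: real where
  "levy_shift = (LINT x|lborel. levy_density x *\<^sub>R (x - x / (1 + x\<^sup>2)))"

lemma xi_0 [simp]: "xi t 0 = 0"
  by (simp add: xi_def)

lemma continuous_on_xi [continuous_intros]:
  "continuous_on A f \<Longrightarrow> continuous_on A (\<lambda>x. xi t (f x))"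
  unfolding xi_def by (intro continuous_intros)

lemma borel_measurable_xi [measurable]: "xi t \<in> borel_measurable borel"
  by (intro borel_measurable_continuous_onI continuous_intros)

lemma norm_xi_le: "norm (xi t x) \<le> t\<^sup>2 / 2 * x\<^sup>2"
  using iexp_approx1[of "t * x" 1]
  by (simp add: xi_def power_mult_distrib power2_eq_square abs_mult diff_diff_eq numeral_2_eq_2 mult_ac flip: abs_mult)

lemma G_char_eq: "G_char t = exp (psi t + \<i> * complex_of_real (t * levy_shift))"
proof -
  have "(CLINT x|punctured_stieltjes L. iexp (t * x) - 1 - \<i> * complex_of_real (t * x / (1 + x\<^sup>2))) =
    (CLINT x|density lborel (\<lambda>x. ennreal (levy_density x)).
      indicator (UNIV - {0}) x *\<^sub>R (iexp (t * x) - 1 - \<i> * complex_of_real (t * x / (1 + x\<^sup>2))))"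
    unfolding punctured_stieltjes_L by (rule integral_restrict_space) auto
  also have "\<dots> = (CLINT x|lborel. levy_density x *\<^sub>R
      (indicator (UNIV - {0}) x *\<^sub>R (iexp (t * x) - 1 - \<i> * complex_of_real (t * x / (1 + x\<^sup>2)))))"
    by (rule integral_density) (auto simp: levy_density_nonneg)
  also have "\<dots> = (CLINT x|lborel. levy_density x *\<^sub>R xi t x +
      (\<i> * complex_of_real t) * complex_of_real (levy_density x *\<^sub>R (x - x / (1 + x\<^sup>2))))"
    by (rule Bochner_Integration.integral_cong)
      (auto simp: xi_def indicator_def scaleR_conv_of_real algebra_simps add_divide_distrib)
  also have "\<dots> = psi t + (CLINT x|lborel. (\<i> * complex_of_real t) * complex_of_real (levy_density x *\<^sub>R (x - x / (1 + x\<^sup>2))))"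
    unfolding psi_def
  proof (rule Bochner_Integration.integral_add)
    show "integrable lborel (\<lambda>x. levy_density x *\<^sub>R xi t x)"
      by (rule integrable_levy_density[OF _ norm_xi_le]) simp
    have "integrable lborel (\<lambda>x. levy_density x *\<^sub>R (x - x / (1 + x\<^sup>2)))"
    proof (rule integrable_levy_density)
      fix x :: real
      have p: "1 + x\<^sup>2 > 0" by (simp add: add_pos_nonneg)
      have "x - x / (1 + x\<^sup>2) = x\<^sup>2 * (x / (1 + x\<^sup>2))"
        using p by (simp add: field_simps power2_eq_square)
      moreover have "\<bar>x / (1 + x\<^sup>2)\<bar> \<le> 1"
      proof -
        have "\<bar>x\<bar> \<le> 1 + x\<^sup>2"
          using zero_le_power2[of "\<bar>x\<bar> - 1"] abs_ge_zero[of x] by (simp add: power2_diff del: abs_ge_zero)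
        thus ?thesis using p by (simp add: abs_divide)
      qed
      ultimately show "norm (x - x / (1 + x\<^sup>2)) \<le> 1 * x\<^sup>2"
        by (simp only: real_norm_def abs_mult abs_power2 mult_1 mult_left_le zero_le_power2)
    qed measurable
    thus "integrable lborel (\<lambda>x. (\<i> * complex_of_real t) * complex_of_real (levy_density x *\<^sub>R (x - x / (1 + x\<^sup>2))))"
      by (intro integrable_mult_right integrable_of_real)
  qed
  also have "(CLINT x|lborel. (\<i> * complex_of_real t) * complex_of_real (levy_density x *\<^sub>R (x - x / (1 + x\<^sup>2)))) =
     \<i> * complex_of_real (t * levy_shift)"
    unfolding levy_shift_def by (subst integral_mult_right_zero, subst integral_complex_of_real) (simp only: of_real_mult mult.assoc)
  finally show ?thesis by (simp add: G_char_def)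
qed

subsection \<open>The characteristic exponent as a limit of Dirichlet kernels\<close>

text \<open>Reduces to the half period on which \<open>abs_dirichlet_le_inverse\<close>
  applies.\<close>

lemma integral_unit_symmetric:
  fixes g :: "real \<Rightarrow> 'a::{banach,second_countable_topology}"
  assumes cont: "continuous_on UNIV g" and sym: "\<And>y. g (1 - y) = g y"
  shows "integral\<^sup>L unit_space g = 2 *\<^sub>R (LINT y|lborel. indicator {0<..1/2} y *\<^sub>R g y)"
proof -
  have [measurable]: "g \<in> borel_measurable borel"
    by (rule borel_measurable_continuous_onI[OF cont])
  have i: "integrable lborel (\<lambda>x. indicator {0..1} x *\<^sub>R g x)"
    using integrable_unit_continuous[OF cont] by (simp add: unit_integrable_eq)
  have i1: "integrable lborel (\<lambda>x. indicator A x *\<^sub>R g x)" if "A \<in> sets borel" "A \<subseteq> {0..1}" for A :: "real set"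
  proof -
    have "integrable lborel (\<lambda>x. indicator A x *\<^sub>R (indicator {0..1} x *\<^sub>R g x))"
      using that by (intro integrable_mult_indicator i) auto
    also have "(\<lambda>x. indicator A x *\<^sub>R (indicator {0..1} x *\<^sub>R g x)) = (\<lambda>x. indicator A x *\<^sub>R g x)"
      using that by (fastforce simp: indicator_def)
    finally show ?thesis .
  qed
  have "integral\<^sup>L unit_space g = (LINT y|lborel. indicator {0<..1/2} y *\<^sub>R g y + indicator {1/2<..<1} y *\<^sub>R g y)"
    unfolding unit_integral_eq
  proof (rule integral_cong_AE)
    show "AE x in lborel. indicator {0..1} x *\<^sub>R g x =
        indicator {0<..1/2} x *\<^sub>R g x + indicator {1/2<..<1} x *\<^sub>R g x"
      using AE_lborel_singleton[of 0] AE_lborel_singleton[of 1] by eventually_elim (auto simp: indicator_def)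
  qed measurable
  also have "\<dots> = (LINT y|lborel. indicator {0<..1/2} y *\<^sub>R g y) + (LINT y|lborel. indicator {1/2<..<1} y *\<^sub>R g y)"
    by (intro Bochner_Integration.integral_add i1) auto
  also have "(LINT y|lborel. indicator {1/2<..<1} y *\<^sub>R g y) =
      (LINT y|lborel. indicator {1/2<..<1} (1 + - 1 * y) *\<^sub>R g (1 + - 1 * y))"
    by (subst lborel_integral_real_affine[where c = "-1" and t = 1]) auto
  also have "\<dots> = (LINT y|lborel. indicator {0<..1/2} y *\<^sub>R g y)"
  proof (rule integral_cong_AE)
    show "AE y in lborel. indicator {1/2<..<1} (1 + - 1 * y) *\<^sub>R g (1 + - 1 * y) = indicator {0<..1/2} y *\<^sub>R g y"
      using AE_lborel_singleton[of "1/2"] by eventually_elim (auto simp: indicator_def sym)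
  qed measurable
  finally show ?thesis by (simp add: scaleR_2)
qed

text \<open>Turns the sum over block lengths into an integral over \<open>s\<close>, the length
  being \<open>s * R\<close> rounded up. The limit of the exponents then becomes a single
  application of dominated convergence in two variables.\<close>

lemma integral_unit_step:
  fixes K :: "nat \<Rightarrow> 'a::{banach,second_countable_topology}"
  assumes R: "R > (0::nat)"
  shows "(LINT s|unit_space. K (nat \<lceil>s * real R\<rceil>)) = (1 / real R) *\<^sub>R (\<Sum>j<R. K (Suc j))"
proof -
  interpret prob_space unit_space by (rule prob_space_unit)
  have meas: "(\<lambda>s. K (nat \<lceil>s * real R\<rceil>)) \<in> borel_measurable borel"
    by (rule measurable_compose[of "\<lambda>s. nat \<lceil>s * real R\<rceil>" _ "count_space UNIV"]) measurable
  have "integrable unit_space (\<lambda>s. K (nat \<lceil>s * real R\<rceil>))"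
  proof (rule integrable_const_bound[where B = "\<Sum>k\<le>R. norm (K k)"])
    have "norm (K (nat \<lceil>s * real R\<rceil>)) \<le> (\<Sum>k\<le>R. norm (K k))" if "s \<in> {0..1}" for s
    proof (rule member_le_sum)
      have "s * real R \<le> 1 * real R" using that by (intro mult_right_mono) auto
      thus "nat \<lceil>s * real R\<rceil> \<in> {..R}" by (simp add: nat_le_iff ceiling_le_iff)
    qed auto
    thus "AE s in unit_space. norm (K (nat \<lceil>s * real R\<rceil>)) \<le> (\<Sum>k\<le>R. norm (K k))"
      by (intro AE_I2) simp
  qed (use meas in \<open>rule borel_measurable_unit\<close>)
  hence "(LINT s|unit_space. K (nat \<lceil>s * real R\<rceil>)) =
      (1 / real R) *\<^sub>R (\<Sum>j<R. LINT y|unit_space. K (nat \<lceil>(real j + y) / real R * real R\<rceil>))"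
    by (rule integral_unit_split[OF _ R])
  also have "(\<Sum>j<R. LINT y|unit_space. K (nat \<lceil>(real j + y) / real R * real R\<rceil>)) = (\<Sum>j<R. K (Suc j))"
  proof (rule sum.cong[OF refl])
    fix j
    have "(LINT y|unit_space. K (nat \<lceil>(real j + y) / real R * real R\<rceil>)) = (LINT y|unit_space. K (Suc j))"
      unfolding unit_integral_eq
    proof (rule integral_cong_AE)
      show "AE y in lborel. indicator {0..1} y *\<^sub>R K (nat \<lceil>(real j + y) / real R * real R\<rceil>) =
          indicator {0..1} y *\<^sub>R K (Suc j)"
        using AE_lborel_singleton[of 0]
      proof eventually_elim
        case (elim y)
        show ?case
        proof (cases "y \<in> {0..1}")
          case True
          hence "\<lceil>real j + y\<rceil> = int (Suc j)" using elim by (intro ceiling_unique) auto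
          thus ?thesis using R by (simp del: of_nat_Suc)
        qed simp
      qed
      have "(\<lambda>y. K (nat \<lceil>(real j + y) / real R * real R\<rceil>)) \<in> borel_measurable borel"
        by (rule measurable_compose[of "\<lambda>y. nat \<lceil>(real j + y) / real R * real R\<rceil>" _ "count_space UNIV"]) measurable
      thus "(\<lambda>y. indicator {0..1} y *\<^sub>R K (nat \<lceil>(real j + y) / real R * real R\<rceil>)) \<in> borel_measurable lborel"
        by measurable
    qed measurable
    thus "(LINT y|unit_space. K (nat \<lceil>(real j + y) / real R * real R\<rceil>)) = K (Suc j)"
      using prob_space by simp
  qed
  finally show ?thesis .
qed

text \<open>In the closed formula, divided by \<open>R\<close>, the denominator
  \<open>2 * R * sin (w / (2 * R))\<close> tends to \<open>w\<close>, while the phase in the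
  numerator tends to \<open>s * w\<close>.\<close>

lemma dirichlet_scaled_limit:
  assumes s: "s > 0" and w: "w > 0"
  shows "(\<lambda>R. dirichlet (nat \<lceil>s * real R\<rceil>) (w / (2 * pi * real R)) / real R) \<longlonglongrightarrow> sin (s * w) / w"
proof -
  have c: "(\<lambda>R. real (nat \<lceil>s * real R\<rceil>) / real R) \<longlonglongrightarrow> s"
  proof (rule tendsto_sandwich[where f = "\<lambda>R. s" and h = "\<lambda>R. s + 1 / real R"])
    show "\<forall>\<^sub>F R in sequentially. s \<le> real (nat \<lceil>s * real R\<rceil>) / real R"
      using eventually_gt_at_top[of 0]
    proof eventually_elim
      case (elim R)
      have "s * real R \<le> real (nat \<lceil>s * real R\<rceil>)" by linarith
      thus ?case using elim by (simp add: field_simps)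
    qed
    show "\<forall>\<^sub>F R in sequentially. real (nat \<lceil>s * real R\<rceil>) / real R \<le> s + 1 / real R"
      using eventually_gt_at_top[of 0]
    proof eventually_elim
      case (elim R)
      have "s * real R \<ge> 0" using s by simp
      hence "real (nat \<lceil>s * real R\<rceil>) \<le> s * real R + 1" by linarith
      thus ?case using elim by (simp add: field_simps)
    qed
  qed real_asymp+
  have d: "(\<lambda>R. 2 * real R * sin (w / (2 * real R))) \<longlonglongrightarrow> w" by real_asymp
  have e: "(\<lambda>R. sin (w / (2 * real R))) \<longlonglongrightarrow> 0" by real_asymp
  have "(\<lambda>R. (sin ((real (nat \<lceil>s * real R\<rceil>) / real R) * w + w / (2 * real R)) - sin (w / (2 * real R))) /
      (2 * real R * sin (w / (2 * real R)))) \<longlonglongrightarrow> (sin (s * w + 0) - 0) / w"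
  proof (intro tendsto_intros c d e)
    show "(\<lambda>R. w / (2 * real R)) \<longlonglongrightarrow> 0" by real_asymp
  qed (use w in auto)
  moreover have "\<forall>\<^sub>F R in sequentially.
     (sin ((real (nat \<lceil>s * real R\<rceil>) / real R) * w + w / (2 * real R)) - sin (w / (2 * real R))) /
      (2 * real R * sin (w / (2 * real R))) = dirichlet (nat \<lceil>s * real R\<rceil>) (w / (2 * pi * real R)) / real R"
    using order_tendstoD(1)[OF d w] eventually_gt_at_top[of 0]
  proof eventually_elim
    case (elim R)
    define r where "r = nat \<lceil>s * real R\<rceil>"
    have y: "pi * (w / (2 * pi * real R)) = w / (2 * real R)" by simp
    have z: "(2 * real r + 1) * pi * (w / (2 * pi * real R)) = (real r / real R) * w + w / (2 * real R)"
      using elim(2) by (simp add: field_simps)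
    have eq: "2 * sin (w / (2 * real R)) * dirichlet r (w / (2 * pi * real R)) =
        sin ((real r / real R) * w + w / (2 * real R)) - sin (w / (2 * real R))"
      using dirichlet_closed[of "w / (2 * pi * real R)" r] unfolding y z .
    have "sin (w / (2 * real R)) \<noteq> 0" using elim by auto
    thus ?case unfolding r_def[symmetric] eq[symmetric] using elim by simp
  qed
  ultimately show ?thesis by (auto intro: Lim_transform_eventually)
qed

text \<open>Scaling \<open>y = w / (2 * pi * R)\<close> on the half period, doubled by symmetry,
  gives the factor \<open>1 / (pi * R)\<close>; the sum over lengths is \<open>R\<close> times an
  integral over \<open>s\<close>. So \<open>1 / pi\<close> remains, and dominated convergence leads
  to the image formula \<open>integral_levy_density\<close>.\<close>

lemma exponent_limit:
  "(\<lambda>R. \<Sum>i<R. (LINT y|unit_space. xi t (dirichlet (Suc i) y / real R))) \<longlonglongrightarrow> psi t"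
proof -
  define Q :: "nat \<Rightarrow> real \<times> real \<Rightarrow> complex" where
    "Q R p = indicator ({0<..1} \<times> {0<..pi * real R}) p *\<^sub>R
       xi t (dirichlet (nat \<lceil>fst p * real R\<rceil>) (snd p / (2 * pi * real R)) / real R)" for R p
  \<comment> \<open>For the scaled kernel \<open>d\<close>, the bounds \<open>|d| \<le> 1\<close>
    and \<open>|d| \<le> pi / w\<close> give
    \<open>d^2 * (1 + w^2) \<le> 1 + pi^2 \<le> 2 * pi^2\<close>, and \<open>xi t d\<close> is at
    most \<open>t^2 / 2 * d^2\<close> in norm.\<close>
  define D :: "real \<times> real \<Rightarrow> real" where
    "D p = indicator {0<..1} (fst p) * (indicator {0<..} (snd p) * (t\<^sup>2 * pi\<^sup>2 * (1 / (1 + (snd p)\<^sup>2))))" for p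
  have DI: "integrable (lborel \<Otimes>\<^sub>M lborel) D"
  proof -
    have i: "integrable lborel (\<lambda>w::real. indicator {0<..} w * (t\<^sup>2 * pi\<^sup>2 * (1 / (1 + w\<^sup>2))))"
    proof -
      have "set_integrable lborel {0<..} (\<lambda>x::real. 1 / (1 + x\<^sup>2))"
        using integrable_I0i_1_div_plus_square by (simp add: interval_lebesgue_integrable_def zero_ereal_def inverse_eq_divide)
      hence "integrable lborel (\<lambda>w::real. (t\<^sup>2 * pi\<^sup>2) * (indicator {0<..} w * (1 / (1 + w\<^sup>2))))"
        unfolding set_integrable_def by (intro integrable_mult_right) simp
      thus ?thesis by (simp add: mult_ac)
    qed
    define h :: "real \<Rightarrow> real" where "h w = indicator {0<..} w * (t\<^sup>2 * pi\<^sup>2 * (1 / (1 + w\<^sup>2)))" for w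
    have [measurable]: "h \<in> borel_measurable borel" unfolding h_def by measurable
    have ih: "integrable lborel h" using i by (simp add: h_def[abs_def])
    have "integrable (lborel \<Otimes>\<^sub>M lborel) (\<lambda>p :: real \<times> real. indicator {0<..1} (fst p) * h (snd p))"
    proof (rule lborel_pair.Fubini_integrable)
      have "integrable lborel (\<lambda>s. indicator {0<..1::real} s * (LINT w|lborel. \<bar>h w\<bar>))"
        by (intro integrable_mult_left) simp
      thus "integrable lborel (\<lambda>s::real. LINT w|lborel. norm (indicator {0<..1} (fst (s, w)) * h (snd (s, w))))"
        by (simp add: abs_mult)
      show "AE s :: real in lborel. integrable lborel (\<lambda>w. indicator {0<..1} (fst (s, w)) * h (snd (s, w)))"
        using ih by (intro AE_I2) simp
    qed measurable
    thus ?thesis by (simp add: D_def[abs_def] h_def)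
  qed
  have Qm [measurable]: "Q R \<in> borel_measurable (lborel \<Otimes>\<^sub>M lborel)" for R
  proof -
    have [measurable]: "{0<..1::real} \<times> {0<..pi * real R} \<in> sets (lborel \<Otimes>\<^sub>M lborel)" by (rule pair_measureI) auto
    have [measurable]: "(\<lambda>p. dirichlet (nat \<lceil>fst p * real R\<rceil>) (snd p / (2 * pi * real R)))
        \<in> borel_measurable (lborel \<Otimes>\<^sub>M lborel)"
      by (rule measurable_compose_countable[where f = "\<lambda>i p. dirichlet i (snd p / (2 * pi * real R))"
            and g = "\<lambda>p. nat \<lceil>fst p * real R\<rceil>"]) measurable
    show ?thesis unfolding Q_def by measurable
  qed
  have QD: "norm (Q R p) \<le> D p" for R p
  proof (cases "p \<in> {0<..1} \<times> {0<..pi * real R}")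
    case True
    then obtain s w where p: "p = (s, w)" "0 < s" "s \<le> 1" "0 < w" "w \<le> pi * real R" by auto
    hence R: "real R > 0" by (metis less_le_trans mult_zero_right of_nat_0_less_iff not_gr_zero of_nat_0 less_irrefl)
    define d where "d = dirichlet (nat \<lceil>s * real R\<rceil>) (w / (2 * pi * real R)) / real R"
    have "s * real R \<le> 1 * real R" using p by (intro mult_right_mono) auto
    hence "real (nat \<lceil>s * real R\<rceil>) \<le> real R" by (simp add: nat_le_iff ceiling_le_iff)
    with abs_dirichlet_le[of "nat \<lceil>s * real R\<rceil>" "w / (2 * pi * real R)"]
    have "\<bar>dirichlet (nat \<lceil>s * real R\<rceil>) (w / (2 * pi * real R))\<bar> \<le> real R" by (rule order_trans)
    hence d1: "\<bar>d\<bar> \<le> 1" using R by (simp add: d_def abs_divide divide_le_eq_1)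
    have "\<bar>dirichlet (nat \<lceil>s * real R\<rceil>) (w / (2 * pi * real R))\<bar> \<le> 1 / (2 * (w / (2 * pi * real R)))"
      using p R by (intro abs_dirichlet_le_inverse) (auto simp: field_simps)
    hence d2: "\<bar>d\<bar> \<le> pi / w" using R p by (simp add: d_def abs_divide field_simps)
    have "d\<^sup>2 \<le> 1" using d1 by (simp add: abs_square_le_1)
    have "d\<^sup>2 \<le> (pi / w)\<^sup>2" using d2 p by (metis abs_le_square_iff abs_of_pos divide_pos_pos pi_gt_zero)
    hence "d\<^sup>2 * w\<^sup>2 \<le> pi\<^sup>2" using p by (simp add: field_simps)
    moreover have "1 \<le> pi\<^sup>2" using pi_gt3 by (simp add: one_le_power)
    ultimately have "d\<^sup>2 * (1 + w\<^sup>2) \<le> 2 * pi\<^sup>2" using \<open>d\<^sup>2 \<le> 1\<close> by (simp add: distrib_left)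
    hence "d\<^sup>2 \<le> 2 * pi\<^sup>2 * (1 / (1 + w\<^sup>2))" by (simp add: pos_le_divide_eq add_pos_nonneg)
    hence "t\<^sup>2 / 2 * d\<^sup>2 \<le> t\<^sup>2 / 2 * (2 * pi\<^sup>2 * (1 / (1 + w\<^sup>2)))" by (rule mult_left_mono) simp
    moreover have "norm (Q R p) \<le> t\<^sup>2 / 2 * d\<^sup>2"
      using norm_xi_le[of t d] p by (simp add: Q_def d_def indicator_def)
    moreover have "D p = t\<^sup>2 / 2 * (2 * pi\<^sup>2 * (1 / (1 + w\<^sup>2)))" using p by (simp add: D_def)
    ultimately show ?thesis by linarith
  qed (auto simp: Q_def D_def indicator_def add_nonneg_nonneg)
  have QI: "integrable (lborel \<Otimes>\<^sub>M lborel) (Q R)" for R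
    by (rule Bochner_Integration.integrable_bound[OF DI Qm]) (use QD in \<open>auto intro!: AE_I2 order_trans[OF QD]\<close>)
  have lim: "(\<lambda>R. integral\<^sup>L (lborel \<Otimes>\<^sub>M lborel) (Q R)) \<longlonglongrightarrow>
      (LINT p|(lborel \<Otimes>\<^sub>M lborel). indicator ({0<..1} \<times> {0<..}) p *\<^sub>R xi t (sin (fst p * snd p) / snd p))"
  proof (rule integral_dominated_convergence[where w = D])
    have [measurable]: "{0<..1::real} \<times> ({0<..} :: real set) \<in> sets (lborel \<Otimes>\<^sub>M lborel)" by (rule pair_measureI) auto
    show "(\<lambda>p. indicator ({0<..1} \<times> {0<..}) p *\<^sub>R xi t (sin (fst p * snd p) / snd p))
        \<in> borel_measurable (lborel \<Otimes>\<^sub>M lborel)" by measurable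
    show "AE p in lborel \<Otimes>\<^sub>M lborel. (\<lambda>R. Q R p) \<longlonglongrightarrow>
        indicator ({0<..1} \<times> {0<..}) p *\<^sub>R xi t (sin (fst p * snd p) / snd p)"
    proof (rule AE_I2)
      fix p :: "real \<times> real"
      show "(\<lambda>R. Q R p) \<longlonglongrightarrow> indicator ({0<..1} \<times> {0<..}) p *\<^sub>R xi t (sin (fst p * snd p) / snd p)"
      proof (cases "p \<in> {0<..1} \<times> {0<..}")
        case False
        hence "Q R p = 0" for R by (auto simp: Q_def indicator_def)
        thus ?thesis using False by simp
      next
        case True
        then obtain s w where p: "p = (s, w)" "0 < s" "s \<le> 1" "0 < w" by auto
        have c: "isCont (xi t) x" for x
          using continuous_on_xi[of UNIV "\<lambda>x. x" t] by (simp add: continuous_on_eq_continuous_at)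
        have "(\<lambda>R. xi t (dirichlet (nat \<lceil>s * real R\<rceil>) (w / (2 * pi * real R)) / real R)) \<longlonglongrightarrow> xi t (sin (s * w) / w)"
          by (rule isCont_tendsto_compose[OF c dirichlet_scaled_limit]) fact+
        moreover have "\<forall>\<^sub>F R in sequentially. xi t (dirichlet (nat \<lceil>s * real R\<rceil>) (w / (2 * pi * real R)) / real R) = Q R p"
        proof -
          have "filterlim (\<lambda>R. pi * real R) at_top sequentially" by real_asymp
          hence "\<forall>\<^sub>F R in sequentially. w \<le> pi * real R" by (simp add: filterlim_at_top)
          thus ?thesis by eventually_elim (use p in \<open>simp add: Q_def\<close>)
        qed
        ultimately show ?thesis using p by (auto intro: Lim_transform_eventually)
      qed
    qed
    show "AE p in lborel \<Otimes>\<^sub>M lborel. norm (Q R p) \<le> D p" for R using QD by (intro AE_I2)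
  qed (use DI in auto)
  have eq: "(\<Sum>i<R. (LINT y|unit_space. xi t (dirichlet (Suc i) y / real R))) =
      (1 / pi) *\<^sub>R integral\<^sup>L (lborel \<Otimes>\<^sub>M lborel) (Q R)" if R: "R > 0" for R
  proof -
    define K where "K r = (LINT w|lborel. indicator {0<..pi * real R} w *\<^sub>R xi t (dirichlet r (w / (2 * pi * real R)) / real R))" for r
    have "(LINT y|unit_space. xi t (dirichlet r y / real R)) = (1 / (pi * real R)) *\<^sub>R K r" for r
    proof -
      have "(LINT y|unit_space. xi t (dirichlet r y / real R)) =
          2 *\<^sub>R (LINT y|lborel. indicator {0<..1/2} y *\<^sub>R xi t (dirichlet r y / real R))"
        using R by (intro integral_unit_symmetric continuous_intros) auto
      also have "(LINT y|lborel. indicator {0<..1/2} y *\<^sub>R xi t (dirichlet r y / real R)) =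
          \<bar>1 / (2 * pi * real R)\<bar> *\<^sub>R (LINT w|lborel. indicator {0<..1/2} (0 + 1 / (2 * pi * real R) * w) *\<^sub>R
            xi t (dirichlet r (0 + 1 / (2 * pi * real R) * w) / real R))"
        using R by (intro lborel_integral_real_affine) auto
      also have "(LINT w|lborel. indicator {0<..1/2} (0 + 1 / (2 * pi * real R) * w) *\<^sub>R
            xi t (dirichlet r (0 + 1 / (2 * pi * real R) * w) / real R)) = K r"
        unfolding K_def using R
        by (intro Bochner_Integration.integral_cong refl arg_cong2[where f = scaleR])
          (auto simp: indicator_def field_simps)
      finally show ?thesis using R by (simp add: abs_divide abs_mult)
    qed
    hence "(\<Sum>i<R. (LINT y|unit_space. xi t (dirichlet (Suc i) y / real R))) =
        (1 / pi) *\<^sub>R ((1 / real R) *\<^sub>R (\<Sum>i<R. K (Suc i)))"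
      by (simp add: scaleR_sum_right)
    also have "(1 / real R) *\<^sub>R (\<Sum>i<R. K (Suc i)) = (LINT s|unit_space. K (nat \<lceil>s * real R\<rceil>))"
      by (rule integral_unit_step[OF R, symmetric])
    also have "\<dots> = (LINT s|lborel. (LINT w|lborel. Q R (s, w)))"
      unfolding unit_integral_eq
    proof (rule integral_cong_AE)
      have inner: "(LINT w|lborel. Q R (s, w)) = indicator {0<..1} s *\<^sub>R K (nat \<lceil>s * real R\<rceil>)" for s
        unfolding K_def integral_scaleR_right[symmetric]
        by (rule Bochner_Integration.integral_cong) (auto simp: Q_def indicator_def)
      show "AE s in lborel. indicator {0..1} s *\<^sub>R K (nat \<lceil>s * real R\<rceil>) = (LINT w|lborel. Q R (s, w))"
        using AE_lborel_singleton[of 0] by eventually_elim (auto simp: inner indicator_def)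
      have [measurable]: "(\<lambda>s. K (nat \<lceil>s * real R\<rceil>)) \<in> borel_measurable borel"
        by (rule measurable_compose[of "\<lambda>s. nat \<lceil>s * real R\<rceil>" _ "count_space UNIV"]) measurable
      show "(\<lambda>s. indicator {0..1} s *\<^sub>R K (nat \<lceil>s * real R\<rceil>)) \<in> borel_measurable lborel" by measurable
      show "(\<lambda>s. LINT w|lborel. Q R (s, w)) \<in> borel_measurable lborel" unfolding inner by measurable
    qed
    also have "\<dots> = integral\<^sup>L (lborel \<Otimes>\<^sub>M lborel) (Q R)"
      by (rule lborel_pair.integral_fst'[OF QI])
    finally show ?thesis .
  qed
  have "(\<lambda>R. integral\<^sup>L (lborel \<Otimes>\<^sub>M lborel) (Q R)) \<longlonglongrightarrow> pi *\<^sub>R psi t"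
    using lim unfolding psi_def by (subst (asm) integral_levy_density) auto
  hence "(\<lambda>R. (1 / pi) *\<^sub>R integral\<^sup>L (lborel \<Otimes>\<^sub>M lborel) (Q R)) \<longlonglongrightarrow> (1 / pi) *\<^sub>R (pi *\<^sub>R psi t)"
    by (intro tendsto_scaleR tendsto_const)
  moreover have "\<forall>\<^sub>F R in sequentially. (1 / pi) *\<^sub>R integral\<^sup>L (lborel \<Otimes>\<^sub>M lborel) (Q R) =
      (\<Sum>i<R. (LINT y|unit_space. xi t (dirichlet (Suc i) y / real R)))"
    using eventually_gt_at_top[of 0] by eventually_elim (simp add: eq)
  ultimately show ?thesis by (auto intro: Lim_transform_eventually)
qed

section \<open>Characteristic functions of sums of kernels\<close>

lemma norm_iexp_diff_le: "norm (iexp a - iexp b) \<le> \<bar>a - b\<bar>"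
proof -
  have "iexp a - iexp b = iexp b * (iexp (a - b) - 1)"
    by (simp add: right_diff_distrib flip: exp_add)
  thus ?thesis using iexp_approx1[of "a - b" 0] by (simp add: norm_mult)
qed

text \<open>The constant is \<open>1\<close> because \<open>fact (n + 2) \<ge> 2 ^ Suc n\<close>,
  which compares the tail of the series with a geometric series of sum \<open>1\<close>.\<close>

lemma norm_exp_minus_one_plus_le:
  fixes z :: complex
  assumes "norm z \<le> 1"
  shows "norm (exp z - (1 + z)) \<le> (norm z)\<^sup>2"
proof -
  have "exp z - (1 + z) = (\<Sum>n. z^2 * (z ^ n /\<^sub>R fact (n + 2)))"
  proof -
    have s: "summable (\<lambda>n. z ^ n /\<^sub>R fact n)" by (rule summable_exp_generic)
    have "exp z = (\<Sum>n. z ^ (n + 2) /\<^sub>R fact (n + 2)) + (\<Sum>n<2. z ^ n /\<^sub>R fact n)"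
      unfolding exp_def by (rule suminf_split_initial_segment[OF s])
    thus ?thesis by (simp add: numeral_2_eq_2 mult_ac)
  qed
  also have "norm \<dots> \<le> (\<Sum>n. (norm z)\<^sup>2 * (1 / 2) ^ Suc n)"
  proof (rule norm_suminf_le)
    fix n
    have "fact (n + 2) \<ge> (2 ^ Suc n :: real)"
    proof (induction n)
      case (Suc n)
      have "2 * 2 ^ Suc n \<le> real (n + 3) * fact (n + 2)" using Suc by (intro mult_mono) auto
      thus ?case by (simp add: fact_reduce[of "n + 3"] algebra_simps)
    qed (simp add: fact_numeral numeral_2_eq_2)
    hence "inverse (fact (n + 2)) \<le> (inverse (2 ^ Suc n) :: real)" by (intro le_imp_inverse_le) auto
    moreover have "norm z ^ n \<le> 1" using assms by (simp add: power_le_one)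
    ultimately have "norm z ^ n * inverse (fact (n + 2)) \<le> 1 * inverse (2 ^ Suc n)"
      by (intro mult_mono) auto
    hence "(norm z)\<^sup>2 * (norm z ^ n * inverse (fact (n + 2))) \<le> (norm z)\<^sup>2 * (1 * inverse (2 ^ Suc n))"
      by (rule mult_left_mono) simp
    moreover have "norm (z\<^sup>2 * (z ^ n /\<^sub>R fact (n + 2))) = (norm z)\<^sup>2 * (norm z ^ n * inverse (fact (n + 2)))"
      by (simp add: norm_mult norm_power)
    moreover have "(1 / 2 :: real) ^ Suc n = 1 * inverse (2 ^ Suc n)"
      by (simp only: power_one_over inverse_eq_divide mult_1)
    ultimately show "norm (z\<^sup>2 * (z ^ n /\<^sub>R fact (n + 2))) \<le> (norm z)\<^sup>2 * (1 / 2) ^ Suc n"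
      by (simp only:)
  qed (auto intro!: summable_mult summable_geometric)
  also have "\<dots> = (norm z)\<^sup>2"
    by (simp only: sums_unique[OF sums_mult[OF power_half_series], symmetric] mult_1_right)
  finally show ?thesis .
qed

text \<open>Since the kernels have mean \<open>0\<close> and second moment \<open>r / 2\<close>,
  each factor is \<open>1 + z\<close> with \<open>|z| \<le> t^2 / (4 * R)\<close>. Replacing the
  \<open>R\<close> factors by \<open>exp z\<close> costs \<open>R\<close> errors of order
  \<open>1 / R^2\<close>.\<close>

lemma char_prod_limit:
  "(\<lambda>R. \<Prod>i<R. (LINT y|unit_space. iexp (t * (dirichlet (Suc i) y / real R)))) \<longlonglongrightarrow> exp (psi t)"
proof -
  interpret prob_space unit_space by (rule prob_space_unit)
  define z where "z R i = (LINT y|unit_space. xi t (dirichlet (Suc i) y / real R))" for R i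
  define \<phi> where "\<phi> R i = (LINT y|unit_space. iexp (t * (dirichlet (Suc i) y / real R)))" for R i
  have \<phi>z: "\<phi> R i = 1 + z R i" for R i
  proof -
    have "iexp (t * (dirichlet (Suc i) y / real R)) =
        (1 + \<i> * complex_of_real (t / real R * dirichlet (Suc i) y)) + xi t (dirichlet (Suc i) y / real R)" for y
      by (simp add: xi_def)
    hence "\<phi> R i = (LINT y|unit_space. (1 + \<i> * complex_of_real (t / real R * dirichlet (Suc i) y)) +
        xi t (dirichlet (Suc i) y / real R))"
      unfolding \<phi>_def by simp
    also have "\<dots> = (LINT y|unit_space. 1 + \<i> * complex_of_real (t / real R * dirichlet (Suc i) y)) + z R i"
      unfolding z_def divide_inverse
      by (intro Bochner_Integration.integral_add integrable_unit_continuous continuous_intros)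
    also have "(LINT y|unit_space. 1 + \<i> * complex_of_real (t / real R * dirichlet (Suc i) y)) =
        (LINT y|unit_space. 1) + (LINT y|unit_space. \<i> * complex_of_real (t / real R * dirichlet (Suc i) y))"
      by (intro Bochner_Integration.integral_add integrable_unit_continuous continuous_intros)
    also have "(LINT y|unit_space. \<i> * complex_of_real (t / real R * dirichlet (Suc i) y)) =
        \<i> * complex_of_real (t / real R * integral\<^sup>L unit_space (dirichlet (Suc i)))"
      by (simp only: integral_mult_right_zero integral_complex_of_real)
    finally show ?thesis using prob_space by (simp add: integral_unit_dirichlet)
  qed
  have zle: "norm (z R i) \<le> t\<^sup>2 / (4 * real R)" if "i < R" for R i
  proof -
    have "norm (z R i) \<le> (LINT y|unit_space. norm (xi t (dirichlet (Suc i) y / real R)))"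
      unfolding z_def by (rule integral_norm_bound)
    also have "\<dots> \<le> (LINT y|unit_space. t\<^sup>2 / (2 * (real R)\<^sup>2) * (dirichlet (Suc i) y)\<^sup>2)"
    proof (rule integral_mono)
      show "norm (xi t (dirichlet (Suc i) y / real R)) \<le> t\<^sup>2 / (2 * (real R)\<^sup>2) * (dirichlet (Suc i) y)\<^sup>2" for y
        using norm_xi_le[of t "dirichlet (Suc i) y / real R"] by (simp add: power_divide)
    qed (use that in \<open>auto intro!: integrable_unit_continuous continuous_intros\<close>)
    also have "\<dots> = t\<^sup>2 / (2 * (real R)\<^sup>2) * (real (Suc i) / 2)"
      by (simp only: integral_mult_right_zero integral_unit_dirichlet_sq)
    also have "\<dots> \<le> t\<^sup>2 / (2 * (real R)\<^sup>2) * (real R / 2)"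
      using that by (intro mult_left_mono) auto
    also have "\<dots> = t\<^sup>2 / (4 * real R)" by (simp add: power2_eq_square)
    finally show ?thesis .
  qed
  have \<phi>1: "norm (\<phi> R i) \<le> 1" for R i
    unfolding \<phi>_def divide_inverse
    by (intro norm_integral_unit_le integrable_unit_continuous continuous_intros) simp
  have "(\<lambda>R. (\<Prod>i<R. \<phi> R i) - exp (\<Sum>i<R. z R i)) \<longlonglongrightarrow> 0"
  proof (rule Lim_null_comparison)
    have "(\<lambda>R. t\<^sup>2 / (4 * real R)) \<longlonglongrightarrow> 0" by real_asymp
    hence "\<forall>\<^sub>F R in sequentially. t\<^sup>2 / (4 * real R) < 1" by (rule order_tendstoD) simp
    thus "\<forall>\<^sub>F R in sequentially. norm ((\<Prod>i<R. \<phi> R i) - exp (\<Sum>i<R. z R i)) \<le> real R * (t\<^sup>2 / (4 * real R))\<^sup>2"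
    proof eventually_elim
      case (elim R)
      \<comment> \<open>\<open>1 + z\<close> is a value of a characteristic function, so it lies in
        the unit disc; hence so does \<open>exp z\<close>, as the telescoping bound
        \<open>norm_prod_diff\<close> requires.\<close>
      have "Re (z R i) \<le> 0" for i
        using \<phi>1[of R i] complex_Re_le_cmod[of "\<phi> R i"] by (simp add: \<phi>z)
      hence e1: "norm (exp (z R i)) \<le> 1" for i by simp
      have "norm ((\<Prod>i<R. \<phi> R i) - exp (\<Sum>i<R. z R i)) = norm ((\<Prod>i<R. \<phi> R i) - (\<Prod>i<R. exp (z R i)))"
        by (simp add: exp_sum)
      also have "\<dots> \<le> (\<Sum>i<R. norm (\<phi> R i - exp (z R i)))"
        by (rule norm_prod_diff) (use \<phi>1 e1 in auto)
      also have "\<dots> \<le> (\<Sum>i<R. (t\<^sup>2 / (4 * real R))\<^sup>2)"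
      proof (rule sum_mono)
        fix i assume "i \<in> {..<R}"
        hence i: "norm (z R i) \<le> t\<^sup>2 / (4 * real R)" using zle by simp
        have "norm (\<phi> R i - exp (z R i)) = norm (exp (z R i) - (1 + z R i))"
          by (simp add: \<phi>z norm_minus_commute)
        also have "\<dots> \<le> (norm (z R i))\<^sup>2" using i elim by (intro norm_exp_minus_one_plus_le) linarith
        also have "\<dots> \<le> (t\<^sup>2 / (4 * real R))\<^sup>2" using i by (intro power_mono) auto
        finally show "norm (\<phi> R i - exp (z R i)) \<le> (t\<^sup>2 / (4 * real R))\<^sup>2" .
      qed
      finally show ?case by simp
    qed
    have "(\<lambda>R. t ^ 4 / 16 * (1 / real R)) \<longlonglongrightarrow> 0" by (intro tendsto_mult_right_zero) real_asymp
    thus "(\<lambda>R. real R * (t\<^sup>2 / (4 * real R))\<^sup>2) \<longlonglongrightarrow> 0"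
      by (rule tendsto_cong[THEN iffD1, rotated])
        (auto intro!: always_eventually simp: power2_eq_square power4_eq_xxxx field_simps)
  qed
  moreover have "(\<lambda>R. exp (\<Sum>i<R. z R i)) \<longlonglongrightarrow> exp (psi t)"
    unfolding z_def by (intro tendsto_exp exponent_limit)
  ultimately have "(\<lambda>R. ((\<Prod>i<R. \<phi> R i) - exp (\<Sum>i<R. z R i)) + exp (\<Sum>i<R. z R i)) \<longlonglongrightarrow> 0 + exp (psi t)"
    by (rule tendsto_add)
  thus ?thesis by (simp add: \<phi>_def)
qed

text \<open>The growth condition turns the errors of \<open>mixing_prod\<close> into a geometric
  series, and the normalisation by \<open>R\<close> puts a factor \<open>1 / R\<close> in front of
  it.\<close>

lemma char_block_sum_limit:
  assumes m: "\<And>i. m i > (0::nat)"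
    and growth: "\<And>i. 2 ^ i * (\<Sum>j<i. real (m j) * (real (Suc j))\<^sup>2) \<le> real (m i)"
  shows "(\<lambda>R. LINT x|unit_space. iexp (t * ((\<Sum>i<R. dirichlet (Suc i) (real (m i) * x)) / real R))) \<longlonglongrightarrow> exp (psi t)"
proof -
  define P where "P R = (\<Prod>i<R. (LINT y|unit_space. iexp (t * (dirichlet (Suc i) y / real R))))" for R
  define C where "C R = (LINT x|unit_space. iexp (t * ((\<Sum>i<R. dirichlet (Suc i) (real (m i) * x)) / real R)))" for R :: nat
  have bound: "norm (C R - P R) \<le> 4 * pi * \<bar>t\<bar> / real R" for R
  proof -
    define K where "K i = \<bar>t\<bar> / real R * (2 * pi * (real (Suc i))\<^sup>2)" for i
    have "norm ((LINT x|unit_space. (\<Prod>i<R. iexp (t * (dirichlet (Suc i) (real (m i) * x) / real R)))) -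
        (\<Prod>i<R. (LINT y|unit_space. iexp (t * (dirichlet (Suc i) y / real R)))))
      \<le> (\<Sum>i<R. (\<Sum>j<i. K j * real (m j)) / real (m i))"
    proof (rule mixing_prod[where f = "\<lambda>i y. iexp (t * (dirichlet (Suc i) y / real R))"])
      show "continuous_on UNIV (\<lambda>y. iexp (t * (dirichlet (Suc i) y / real R)))" for i
        unfolding divide_inverse by (intro continuous_intros)
      show "norm (iexp (t * (dirichlet (Suc i) x / real R)) - iexp (t * (dirichlet (Suc i) y / real R))) \<le> K i * \<bar>x - y\<bar>" for i x y
      proof -
        have "norm (iexp (t * (dirichlet (Suc i) x / real R)) - iexp (t * (dirichlet (Suc i) y / real R)))
           \<le> \<bar>t * (dirichlet (Suc i) x / real R) - t * (dirichlet (Suc i) y / real R)\<bar>" by (rule norm_iexp_diff_le)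
        also have "\<dots> = \<bar>t\<bar> / real R * \<bar>dirichlet (Suc i) x - dirichlet (Suc i) y\<bar>"
          by (simp add: abs_mult abs_divide flip: right_diff_distrib diff_divide_distrib)
        also have "\<dots> \<le> \<bar>t\<bar> / real R * (2 * pi * real ((Suc i)\<^sup>2) * \<bar>x - y\<bar>)"
          by (intro mult_left_mono dirichlet_lipschitz) auto
        finally show ?thesis by (simp add: K_def mult_ac)
      qed
    qed (use m in auto)
    also have "(\<lambda>x. (\<Prod>i<R. iexp (t * (dirichlet (Suc i) (real (m i) * x) / real R)))) =
        (\<lambda>x. iexp (t * ((\<Sum>i<R. dirichlet (Suc i) (real (m i) * x)) / real R)))"
      by (simp add: sum_divide_distrib sum_distrib_left flip: exp_sum)
    also have "(\<Sum>i<R. (\<Sum>j<i. K j * real (m j)) / real (m i)) \<le> (\<Sum>i<R. \<bar>t\<bar> / real R * (2 * pi) * (1 / 2) ^ i)"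
    proof (rule sum_mono)
      fix i
      have "(\<Sum>j<i. K j * real (m j)) = \<bar>t\<bar> / real R * (2 * pi) * (\<Sum>j<i. real (m j) * (real (Suc j))\<^sup>2)"
        by (simp add: K_def sum_distrib_left mult_ac)
      also have "\<dots> / real (m i) = \<bar>t\<bar> / real R * (2 * pi) * ((\<Sum>j<i. real (m j) * (real (Suc j))\<^sup>2) / real (m i))"
        by simp
      also have "\<dots> \<le> \<bar>t\<bar> / real R * (2 * pi) * (1 / 2) ^ i"
        using growth[of i] m[of i] by (intro mult_left_mono) (auto simp: field_simps power_one_over)
      finally show "(\<Sum>j<i. K j * real (m j)) / real (m i) \<le> \<bar>t\<bar> / real R * (2 * pi) * (1 / 2) ^ i" .
    qed
    also have "\<dots> = \<bar>t\<bar> / real R * (2 * pi) * (\<Sum>i<R. (1 / 2) ^ i)" by (simp add: sum_distrib_left)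
    also have "\<dots> \<le> \<bar>t\<bar> / real R * (2 * pi) * 2"
      by (intro mult_left_mono) (simp_all add: geometric_sum)
    finally show ?thesis by (simp add: C_def P_def mult_ac)
  qed
  have "(\<lambda>R. C R - P R) \<longlonglongrightarrow> 0"
  proof (rule Lim_null_comparison[where g = "\<lambda>R. 4 * pi * \<bar>t\<bar> / real R"])
    show "(\<lambda>R. 4 * pi * \<bar>t\<bar> / real R) \<longlonglongrightarrow> 0" by real_asymp
  qed (use bound in simp)
  hence "(\<lambda>R. (C R - P R) + P R) \<longlonglongrightarrow> 0 + exp (psi t)"
    unfolding P_def by (intro tendsto_add char_prod_limit)
  thus ?thesis by (simp add: C_def)
qed

subsection \<open>Rearrangements\<close>

text \<open>With the block bases as \<open>f\<close>, this limits the index of the block that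
  contains a given frequency.\<close>

lemma enumerate_le_strict_mono:
  fixes f :: "nat \<Rightarrow> nat"
  assumes f: "strict_mono f" "range f \<subseteq> V" and V: "infinite V"
  shows "enumerate V i \<le> f i"
proof (induction i)
  case 0
  show ?case unfolding enumerate_0 using f by (intro Least_le) auto
next
  case (Suc i)
  have "f (Suc i) \<in> V \<and> enumerate V i < f (Suc i)"
    using Suc f(2) strict_monoD[OF f(1), of i "Suc i"] by auto
  thus ?case unfolding enumerate_Suc'' [OF V] by (rule Least_le)
qed

text \<open>The frequencies are fixed once, in increasing order; any other enumeration of the same
  set differs from this one by a permutation. The shifts by one pass between indices starting at
  \<open>0\<close> and positive integers.\<close>

lemma ex_permutation_of_enumeration:
  fixes \<tau> :: "nat \<Rightarrow> nat"
  assumes V: "infinite V" and \<tau>: "bij_betw \<tau> UNIV V"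
  shows "\<exists>\<sigma>. permutation_of_pos \<sigma> \<and> (\<forall>k\<ge>1. enumerate V (\<sigma> k - 1) = \<tau> (k - 1))"
proof -
  define g where "g v = the_inv_into UNIV (enumerate V) v" for v
  have e: "bij_betw (enumerate V) UNIV V" by (rule bij_enumerate[OF V])
  have g: "bij_betw g V UNIV" unfolding g_def by (rule bij_betw_the_inv_into[OF e])
  have eg: "enumerate V (g v) = v" if "v \<in> V" for v
    unfolding g_def by (rule f_the_inv_into_f_bij_betw[OF e that])
  have "bij_betw (\<lambda>k. k - 1) {1..} (UNIV :: nat set)"
    by (rule bij_betwI[where g = Suc]) auto
  moreover have "bij_betw Suc UNIV {1..}"
    by (rule bij_betwI[where g = "\<lambda>k. k - 1"]) auto
  ultimately have "bij_betw (Suc \<circ> (g \<circ> (\<tau> \<circ> (\<lambda>k. k - 1)))) {1..} {1..}"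
    using \<tau> g by (intro bij_betw_trans)
  moreover have "enumerate V (g (\<tau> k)) = \<tau> k" for k
    using \<tau> by (intro eg) (auto simp: bij_betw_def)
  ultimately show ?thesis
    by (intro exI[of _ "Suc \<circ> (g \<circ> (\<tau> \<circ> (\<lambda>k. k - 1)))"]) (auto simp: permutation_of_pos_def)
qed

lemma cos_sum_Suc_shift:
  assumes "\<And>k. k \<ge> 1 \<Longrightarrow> m k = \<tau> (k - 1)"
  shows "cos_sum m N x = (\<Sum>k<N. cos (2 * pi * real (\<tau> k) * x))"
proof -
  have "cos_sum m N x = (\<Sum>k=1..N. cos (2 * pi * real (\<tau> (k - 1)) * x))"
    unfolding cos_sum_def using assms by (intro sum.cong) auto
  also have "\<dots> = (\<Sum>k<N. cos (2 * pi * real (\<tau> k) * x))"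
    by (rule sum.reindex_bij_witness[where i = Suc and j = "\<lambda>k. k - 1"]) auto
  finally show ?thesis .
qed

text \<open>The elements of \<open>S\<close> missed by the injective sequence \<open>u\<close> are inserted at the positions
  \<open>2 ^ i\<close>, so sparsely that partial sums barely notice them.\<close>

definition sparse_count :: "nat \<Rightarrow> nat" where
  "sparse_count N = card {k. k < N \<and> (\<exists>i. k = 2 ^ i)}"

lemma sparse_count_0 [simp]: "sparse_count 0 = 0"
  by (simp add: sparse_count_def)

lemma sparse_count_Suc: "sparse_count (Suc N) = sparse_count N + (if \<exists>i. N = 2 ^ i then 1 else 0)"
proof -
  have "{k. k < Suc N \<and> (\<exists>i. k = 2 ^ i)} =
      (if \<exists>i. N = 2 ^ i then insert N {k. k < N \<and> (\<exists>i. k = 2 ^ i)} else {k. k < N \<and> (\<exists>i. k = 2 ^ i)})"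
    by (auto simp: less_Suc_eq)
  thus ?thesis by (auto simp: sparse_count_def)
qed

lemma sparse_count_power: "2 ^ sparse_count N \<le> 2 * Suc N"
proof -
  have "sparse_count N \<le> card ((\<lambda>i. 2 ^ i :: nat) ` {..floor_log N})"
    unfolding sparse_count_def
  proof (rule card_mono)
    show "{k. k < N \<and> (\<exists>i. k = 2 ^ i)} \<subseteq> (\<lambda>i. 2 ^ i) ` {..floor_log N}"
    proof safe
      fix i :: nat assume "2 ^ i < N"
      hence "floor_log (2 ^ i) \<le> floor_log N" by (intro floor_log_le_iff) simp
      thus "2 ^ i \<in> (\<lambda>i. 2 ^ i) ` {..floor_log N}" by (intro imageI) simp
    qed
  qed simp
  also have "\<dots> \<le> Suc (floor_log N)" using card_image_le[of "{..floor_log N}" "\<lambda>i. 2 ^ i :: nat"] by simp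
  finally have "2 ^ sparse_count N \<le> (2 ^ Suc (floor_log N) :: nat)" by (intro power_increasing) auto
  also have "\<dots> \<le> 2 * Suc N"
  proof (cases "N = 0")
    case False
    thus ?thesis using floor_log_exp2_le[of N] by simp
  qed (simp add: floor_log.simps)
  finally show ?thesis .
qed

lemma sparse_count_le_log: "real (sparse_count N) \<le> log 2 (2 * (real N + 1))"
proof -
  have "real (2 ^ sparse_count N) \<le> real (2 * Suc N)" using sparse_count_power by (simp only: of_nat_le_iff)
  thus ?thesis by (simp add: le_log_iff powr_realpow algebra_simps)
qed

lemma sparse_count_le: "sparse_count N \<le> N"
  by (induction N) (auto simp: sparse_count_Suc)

lemma sparse_count_mono: "M \<le> N \<Longrightarrow> sparse_count M \<le> sparse_count N"
  by (rule lift_Suc_mono_le[of sparse_count]) (auto simp: sparse_count_Suc)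

lemma sparse_count_unbounded: "\<exists>N. i < sparse_count N"
proof -
  have "i \<le> sparse_count (2 ^ i)"
  proof (induction i)
    case (Suc i)
    have "Suc (sparse_count (2 ^ i)) = sparse_count (Suc (2 ^ i))" by (auto simp: sparse_count_Suc)
    also have "\<dots> \<le> sparse_count (2 ^ Suc i)" by (intro sparse_count_mono) (simp add: Suc_le_eq)
    finally show ?case using Suc by linarith
  qed simp
  hence "i < sparse_count (Suc (2 ^ i))" by (auto simp: sparse_count_Suc)
  thus ?thesis ..
qed

lemma compl_sparse_count_unbounded: "\<exists>N. j < N - sparse_count N"
proof -
  have "\<forall>\<^sub>F N in sequentially. real j < real N - log 2 (2 * (real N + 1))" by real_asymp
  then obtain N where N: "real j < real N - log 2 (2 * (real N + 1))" by (auto simp: eventually_sequentially)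
  with sparse_count_le_log[of N] have "j < N - sparse_count N" by linarith
  thus ?thesis ..
qed

text \<open>Position \<open>k\<close> takes the next missed element if \<open>k\<close> is a power
  of two and the next term of \<open>u\<close> otherwise. The partial sum up to \<open>N\<close>
  thus gains \<open>sparse_count N\<close> missed elements and loses as many of the last terms of
  \<open>u\<close>, whence the factor \<open>2\<close>.\<close>

lemma ex_sparse_completion:
  fixes u :: "nat \<Rightarrow> 'a :: countable"
  assumes u: "inj u" "range u \<subseteq> S" and S: "infinite (S - range u)"
  shows "\<exists>\<tau>. bij_betw \<tau> UNIV S \<and> (\<forall>(f :: 'a \<Rightarrow> real) N. (\<forall>s. \<bar>f s\<bar> \<le> 1) \<longrightarrow>
    \<bar>(\<Sum>k<N. f (\<tau> k)) - (\<Sum>k<N. f (u k))\<bar> \<le> 2 * real (sparse_count N))"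
proof -
  define v where "v = from_nat_into (S - range u)"
  have v: "bij_betw v UNIV (S - range u)"
    unfolding v_def using S by (intro bij_betw_from_nat_into) auto
  define \<tau> where "\<tau> k = (if \<exists>i. k = 2 ^ i then v (sparse_count k) else u (k - sparse_count k))" for k
  have sum: "(\<Sum>k<N. f (\<tau> k)) = (\<Sum>i<sparse_count N. f (v i)) + (\<Sum>i<N - sparse_count N. f (u i))"
    for f :: "'a \<Rightarrow> real" and N
  proof (induction N)
    case (Suc N)
    have "Suc N - sparse_count N = Suc (N - sparse_count N)" using sparse_count_le[of N] by simp
    thus ?case using Suc by (auto simp: sparse_count_Suc \<tau>_def)
  qed simp
  have bij: "bij_betw \<tau> UNIV S"
  proof -
    have in_S: "\<tau> k \<in> S" for k
      using u v by (auto simp: \<tau>_def bij_betw_def)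
    have cnt: "(\<Sum>i<M. indicator {s} (w i) :: real) = (if i0 < M then 1 else 0)"
      if "inj w" "w i0 = s" for w :: "nat \<Rightarrow> 'a" and M i0 s
    proof -
      have "(\<Sum>i<M. indicator {s} (w i) :: real) = (\<Sum>i<M. if i = i0 then 1 else 0)"
        using that by (intro sum.cong) (auto simp: indicator_def inj_eq)
      thus ?thesis by simp
    qed
    have zero: "(\<Sum>i<M. indicator {s} (w i) :: real) = 0" if "s \<notin> range w" for w :: "nat \<Rightarrow> 'a" and M s
      using that by (intro sum.neutral) (auto simp: indicator_def)
    have vinj: "inj v" and vr: "range v = S - range u" using v by (auto simp: bij_betw_def)
    \<comment> \<open>Bijectivity is read off the same splitting of partial sums, applied to
      indicators: \<open>s\<close> is counted at most once, which gives injectivity, and eventually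
      once, which gives surjectivity. Here \<open>N0\<close> is a predicate.\<close>
    have count: "\<exists>N0. \<forall>N. (\<Sum>k<N. indicator {s} (\<tau> k) :: real) = (if N0 N then 1 else 0)"
      and ev: "\<exists>N. (\<Sum>k<N. indicator {s} (\<tau> k) :: real) = 1" if s: "s \<in> S" for s
    proof -
      have "(\<exists>N0. \<forall>N. (\<Sum>k<N. indicator {s} (\<tau> k) :: real) = (if N0 N then 1 else 0)) \<and>
        (\<exists>N. (\<Sum>k<N. indicator {s} (\<tau> k) :: real) = 1)"
      proof (cases "s \<in> range u")
        case True
        then obtain j where j: "u j = s" by auto
        have "s \<notin> range v" using True vr by auto
        hence *: "(\<Sum>k<N. indicator {s} (\<tau> k) :: real) = (if j < N - sparse_count N then 1 else 0)" for N
          unfolding sum by (simp add: zero cnt[OF u(1) j])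
        show ?thesis using * compl_sparse_count_unbounded[of j] by auto
      next
        case False
        then obtain i where i: "v i = s" using s vr by (metis DiffI rangeE)
        have *: "(\<Sum>k<N. indicator {s} (\<tau> k) :: real) = (if i < sparse_count N then 1 else 0)" for N
          unfolding sum using False by (simp add: zero cnt[OF vinj i])
        show ?thesis using * sparse_count_unbounded[of i] by auto
      qed
      thus "\<exists>N0. \<forall>N. (\<Sum>k<N. indicator {s} (\<tau> k) :: real) = (if N0 N then 1 else 0)"
        "\<exists>N. (\<Sum>k<N. indicator {s} (\<tau> k) :: real) = 1" by auto
    qed
    have "inj \<tau>"
    proof (rule injI)
      fix a b assume ab: "\<tau> a = \<tau> b"
      show "a = b"
      proof (rule ccontr)
        assume "a \<noteq> b"
        define N where "N = Suc (max a b)"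
        have "(\<Sum>k\<in>{a, b}. indicator {\<tau> a} (\<tau> k) :: real) \<le> (\<Sum>k<N. indicator {\<tau> a} (\<tau> k))"
          by (rule sum_mono2) (auto simp: N_def)
        hence "2 \<le> (\<Sum>k<N. indicator {\<tau> a} (\<tau> k) :: real)" using ab \<open>a \<noteq> b\<close> by simp
        moreover obtain N0 where "\<And>N. (\<Sum>k<N. indicator {\<tau> a} (\<tau> k) :: real) = (if N0 N then 1 else 0)"
          using count[OF in_S[of a]] by auto
        ultimately show False by (simp split: if_splits)
      qed
    qed
    moreover have "s \<in> range \<tau>" if "s \<in> S" for s
    proof (rule ccontr)
      assume "s \<notin> range \<tau>"
      hence "(\<Sum>k<N. indicator {s} (\<tau> k) :: real) = 0" for N by (rule zero)
      thus False using ev[OF that] by auto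
    qed
    ultimately show ?thesis using in_S by (auto simp: bij_betw_def)
  qed
  have "\<bar>(\<Sum>k<N. f (\<tau> k)) - (\<Sum>k<N. f (u k))\<bar> \<le> 2 * real (sparse_count N)"
    if f: "\<forall>s. \<bar>f s\<bar> \<le> 1" for f :: "'a \<Rightarrow> real" and N
  proof -
    define M where "M = N - sparse_count N"
    have N: "N = M + sparse_count N" using sparse_count_le[of N] by (simp add: M_def)
    have b: "\<bar>\<Sum>i\<in>A. f (w i)\<bar> \<le> real (card A)" for A and w :: "nat \<Rightarrow> 'a"
      using order_trans[OF sum_abs sum_bounded_above[of A "\<lambda>i. \<bar>f (w i)\<bar>" 1]] f by simp
    have "(\<Sum>k<N. f (u k)) = (\<Sum>k<M. f (u k)) + (\<Sum>k=M..<N. f (u k))"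
      using sum.atLeastLessThan_concat[of 0 M N "\<lambda>k. f (u k)"] N by (simp add: lessThan_atLeast0)
    hence "(\<Sum>k<N. f (\<tau> k)) - (\<Sum>k<N. f (u k)) = (\<Sum>i<sparse_count N. f (v i)) - (\<Sum>k=M..<N. f (u k))"
      by (simp add: sum M_def)
    also have "\<bar>\<dots>\<bar> \<le> real (card {..<sparse_count N}) + real (card {M..<N})"
      by (rule order_trans[OF abs_triangle_ineq4 add_mono[OF b b]])
    finally show ?thesis using N by simp
  qed
  with bij show ?thesis by blast
qed

subsection \<open>Concatenation of blocks\<close>

definition block_start :: "(nat \<Rightarrow> nat) \<Rightarrow> nat \<Rightarrow> nat" where
  "block_start w b = (\<Sum>i<b. w i)"

definition block_index :: "(nat \<Rightarrow> nat) \<Rightarrow> nat \<Rightarrow> nat" where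
  "block_index w k = (LEAST b. k < block_start w (Suc b))"

text \<open>The second component counts from \<open>1\<close>, because it is the multiple of the
  base.\<close>

definition block_term :: "(nat \<Rightarrow> nat) \<Rightarrow> nat \<Rightarrow> nat \<times> nat" where
  "block_term w k = (block_index w k, Suc (k - block_start w (block_index w k)))"

lemma block_start_Suc: "block_start w (Suc b) = block_start w b + w b"
  by (simp add: block_start_def)

lemma block_start_mono: "a \<le> b \<Longrightarrow> block_start w a \<le> block_start w b"
  unfolding block_start_def by (rule sum_mono2) auto

context
  fixes w :: "nat \<Rightarrow> nat"
  assumes w: "\<And>i. w i \<ge> 1"
begin

lemma le_block_start: "b \<le> block_start w b"
  using sum_mono[of "{..<b}" "\<lambda>_. 1" w] w by (simp add: block_start_def)

lemma block_index_bounds: "block_start w (block_index w k) \<le> k" "k < block_start w (Suc (block_index w k))"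
proof -
  have ex: "k < block_start w (Suc k)" using le_block_start[of "Suc k"] by simp
  show "k < block_start w (Suc (block_index w k))"
    unfolding block_index_def using ex by (rule LeastI)
  show "block_start w (block_index w k) \<le> k"
  proof (cases "block_index w k")
    case (Suc b)
    have "\<not> k < block_start w (Suc b)"
      using not_less_Least[of b "\<lambda>b. k < block_start w (Suc b)"] Suc unfolding block_index_def by simp
    thus ?thesis using Suc by simp
  qed (simp add: block_start_def)
qed

lemma block_index_eq: "q < w b \<Longrightarrow> block_index w (block_start w b + q) = b"
proof -
  assume q: "q < w b"
  let ?i = "block_index w (block_start w b + q)"
  have 1: "block_start w ?i \<le> block_start w b + q" "block_start w b + q < block_start w (Suc ?i)"
    by (rule block_index_bounds)+
  have "\<not> ?i < b"
    using 1(2) block_start_mono[of "Suc ?i" b w] by auto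
  moreover have "\<not> b < ?i"
    using 1(1) q block_start_mono[of "Suc b" ?i w] by (auto simp: block_start_Suc)
  ultimately show "?i = b" by simp
qed

lemma block_term_eq: "q < w b \<Longrightarrow> block_term w (block_start w b + q) = (b, Suc q)"
  by (simp add: block_term_def block_index_eq)

lemma inj_block_term: "inj (block_term w)"
proof (rule injI)
  fix k l assume "block_term w k = block_term w l"
  thus "k = l" using block_index_bounds(1)[of k] block_index_bounds(1)[of l] by (auto simp: block_term_def)
qed

lemma snd_block_term: "1 \<le> snd (block_term w k)" "snd (block_term w k) \<le> w (fst (block_term w k))"
  using block_index_bounds[of k] by (auto simp: block_term_def block_start_Suc)

lemma sum_block_term_partial:
  "q \<le> w b \<Longrightarrow> (\<Sum>k<block_start w b + q. f (block_term w k)) =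
    (\<Sum>k<block_start w b. f (block_term w k)) + (\<Sum>j=1..q. f (b, j) :: real)"
proof (induction q)
  case (Suc q)
  thus ?case by (simp add: block_term_eq)
qed simp

lemma sum_block_term_start:
  "(\<Sum>k<block_start w b. f (block_term w k)) = (\<Sum>i<b. \<Sum>j=1..w i. f (i, j) :: real)"
proof (induction b)
  case (Suc b)
  thus ?case using sum_block_term_partial[of "w b" b f] by (simp add: block_start_Suc)
qed (simp add: block_start_def)

lemma sum_block_term:
  "(\<Sum>k<N. f (block_term w k)) = (\<Sum>i<block_index w N. \<Sum>j=1..w i. f (i, j) :: real) +
     (\<Sum>j=1..N - block_start w (block_index w N). f (block_index w N, j))"
proof -
  have "N - block_start w (block_index w N) \<le> w (block_index w N)"
    using block_index_bounds[of N] by (simp add: block_start_Suc)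
  from sum_block_term_partial[OF this, of f] show ?thesis
    using block_index_bounds(1)[of N] by (simp add: sum_block_term_start)
qed

end

subsection \<open>The frequencies\<close>

text \<open>Index \<open>c\<close> proposes the length \<open>p c\<close>, and the pairing function
  proposes every length infinitely often. A proposal is accepted only if it is compatible with all
  \<open>\<epsilon> k\<close> from \<open>k = c\<close> on, and is otherwise replaced by the
  harmless length \<open>1\<close>. As \<epsilon> tends to \<open>0\<close>, only finitely many
  proposals of a given length fail.\<close>

lemma ex_block_lengths:
  fixes \<epsilon> :: "nat \<Rightarrow> real"
  assumes \<epsilon>: "\<epsilon> \<longlonglongrightarrow> 0"
  shows "\<exists>l :: nat \<Rightarrow> nat. (\<forall>c. l c \<ge> 1) \<and> (\<forall>c k. l c \<ge> 2 \<longrightarrow> c \<le> k \<longrightarrow> \<epsilon> k * real (l c) \<le> 1) \<and>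
    (\<forall>r\<ge>1. infinite {c. l c = r})"
proof -
  define p where "p c = Suc (fst (prod_decode c))" for c
  define l where "l c = (if \<forall>k\<ge>c. \<epsilon> k * real (p c) \<le> 1 then p c else 1)" for c
  have "infinite {c. l c = r}" if r: "r \<ge> 1" for r
  proof -
    have "\<forall>\<^sub>F k in sequentially. \<epsilon> k < 1 / real r" using r by (intro order_tendstoD(2)[OF \<epsilon>]) simp
    then obtain K where K: "\<And>k. k \<ge> K \<Longrightarrow> \<epsilon> k < 1 / real r" by (auto simp: eventually_sequentially)
    have "infinite (range (\<lambda>j. prod_encode (r - 1, j)))"
      by (rule range_inj_infinite) (auto simp: inj_def)
    hence "infinite (range (\<lambda>j. prod_encode (r - 1, j)) - {..<K})" by simp
    moreover have "range (\<lambda>j. prod_encode (r - 1, j)) - {..<K} \<subseteq> {c. l c = r}"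
    proof
      fix c assume "c \<in> range (\<lambda>j. prod_encode (r - 1, j)) - {..<K}"
      hence pc: "p c = r" "c \<ge> K" using r by (auto simp: p_def)
      have "\<epsilon> k * real r \<le> 1" if "k \<ge> c" for k
        using K[of k] that pc r by (simp add: field_simps)
      thus "c \<in> {c. l c = r}" using pc by (simp add: l_def)
    qed
    ultimately show ?thesis using finite_subset by blast
  qed
  moreover have "l c \<ge> 1" for c by (simp add: l_def p_def)
  moreover have "\<epsilon> k * real (l c) \<le> 1" if "l c \<ge> 2" "c \<le> k" for c k
    using that by (auto simp: l_def split: if_splits)
  ultimately show ?thesis by blast
qed

text \<open>At least one block is skipped after each selected one. This leaves infinitely many
  frequencies over, as \<open>ex_sparse_completion\<close> requires.\<close>

lemma ex_block_selection:
  fixes l w :: "nat \<Rightarrow> nat"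
  assumes l: "\<And>r. r \<ge> 1 \<Longrightarrow> infinite {c. l c = r}" and w: "\<And>i. w i \<ge> 1"
  shows "\<exists>e. (\<forall>i. l (e i) = w i) \<and> (\<forall>i. Suc (e i) < e (Suc i))"
proof -
  have "\<exists>e. \<forall>i. l (e i) = w i \<and> Suc (e i) < e (Suc i)"
  proof (rule dependent_nat_choice)
    have "infinite {c. l c = w 0}" using w by (intro l)
    thus "\<exists>c. l c = w 0" using not_finite_existsD by auto
  next
    fix c i
    have "infinite {c. l c = w (Suc i)}" using w by (intro l)
    thus "\<exists>d. l d = w (Suc i) \<and> Suc c < d" by (auto simp: infinite_nat_iff_unbounded)
  qed
  thus ?thesis by blast
qed

text \<open>The sum in \<open>block_weight_eq\<close>, written as a recursion in itself so that the
  bases can be read off from it without mutual recursion.\<close>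

primrec block_weight :: "(nat \<Rightarrow> nat) \<Rightarrow> nat \<Rightarrow> nat" where
  "block_weight l 0 = (l 0)\<^sup>2"
| "block_weight l (Suc c) = block_weight l c + 4 ^ Suc c * (block_weight l c)\<^sup>2 * (l (Suc c))\<^sup>2"

text \<open>The square serves the decoupling of squared partial sums, whose Lipschitz constants are
  of the order of the squared weight. The powers of \<open>4\<close> make the decoupling errors of
  unsquared sums geometric.\<close>

definition block_base :: "(nat \<Rightarrow> nat) \<Rightarrow> nat \<Rightarrow> nat" where
  "block_base l c = (case c of 0 \<Rightarrow> 1 | Suc d \<Rightarrow> 4 ^ Suc d * (block_weight l d)\<^sup>2)"

definition block_freq :: "(nat \<Rightarrow> nat) \<Rightarrow> nat \<times> nat \<Rightarrow> nat" where
  "block_freq l s = block_base l (fst s) * snd s"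

definition block_set :: "(nat \<Rightarrow> nat) \<Rightarrow> (nat \<times> nat) set" where
  "block_set l = {(c, j). 1 \<le> j \<and> j \<le> l c}"

lemma block_weight_eq: "block_weight l c = (\<Sum>b\<le>c. block_base l b * (l b)\<^sup>2)"
  by (induction c) (auto simp: block_base_def)

context
  fixes l :: "nat \<Rightarrow> nat"
  assumes l: "\<And>c. l c \<ge> 1"
begin

lemma block_weight_ge: "block_weight l c \<ge> 1"
proof (induction c)
  case 0
  show ?case using l[of 0] by (simp add: Suc_le_eq)
qed simp

lemma block_base_pos: "block_base l c > 0"
  using block_weight_ge by (cases c) (auto simp: block_base_def intro: Suc_le_lessD)

text \<open>Passing to a subsequence of blocks only drops terms from the weight, and
  \<open>i \<le> e i\<close> preserves the factor \<open>4 ^ i\<close>.\<close>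

lemma block_base_growth:
  assumes e: "\<And>i. e i < e (Suc i)"
  shows "4 ^ i * (\<Sum>j<i. block_base l (e j) * (l (e j))\<^sup>2)\<^sup>2 \<le> block_base l (e i)"
proof (cases i)
  case (Suc i')
  have mono: "strict_mono e" using e by (simp add: strict_mono_Suc_iff)
  obtain d where d: "e i = Suc d" using e[of i'] Suc by (cases "e i") auto
  have "(\<Sum>j<i. block_base l (e j) * (l (e j))\<^sup>2) = (\<Sum>b\<in>e ` {..<i}. block_base l b * (l b)\<^sup>2)"
    using mono by (subst sum.reindex) (auto intro: strict_mono_imp_inj_on[THEN inj_on_subset])
  also have "\<dots> \<le> block_weight l d"
    unfolding block_weight_eq
  proof (rule sum_mono2)
    show "e ` {..<i} \<subseteq> {..d}" using d strict_monoD[OF mono] by fastforce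
  qed auto
  finally have "(\<Sum>j<i. block_base l (e j) * (l (e j))\<^sup>2)\<^sup>2 \<le> (block_weight l d)\<^sup>2" by (rule power_mono) simp
  moreover have "(4::nat) ^ i \<le> 4 ^ Suc d" using d strict_mono_imp_increasing[OF mono, of i] by (intro power_increasing) auto
  ultimately have "4 ^ i * (\<Sum>j<i. block_base l (e j) * (l (e j))\<^sup>2)\<^sup>2 \<le> 4 ^ Suc d * (block_weight l d)\<^sup>2"
    by (intro mult_mono) auto
  thus ?thesis by (simp add: d block_base_def)
qed simp

text \<open>The factor \<open>2\<close> between different blocks settles the ratio condition there
  as soon as \<open>\<epsilon> k \<le> 1\<close>, so only ratios inside a block depend on its
  length.\<close>

lemma block_base_gap:
  assumes "c < d"
  shows "2 * (block_base l c * l c) \<le> block_base l d"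
proof -
  have "2 * (block_base l c * l c) \<le> block_base l (Suc c)" for c
  proof -
    have "block_base l c * l c \<le> block_base l c * (l c)\<^sup>2"
      using l[of c] by (intro mult_left_mono) (auto simp: power2_eq_square)
    also have "\<dots> \<le> block_weight l c" unfolding block_weight_eq by (rule member_le_sum) auto
    finally have A: "block_base l c * l c \<le> block_weight l c" .
    have "2 * block_weight l c \<le> 4 ^ Suc c * (block_weight l c)\<^sup>2"
    proof (rule mult_mono)
      have "(4::nat) ^ 1 \<le> 4 ^ Suc c" by (intro power_increasing) auto
      thus "(2::nat) \<le> 4 ^ Suc c" by simp
      show "block_weight l c \<le> (block_weight l c)\<^sup>2" using block_weight_ge[of c] by (simp add: power2_eq_square)
    qed auto
    also have "\<dots> = block_base l (Suc c)" by (simp add: block_base_def)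
    finally show ?thesis using A by linarith
  qed
  note step = this
  have "block_base l n \<le> block_base l (Suc n)" for n
  proof -
    have "block_base l n * 1 \<le> block_base l n * l n" using l by (intro mult_left_mono) auto
    thus ?thesis using step[of n] by linarith
  qed
  hence "block_base l (Suc c) \<le> block_base l d" by (rule lift_Suc_mono_le) (use assms in simp)
  thus ?thesis using step[of c] by linarith
qed

lemma block_base_strict_mono: "strict_mono (block_base l)"
proof (rule strict_monoI)
  fix c d :: nat assume "c < d"
  have "block_base l c * 1 \<le> block_base l c * l c" using l by (intro mult_left_mono) auto
  thus "block_base l c < block_base l d"
    using block_base_gap[OF \<open>c < d\<close>] block_base_pos[of c] by linarith
qed

lemma block_freq_less:
  assumes "(c, j) \<in> block_set l" "(d, i) \<in> block_set l" "c < d"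
  shows "2 * block_freq l (c, j) \<le> block_freq l (d, i)"
proof -
  have "2 * (block_base l c * j) \<le> 2 * (block_base l c * l c)"
    using assms(1) by (auto simp: block_set_def)
  also have "\<dots> \<le> block_base l d * 1" using block_base_gap[OF assms(3)] by simp
  also have "\<dots> \<le> block_base l d * i" using assms(2) by (intro mult_left_mono) (auto simp: block_set_def)
  finally show ?thesis by (simp add: block_freq_def)
qed

lemma block_freq_pos: "s \<in> block_set l \<Longrightarrow> block_freq l s > 0"
  using block_base_pos by (auto simp: block_freq_def block_set_def)

lemma inj_on_block_freq: "inj_on (block_freq l) (block_set l)"
proof (rule inj_onI, clarify)
  fix c j d i assume *: "(c, j) \<in> block_set l" "(d, i) \<in> block_set l" "block_freq l (c, j) = block_freq l (d, i)"
  have "\<not> c < d" using block_freq_less[OF *(1,2)] block_freq_pos[OF *(1)] *(3) by linarith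
  moreover have "\<not> d < c" using block_freq_less[OF *(2,1)] block_freq_pos[OF *(1)] *(3) by linarith
  ultimately have "c = d" by simp
  thus "c = d \<and> j = i" using *(3) block_base_pos[of d] by (auto simp: block_freq_def)
qed

lemma infinite_block_freq: "infinite (block_freq l ` block_set l)"
proof -
  have "(c, 1) \<in> block_set l" for c using l by (simp add: block_set_def)
  hence "range (block_base l) \<subseteq> block_freq l ` block_set l"
    by (auto simp: block_freq_def intro!: image_eqI[where x = "(_, 1)"])
  moreover have "infinite (range (block_base l))"
    using block_base_strict_mono by (intro range_inj_infinite strict_mono_imp_inj_on)
  ultimately show ?thesis using finite_subset by blast
qed

text \<open>The \<open>c\<close>-th block is preceded by at least \<open>c\<close> frequencies, one from each earlier block. Hence the \<open>k\<close>-th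
  frequency belongs to a block with index at most \<open>k\<close>, where the ratios are at least \<open>1 + 1 / l c\<close>.\<close>

lemma block_freq_ratio:
  fixes \<epsilon> :: "nat \<Rightarrow> real"
  assumes \<epsilon>: "\<And>c k. l c \<ge> 2 \<Longrightarrow> c \<le> k \<Longrightarrow> \<epsilon> k * real (l c) \<le> 1"
    and k: "k \<ge> 1" "\<epsilon> k \<le> 1"
  defines "V \<equiv> block_freq l ` block_set l"
  shows "real (enumerate V k) / real (enumerate V (k - 1)) \<ge> 1 + \<epsilon> k"
proof -
  have V: "infinite V" unfolding V_def by (rule infinite_block_freq)
  obtain c j where cj: "(c, j) \<in> block_set l" "enumerate V (k - 1) = block_freq l (c, j)"
    using enumerate_in_set[OF V, of "k - 1"] by (auto simp: V_def)
  obtain d i where di: "(d, i) \<in> block_set l" "enumerate V k = block_freq l (d, i)"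
    using enumerate_in_set[OF V, of k] by (auto simp: V_def)
  have less: "block_freq l (c, j) < block_freq l (d, i)"
    using enumerate_mono[OF _ V, of "k - 1" k] k unfolding cj(2) di(2) by simp
  have pos: "block_freq l (c, j) > 0" using block_freq_pos cj by blast
  have "c \<le> k - 1"
  proof -
    have "enumerate V (k - 1) \<le> block_base l (k - 1)"
    proof (rule enumerate_le_strict_mono[OF block_base_strict_mono _ V])
      have "(c, 1) \<in> block_set l" for c using l by (simp add: block_set_def)
      thus "range (block_base l) \<subseteq> V"
        by (auto simp: V_def block_freq_def intro!: image_eqI[where x = "(_, 1)"])
    qed
    moreover have "block_base l c * 1 \<le> block_base l c * j" using cj(1) by (intro mult_left_mono) (auto simp: block_set_def)
    hence "block_base l c \<le> enumerate V (k - 1)" unfolding cj(2) block_freq_def fst_conv snd_conv by linarith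
    ultimately have "block_base l c \<le> block_base l (k - 1)" by linarith
    thus ?thesis using block_base_strict_mono by (simp add: strict_mono_less_eq)
  qed
  hence ck: "c \<le> k" by simp
  have "\<not> d < c" using block_freq_less[OF di(1) cj(1)] less by linarith
  then consider "c < d" | "d = c" by linarith
  hence "(1 + \<epsilon> k) * real (block_freq l (c, j)) \<le> real (block_freq l (d, i))"
  proof cases
    case 1
    have "(1 + \<epsilon> k) * real (block_freq l (c, j)) \<le> 2 * real (block_freq l (c, j))"
      using k by (intro mult_right_mono) auto
    also have "\<dots> \<le> real (block_freq l (d, i))" using block_freq_less[OF cj(1) di(1) 1] by linarith
    finally show ?thesis .
  next
    case 2
    have ji: "j < i" using less 2 block_base_pos[of c] by (simp add: block_freq_def)
    \<comment> \<open>Two different multiples of a base occur only in a block of length at least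
      \<open>2\<close>, to which the restriction on lengths applies; then
      \<open>\<epsilon> k * j \<le> 1\<close> and \<open>j + 1 \<le> i\<close> give the
      ratio.\<close>
    hence "l c \<ge> 2" using di(1) cj(1) 2 by (auto simp: block_set_def)
    hence e: "\<epsilon> k * real (l c) \<le> 1" using \<epsilon> ck by blast
    have "\<epsilon> k * real j \<le> 1"
    proof (cases "\<epsilon> k \<ge> 0")
      case True
      have "\<epsilon> k * real j \<le> \<epsilon> k * real (l c)" using True cj(1) by (intro mult_left_mono) (auto simp: block_set_def)
      thus ?thesis using e by linarith
    next
      case False
      hence "\<epsilon> k * real j \<le> 0" by (simp add: mult_nonpos_nonneg)
      thus ?thesis by linarith
    qed
    hence "(1 + \<epsilon> k) * real j \<le> real i" using ji by (simp add: distrib_right)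
    hence "real (block_base l c) * ((1 + \<epsilon> k) * real j) \<le> real (block_base l c) * real i"
      by (rule mult_left_mono) simp
    thus ?thesis using 2 by (simp add: block_freq_def mult_ac)
  qed
  thus ?thesis unfolding cj(2) di(2) using pos by (simp add: pos_le_divide_eq)
qed

end

lemma sum_cos_block_freq:
  "(\<Sum>j=1..q. cos (2 * pi * real (block_freq l (c, j)) * x)) = dirichlet q (real (block_base l c) * x)"
  by (simp add: dirichlet_def block_freq_def mult_ac)

subsection \<open>The limit law\<close>

lemma real_distribution_unit:
  assumes "continuous_on UNIV X"
  shows "real_distribution (distr unit_space borel X)"
proof -
  interpret prob_space unit_space by (rule prob_space_unit)
  show ?thesis
    by (rule real_distribution_distr) (intro borel_measurable_unit borel_measurable_continuous_onI assms)
qed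

lemma char_distr_unit:
  assumes "continuous_on UNIV X"
  shows "char (distr unit_space borel X) t = (LINT x|unit_space. iexp (t * X x))"
  unfolding char_def
  by (rule integral_distr) (auto intro: borel_measurable_unit borel_measurable_continuous_onI assms)

text \<open>Existence of a law with characteristic function \<open>G_char\<close> comes from the
  approximating sums: tightness yields a weak limit along a subsequence, continuity identifies its
  characteristic function, and uniqueness makes it the object described by
  \<open>THE\<close>.\<close>

lemma ex_G:
  assumes \<mu>: "tight \<mu>" and lim: "\<And>t. (\<lambda>n. char (\<mu> n) t) \<longlonglongrightarrow> G_char t"
  shows "real_distribution G" "char G t = G_char t"
proof -
  have rd: "real_distribution (\<mu> n)" for n using \<mu> by (simp add: tight_def)
  obtain r M where r: "strict_mono r" and M: "real_distribution M" and w: "weak_conv_m (\<mu> \<circ> id \<circ> r) M"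
    using tight_imp_convergent_subsubsequence[OF \<mu>, of id] by (auto simp: strict_mono_id)
  have cM: "char M t = G_char t" for t
  proof (rule LIMSEQ_unique)
    show "(\<lambda>n. char ((\<mu> \<circ> id \<circ> r) n) t) \<longlonglongrightarrow> char M t"
      by (rule levy_continuity1[OF _ M w]) (simp add: rd)
    show "(\<lambda>n. char ((\<mu> \<circ> id \<circ> r) n) t) \<longlonglongrightarrow> G_char t"
      using LIMSEQ_subseq_LIMSEQ[OF lim r] by (simp add: comp_def)
  qed
  have "G = M"
    unfolding G_def
  proof (rule the_equality)
    show "N = M" if "real_distribution N \<and> (\<forall>t. char N t = G_char t)" for N
      using that M cM by (intro Levy_uniqueness) auto
  qed (use M cM in auto)
  thus "real_distribution G" "char G t = G_char t" using M cM by auto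
qed

section \<open>The modulus of the characteristic function and non-Gaussianity\<close>

lemma psi_Re: "- Re (psi t) = (LINT x|lborel. levy_density x * (1 - cos (t * x)))"
  and integrable_one_minus_cos: "integrable lborel (\<lambda>x. levy_density x * (1 - cos (t * x)))"
proof -
  have i: "integrable lborel (\<lambda>x. levy_density x *\<^sub>R xi t x)"
    by (rule integrable_levy_density[OF _ norm_xi_le]) simp
  have eq: "levy_density x * (1 - cos (t * x)) = - Re (levy_density x *\<^sub>R xi t x)" for x
    by (simp add: xi_def Re_exp algebra_simps)
  show "integrable lborel (\<lambda>x. levy_density x * (1 - cos (t * x)))"
    unfolding eq using i by (intro Bochner_Integration.integrable_minus integrable_Re)
  show "- Re (psi t) = (LINT x|lborel. levy_density x * (1 - cos (t * x)))"
    unfolding eq psi_def by (simp only: Bochner_Integration.integral_minus integral_Re[OF i])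
qed

lemma norm_G_char: "norm (G_char t) = exp (- (LINT x|lborel. levy_density x * (1 - cos (t * x))))"
  unfolding G_char_eq by (simp flip: psi_Re)

text \<open>Excludes point masses. It suffices that the density is positive on
  \<open>(0, 1/2)\<close>: by Jordan's inequality \<open>sin u / u \<ge> 2 / pi \<ge> 1 / 2\<close>
  on \<open>(0, 1]\<close>, so \<open>sinc_upper\<close> is at least \<open>1\<close> there.\<close>

lemma norm_G_char_1: "norm (G_char 1) < 1"
proof -
  define h where "h x = levy_density x * (1 - cos (1 * x))" for x
  have i: "integrable lborel h" unfolding h_def by (rule integrable_one_minus_cos)
  have nn: "h x \<ge> 0" for x unfolding h_def by (intro mult_nonneg_nonneg levy_density_nonneg) simp
  have pos: "h x > 0" if x: "0 < x" "x < 1 / 2" for x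
  proof -
    have "{0<..1} \<subseteq> {u::real. u > 0 \<and> sin u / u \<ge> x}"
    proof
      fix u :: real assume u: "u \<in> {0<..1}"
      have "2 * (u / pi) \<le> sin (pi * (u / pi))" using u pi_gt3 by (intro jordan_sin) (auto simp: field_simps)
      hence "2 / pi \<le> sin u / u" using u by (simp add: field_simps)
      moreover have "1 / 2 \<le> 2 / pi" using pi_less_4 by (simp add: field_simps)
      ultimately have "x \<le> sin u / u" using x by linarith
      thus "u \<in> {u. u > 0 \<and> sin u / u \<ge> x}" using u by simp
    qed
    hence "emeasure lborel {0<..1::real} \<le> emeasure lborel {u::real. u > 0 \<and> sin u / u \<ge> x}"
      by (rule emeasure_mono) measurable
    hence "1 \<le> sinc_upper x" using x unfolding emeasure_sinc_upper[OF x(1)] by simp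
    hence "levy_density x > 0" using x by (simp add: levy_density_def)
    moreover have "cos x < 1" using cos_monotone_0_pi[of 0 x] x pi_gt3 by simp
    ultimately show ?thesis by (simp add: h_def)
  qed
  have "integral\<^sup>L lborel h \<noteq> 0"
  proof
    assume "integral\<^sup>L lborel h = 0"
    hence "AE x in lborel. h x = 0" using integral_nonneg_eq_0_iff_AE[OF i] nn by simp
    hence "AE x in lborel. x \<notin> {0<..<1/2::real}" by eventually_elim (use pos in force)
    hence "emeasure lborel {0<..<1/2::real} = 0"
      by (subst (asm) AE_iff_measurable[of "{0<..<1/2::real}"]) auto
    thus False by simp
  qed
  moreover have "integral\<^sup>L lborel h \<ge> 0" using nn by simp
  ultimately show ?thesis unfolding norm_G_char h_def by (simp add: less_le)
qed

text \<open>\<open>ln \<bar>G_char t\<bar> = o(t\<^sup>2)\<close>, so that \<open>G\<close> has no Gaussian component.\<close>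

lemma ln_norm_G_char_limit:
  "(\<lambda>n. (LINT x|lborel. levy_density x * (1 - cos (real n * x))) / (real n)\<^sup>2) \<longlonglongrightarrow> 0"
proof -
  have cosle: "1 - cos y \<le> y\<^sup>2 / 2" for y :: real
  proof -
    have "1 - cos y = 2 * (sin (y / 2))\<^sup>2" using cos_double_sin[of "y / 2"] by simp
    also have "(sin (y / 2))\<^sup>2 \<le> (y / 2)\<^sup>2"
      using abs_sin_x_le_abs_x[of "y / 2"] by (rule abs_le_square_iff[THEN iffD1])
    finally show ?thesis by (simp add: power_divide)
  qed
  define s where "s n x = levy_density x * (1 - cos (real n * x)) / (real n)\<^sup>2" for n x
  have "(\<lambda>n. integral\<^sup>L lborel (s n)) \<longlonglongrightarrow> integral\<^sup>L lborel (\<lambda>_ :: real. 0)"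
  proof (rule integral_dominated_convergence[where w = "\<lambda>x. levy_density x *\<^sub>R x\<^sup>2"])
    show "integrable lborel (\<lambda>x. levy_density x *\<^sub>R x\<^sup>2)"
      by (rule integrable_levy_density[where C = 1]) auto
    show "AE x in lborel. (\<lambda>n. s n x) \<longlonglongrightarrow> 0"
      unfolding s_def
    proof (rule AE_I2, rule Lim_null_comparison)
      fix x :: real
      show "\<forall>\<^sub>F n in sequentially. norm (levy_density x * (1 - cos (real n * x)) / (real n)\<^sup>2) \<le> levy_density x * (2 * (1 / (real n)\<^sup>2))"
      proof (rule always_eventually, rule allI)
        fix n
        have "\<bar>1 - cos (real n * x)\<bar> \<le> 2" using cos_ge_minus_one[of "real n * x"] cos_le_one[of "real n * x"] by linarith
        hence "levy_density x * \<bar>1 - cos (real n * x)\<bar> / (real n)\<^sup>2 \<le> levy_density x * 2 / (real n)\<^sup>2"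
          by (intro divide_right_mono mult_left_mono levy_density_nonneg) auto
        thus "norm (levy_density x * (1 - cos (real n * x)) / (real n)\<^sup>2) \<le> levy_density x * (2 * (1 / (real n)\<^sup>2))"
          using levy_density_nonneg[of x] by (simp add: abs_mult)
      qed
      have "(\<lambda>n. 2 * (1 / (real n)\<^sup>2)) \<longlonglongrightarrow> 0" by real_asymp
      thus "(\<lambda>n. levy_density x * (2 * (1 / (real n)\<^sup>2))) \<longlonglongrightarrow> 0" by (rule tendsto_mult_right_zero)
    qed
    fix n :: nat
    show "s n \<in> borel_measurable lborel" unfolding s_def by measurable
    show "AE x in lborel. norm (s n x) \<le> levy_density x *\<^sub>R x\<^sup>2"
      unfolding s_def
    proof (rule AE_I2)
      fix x :: real
      have "(1 - cos (real n * x)) / (real n)\<^sup>2 \<le> x\<^sup>2"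
      proof (cases "n = 0")
        case False
        have "(1 - cos (real n * x)) \<le> (real n)\<^sup>2 * x\<^sup>2 / 2" using cosle[of "real n * x"] by (simp add: power_mult_distrib)
        also have "\<dots> \<le> (real n)\<^sup>2 * x\<^sup>2" by simp
        finally show ?thesis using False by (simp add: divide_le_eq mult.commute)
      qed simp
      hence "levy_density x * ((1 - cos (real n * x)) / (real n)\<^sup>2) \<le> levy_density x * x\<^sup>2"
        by (rule mult_left_mono) (rule levy_density_nonneg)
      thus "norm (levy_density x * (1 - cos (real n * x)) / (real n)\<^sup>2) \<le> levy_density x *\<^sub>R x\<^sup>2"
        using levy_density_nonneg[of x] by (simp add: abs_mult)
    qed
  qed measurable
  moreover have "integral\<^sup>L lborel (s n) = (LINT x|lborel. levy_density x * (1 - cos (real n * x))) / (real n)\<^sup>2" for n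
    unfolding s_def by (rule integral_divide_zero)
  ultimately show ?thesis by simp
qed

lemma char_normal_density:
  assumes "s > 0"
  shows "norm (char (density lborel (\<lambda>x. ennreal (normal_density m s x))) t) = exp (- (s * t)\<^sup>2 / 2)"
proof -
  interpret std: prob_space "density lborel (\<lambda>x. ennreal (std_normal_density x))"
    by (rule prob_space_normal_density) simp
  have d: "distributed (density lborel (\<lambda>x. ennreal (std_normal_density x))) lborel (\<lambda>x. x) std_normal_density"
    by (auto simp: distributed_def intro!: distr_id2 simp: cong: distr_cong)
  have "distributed (density lborel (\<lambda>x. ennreal (std_normal_density x))) lborel (\<lambda>x. m + s * x) (normal_density (m + s * 0) (\<bar>s\<bar> * 1))"
    using assms by (intro std.normal_density_affine d) auto
  hence eq: "density lborel (\<lambda>x. ennreal (normal_density m s x)) =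
      distr (density lborel (\<lambda>x. ennreal (std_normal_density x))) lborel (\<lambda>x. m + s * x)"
    using assms by (simp add: distributed_def)
  have "char (density lborel (\<lambda>x. ennreal (normal_density m s x))) t =
     (LINT x|density lborel (\<lambda>x. ennreal (std_normal_density x)). iexp (t * (m + s * x)))"
    unfolding eq char_def by (rule integral_distr) auto
  also have "\<dots> = (LINT x|density lborel (\<lambda>x. ennreal (std_normal_density x)). iexp (t * m) * iexp ((t * s) * x))"
    by (simp add: algebra_simps flip: exp_add)
  also have "\<dots> = iexp (t * m) * char std_normal_distribution (t * s)"
    unfolding char_def by (rule integral_mult_right_zero)
  finally show ?thesis by (simp add: char_std_normal_distribution norm_mult power_mult_distrib mult.commute)
qed

text \<open>The characteristic function of a point mass has modulus \<open>1\<close>; for a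
  nondegenerate normal law, minus the logarithm of the modulus is exactly quadratic in
  \<open>t\<close>, which contradicts \<open>ln_norm_G_char_limit\<close>.\<close>

lemma not_gaussian_G:
  assumes G: "\<And>t. char G t = G_char t"
  shows "\<not> gaussian G"
proof
  assume "gaussian G"
  then consider m where "G = return borel m"
    | m s where "s > 0" "G = density lborel (\<lambda>x. ennreal (normal_density m s x))"
    by (auto simp: gaussian_def)
  thus False
  proof cases
    case 1
    have "char G 1 = iexp (1 * m)" unfolding 1 char_def by (rule integral_return) auto
    thus False using norm_G_char_1 by (simp add: G)
  next
    case 2
    have eq: "(LINT x|lborel. levy_density x * (1 - cos (t * x))) = (s * t)\<^sup>2 / 2" for t
      using char_normal_density[OF 2(1), of m t] G[of t] unfolding 2(2)[symmetric] by (simp add: norm_G_char)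
    have "(\<lambda>n. (s * real n)\<^sup>2 / 2 / (real n)\<^sup>2) \<longlonglongrightarrow> 0"
      using ln_norm_G_char_limit unfolding eq .
    moreover have "\<forall>\<^sub>F n in sequentially. (s * real n)\<^sup>2 / 2 / (real n)\<^sup>2 = s\<^sup>2 / 2"
      using eventually_gt_at_top[of 0] by eventually_elim (simp add: power_mult_distrib)
    ultimately have "(\<lambda>n::nat. s\<^sup>2 / 2) \<longlonglongrightarrow> 0" by (rule Lim_transform_eventually)
    thus False using 2(1) by (simp add: LIMSEQ_const_iff)
  qed
qed

subsection \<open>Convergence to the limit law\<close>

text \<open>Within \<open>d = sqrt a\<close> of the integers the minimum is at most
  \<open>1\<close>, on a set of measure at most \<open>2 * d\<close>; elsewhere the kernel is at
  most \<open>1 / (2 * d)\<close>, which contributes \<open>a / (2 * d) = d / 2\<close>. The bound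
  is uniform in \<open>q\<close>, so even an exponentially long block costs no more than a short
  one.\<close>

lemma integral_min_dirichlet_le:
  assumes a: "a \<ge> 0" and m: "m > (0::nat)"
  shows "(LINT x|unit_space. min 1 (a * \<bar>dirichlet q (real m * x)\<bar>)) \<le> 5 / 2 * sqrt a"
proof (cases "a = 0")
  case False
  interpret prob_space unit_space by (rule prob_space_unit)
  define d where "d = sqrt a"
  have d: "d > 0" "d * d = a" using a False by (auto simp: d_def)
  have c: "continuous_on UNIV (\<lambda>y. min 1 (a * \<bar>dirichlet q y\<bar>))"
    by (intro continuous_intros)
  have ind: "integrable unit_space (indicator A :: real \<Rightarrow> real)" "integral\<^sup>L unit_space (indicator A :: real \<Rightarrow> real) \<le> d"
    if "A = {0..d} \<or> A = {1 - d..1}" for A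
  proof -
    have A: "A \<in> sets borel" using that by auto
    have 1: "integrable lborel (indicator A :: real \<Rightarrow> real)" "integral\<^sup>L lborel (indicator A :: real \<Rightarrow> real) = d"
      using that d by auto
    have eq: "(\<lambda>x. indicator {0..1} x *\<^sub>R (indicator A x :: real)) = (\<lambda>x. indicator ({0..1} \<inter> A) x)"
      by (auto simp: indicator_def)
    have 2: "integrable lborel (indicator ({0..1} \<inter> A) :: real \<Rightarrow> real)"
    proof (rule integrable_real_indicator)
      show "emeasure lborel ({0..1} \<inter> A) < \<infinity>"
        using emeasure_mono[of "{0..1} \<inter> A" "{0..1::real}" lborel] A by (auto intro: le_less_trans)
    qed (use A in auto)
    show "integrable unit_space (indicator A :: real \<Rightarrow> real)"
      unfolding unit_integrable_eq eq using 2 by simp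
    have "integral\<^sup>L unit_space (indicator A :: real \<Rightarrow> real) = integral\<^sup>L lborel (indicator ({0..1} \<inter> A) :: real \<Rightarrow> real)"
      unfolding unit_integral_eq eq by simp
    also have "\<dots> \<le> integral\<^sup>L lborel (indicator A :: real \<Rightarrow> real)"
      by (rule integral_mono[OF 2 1(1)]) (auto simp: indicator_def)
    finally show "integral\<^sup>L unit_space (indicator A :: real \<Rightarrow> real) \<le> d" using 1 by simp
  qed
  have "(LINT x|unit_space. min 1 (a * \<bar>dirichlet q (real m * x)\<bar>)) = (LINT y|unit_space. min 1 (a * \<bar>dirichlet q y\<bar>))"
    by (rule integral_unit_scale[OF c _ m]) simp
  also have "\<dots> \<le> (LINT y|unit_space. (indicator {0..d} y + indicator {1 - d..1} y) + a / (2 * d))"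
  proof (rule integral_mono[OF integrable_unit_continuous[OF c]])
    show "integrable unit_space (\<lambda>y. (indicator {0..d} y + indicator {1 - d..1} y) + a / (2 * d))"
      using ind by (intro Bochner_Integration.integrable_add) auto
    fix y assume "y \<in> space unit_space"
    hence y: "0 \<le> y" "y \<le> 1" by auto
    show "min 1 (a * \<bar>dirichlet q y\<bar>) \<le> (indicator {0..d} y + indicator {1 - d..1} y) + a / (2 * d)"
    proof (cases "y \<in> {0..d} \<or> y \<in> {1 - d..1}")
      case True
      hence "1 \<le> (indicator {0..d} y + indicator {1 - d..1} y :: real)" by (auto simp: indicator_def)
      moreover have "0 \<le> a / (2 * d)" using a d by simp
      ultimately show ?thesis by linarith
    next
      case False
      hence yd: "d < y" "d < 1 - y" using y by auto
      have "\<bar>dirichlet q y\<bar> \<le> 1 / (2 * d)"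
      proof (cases "y \<le> 1 / 2")
        case True
        have "\<bar>dirichlet q y\<bar> \<le> 1 / (2 * y)" using yd d True by (intro abs_dirichlet_le_inverse) auto
        also have "\<dots> \<le> 1 / (2 * d)" using yd d by (intro divide_left_mono) auto
        finally show ?thesis .
      next
        case False
        have "\<bar>dirichlet q (1 - y)\<bar> \<le> 1 / (2 * (1 - y))" using yd d False by (intro abs_dirichlet_le_inverse) auto
        also have "\<dots> \<le> 1 / (2 * d)" using yd d by (intro divide_left_mono) auto
        finally show ?thesis by simp
      qed
      hence "a * \<bar>dirichlet q y\<bar> \<le> a * (1 / (2 * d))" using a by (rule mult_left_mono)
      hence "min 1 (a * \<bar>dirichlet q y\<bar>) \<le> a / (2 * d)" by (simp add: min.coboundedI2)
      moreover have "indicator {0..d} y = (0 :: real)" "indicator {1 - d..1} y = (0 :: real)" using False by auto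
      ultimately show ?thesis by simp
    qed
  qed
  also have "\<dots> = integral\<^sup>L unit_space (indicator {0..d}) + integral\<^sup>L unit_space (indicator {1 - d..1}) + a / (2 * d)"
    using ind prob_space by simp
  also have "\<dots> \<le> d + d + d / 2"
  proof -
    have "a / (2 * d) = d / 2" using d by (simp add: field_simps)
    thus ?thesis using ind(2)[of "{0..d}"] ind(2)[of "{1 - d..1}"] by simp
  qed
  finally show ?thesis by (simp add: d_def)
qed simp

lemma norm_iexp_diff_le_2: "norm (iexp a - iexp b) \<le> 2"
  using norm_triangle_ineq4[of "iexp a" "iexp b"] by simp

text \<open>Perturbations are measured by \<open>\<integral> min 1 \<bar>X\<bar>\<close>, which tolerates the heavy tails of single kernels.\<close>

lemma norm_iexp_diff_le_sum:
  assumes "\<bar>a - b\<bar> \<le> A + (\<Sum>i\<in>I. B i)" "A \<ge> 0" "\<And>i. i \<in> I \<Longrightarrow> B i \<ge> 0" "finite I"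
  shows "norm (iexp a - iexp b) \<le> A + 2 * (\<Sum>i\<in>I. min 1 (B i))"
proof (cases "\<exists>i\<in>I. B i \<ge> 1")
  case True
  then obtain i where i: "i \<in> I" "B i \<ge> 1" by auto
  have "min 1 (B i) \<le> (\<Sum>i\<in>I. min 1 (B i))"
    using assms i by (intro member_le_sum) auto
  hence "1 \<le> (\<Sum>i\<in>I. min 1 (B i))" using i by simp
  thus ?thesis using norm_iexp_diff_le_2[of a b] assms(2) by linarith
next
  case False
  hence "(\<Sum>i\<in>I. min 1 (B i)) = (\<Sum>i\<in>I. B i)" by (intro sum.cong) auto
  moreover have "(\<Sum>i\<in>I. B i) \<ge> 0" using assms by (intro sum_nonneg) auto
  ultimately show ?thesis using norm_iexp_diff_le[of a b] assms(1) by linarith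
qed

lemma block_start_triangular: "2 * block_start Suc b = b * Suc b"
  by (induction b) (auto simp: block_start_def)

lemma block_start_power2: "block_start (\<lambda>b. 2 ^ b) b + 1 = 2 ^ b"
  by (induction b) (auto simp: block_start_def)

lemma sum_alternate:
  "(\<Sum>k<N. f (if even k then u (k div 2) else v (k div 2))) =
    (\<Sum>k<Suc N div 2. f (u k)) + (\<Sum>k<N div 2. f (v k) :: real)"
proof (induction N)
  case (Suc N)
  thus ?case by (cases "even N") (auto elim!: evenE oddE)
qed simp

lemma inj_block_enumeration:
  assumes w: "\<And>i. w i \<ge> 1" and e: "inj e"
  shows "inj (\<lambda>k. (e (fst (block_term w k)), snd (block_term w k)))"
proof (rule injI)
  fix k k' assume "(e (fst (block_term w k)), snd (block_term w k)) = (e (fst (block_term w k')), snd (block_term w k'))"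
  hence "block_term w k = block_term w k'" using e by (auto simp: inj_eq intro: prod_eqI)
  thus "k = k'" using inj_block_term[OF w] by (auto simp: inj_eq)
qed

lemma sum_cos_block_enumeration:
  assumes w: "\<And>i. w i \<ge> 1"
  shows "(\<Sum>k<N. cos (2 * pi * real (block_freq l (e (fst (block_term w k)), snd (block_term w k))) * x)) =
    (\<Sum>i<block_index w N. dirichlet (w i) (real (block_base l (e i)) * x)) +
    dirichlet (N - block_start w (block_index w N)) (real (block_base l (e (block_index w N))) * x)"
  using sum_block_term[where w = w, OF w, where f = "\<lambda>s. cos (2 * pi * real (block_freq l (e (fst s), snd s)) * x)" and N = N]
  by (simp only: fst_conv snd_conv sum_cos_block_freq)

text \<open>The missed elements come from the blocks \<open>Suc (e i)\<close>, which the selection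
  skips.\<close>

lemma infinite_block_set_diff:
  assumes l: "\<And>c. l c \<ge> 1" and e: "\<And>i. Suc (e i) < e (Suc i)" and u: "\<And>k. fst (u k) \<in> range e"
  shows "infinite (block_set l - range u)"
proof -
  have mono: "strict_mono e"
    using e by (auto simp: strict_mono_Suc_iff intro: Suc_lessD)
  have "Suc (e i) \<noteq> e j" for i j
  proof
    assume eq: "Suc (e i) = e j"
    hence "i < j" using strict_mono_less[OF mono, of i j] by simp
    hence "e (Suc i) \<le> e j" using strict_mono_less_eq[OF mono] by (simp add: Suc_le_eq)
    thus False using e[of i] eq by simp
  qed
  hence "(Suc (e i), 1) \<notin> range u" for i using u by (metis fst_conv rangeE)
  hence "range (\<lambda>i. (Suc (e i), 1)) \<subseteq> block_set l - range u"
    using l by (auto simp: block_set_def)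
  moreover have "infinite (range (\<lambda>i. (Suc (e i), 1 :: nat)))"
    using mono by (intro range_inj_infinite) (auto simp: inj_def strict_mono_eq)
  ultimately show ?thesis using finite_subset by blast
qed

text \<open>The proportion of \<open>N\<close> used up by the blocks of length \<open>1, \<dots>, R\<close> tends to \<open>1 / 2\<close>: the limit law
  has variance \<open>1 / 4\<close>, while the normalised sums have variance \<open>1 / 2\<close>. The other half is taken
  from blocks of length \<open>1, 2, 4, \<dots>\<close>, whose contribution tends to \<open>0\<close> in probability although
  its variance does not.\<close>

lemma clt_rearrangement:
  assumes l: "\<And>c. l c \<ge> 1" and l_inf: "\<And>r. r \<ge> 1 \<Longrightarrow> infinite {c. l c = r}"
  shows "\<exists>\<tau>. bij_betw \<tau> UNIV (block_set l) \<and> (\<forall>t.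
    (\<lambda>N. LINT x|unit_space. iexp (t * (real N powr (- 1 / 2) * (\<Sum>k<N. cos (2 * pi * real (block_freq l (\<tau> k)) * x)))))
      \<longlonglongrightarrow> exp (psi t))"
proof -
  interpret prob_space unit_space by (rule prob_space_unit)
  \<comment> \<open>One selection serves both kinds of blocks: even indices give the lengths
    \<open>1, 2, 3, ...\<close>, odd indices \<open>1, 2, 4, ...\<close>.\<close>
  define w where "w i = (if even i then Suc (i div 2) else 2 ^ (i div 2))" for i :: nat
  have "\<exists>e. (\<forall>i. l (e i) = w i) \<and> (\<forall>i. Suc (e i) < e (Suc i))"
    by (rule ex_block_selection[OF l_inf]) (auto simp: w_def)
  then obtain e where e: "\<And>i. l (e i) = w i" "\<And>i. Suc (e i) < e (Suc i)" by blast
  have mono: "strict_mono e" using e(2) by (auto simp: strict_mono_Suc_iff intro: Suc_lessD)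
  define \<alpha> where "\<alpha> b = e (2 * b)" for b
  define \<delta> where "\<delta> b = e (Suc (2 * b))" for b
  have l\<alpha>: "l (\<alpha> b) = Suc b" and l\<delta>: "l (\<delta> b) = 2 ^ b" for b by (simp_all add: \<alpha>_def \<delta>_def e(1) w_def)
  have inj\<alpha>: "inj \<alpha>" and inj\<delta>: "inj \<delta>" using mono by (auto simp: inj_def \<alpha>_def \<delta>_def strict_mono_eq)
  have \<alpha>_less: "\<alpha> b < \<alpha> (Suc b)" for b using strict_monoD[OF mono, of "2 * b" "2 * Suc b"] by (simp add: \<alpha>_def)
  define p2 where "p2 b = (2::nat) ^ b" for b
  have p2: "p2 b \<ge> 1" for b by (simp add: p2_def)
  have S1: "Suc b \<ge> 1" for b by simp
  define uA where "uA k = (\<alpha> (fst (block_term Suc k)), snd (block_term Suc k))" for k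
  define uD where "uD k = (\<delta> (fst (block_term p2 k)), snd (block_term p2 k))" for k
  \<comment> \<open>Alternating term by term, and not block by block, keeps the shares of both kinds
    at one half for every \<open>N\<close>.\<close>
  define u where "u k = (if even k then uA (k div 2) else uD (k div 2))" for k
  have inj_uA: "inj uA" unfolding uA_def using inj\<alpha> by (intro inj_block_enumeration) auto
  have inj_uD: "inj uD" unfolding uD_def using inj\<delta> p2 by (intro inj_block_enumeration) auto
  have AD: "uA k \<noteq> uD k'" for k k'
    using strict_mono_eq[OF mono] by (auto simp: uA_def uD_def \<alpha>_def \<delta>_def) presburger+
  have "inj u"
  proof (rule injI)
    fix a b assume "u a = u b"
    hence "even a = even b \<and> a div 2 = b div 2"
      using AD[of "a div 2" "b div 2"] AD[of "b div 2" "a div 2"] inj_uA inj_uD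
      by (auto simp: u_def inj_eq split: if_splits)
    thus "a = b" by (metis even_two_times_div_two odd_two_times_div_two_succ)
  qed
  have uA_set: "uA k \<in> block_set l" for k
    using snd_block_term[where w = Suc and k = k, OF S1] by (auto simp: uA_def block_set_def l\<alpha>)
  have uD_set: "uD k \<in> block_set l" for k
    using snd_block_term[where w = p2 and k = k, OF p2] by (auto simp: uD_def block_set_def l\<delta> p2_def)
  have "\<exists>\<tau>. bij_betw \<tau> UNIV (block_set l) \<and> (\<forall>(f :: nat \<times> nat \<Rightarrow> real) N. (\<forall>s. \<bar>f s\<bar> \<le> 1) \<longrightarrow>
    \<bar>(\<Sum>k<N. f (\<tau> k)) - (\<Sum>k<N. f (u k))\<bar> \<le> 2 * real (sparse_count N))"
  proof (rule ex_sparse_completion[OF \<open>inj u\<close>])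
    show "range u \<subseteq> block_set l" using uA_set uD_set by (auto simp: u_def)
    show "infinite (block_set l - range u)"
      by (rule infinite_block_set_diff[where e = e, OF l e(2)]) (auto simp: u_def uA_def uD_def \<alpha>_def \<delta>_def)
  qed
  then obtain \<tau> where \<tau>: "bij_betw \<tau> UNIV (block_set l)"
    and near: "\<And>(f :: nat \<times> nat \<Rightarrow> real) N. (\<forall>s. \<bar>f s\<bar> \<le> 1) \<Longrightarrow>
      \<bar>(\<Sum>k<N. f (\<tau> k)) - (\<Sum>k<N. f (u k))\<bar> \<le> 2 * real (sparse_count N)" by blast
  define m where "m b = block_base l (\<alpha> b)" for b
  have mpos: "m b > 0" for b unfolding m_def by (rule block_base_pos[where l = l, OF l])
  define T where "T R x = (\<Sum>i<R. dirichlet (Suc i) (real (m i) * x))" for R x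
  define C where "C t R = (LINT x|unit_space. iexp (t * (T R x / real R)))" for t R
  have Clim: "C t \<longlonglongrightarrow> exp (psi t)" for t
    unfolding C_def T_def
  proof (rule char_block_sum_limit[OF mpos])
    fix i
    define X where "X = (\<Sum>j<i. m j * (Suc j)\<^sup>2)"
    have "4 ^ i * X\<^sup>2 \<le> m i"
      using block_base_growth[where l = l and e = \<alpha> and i = i, OF l \<alpha>_less] by (simp add: X_def m_def l\<alpha>)
    moreover have "2 ^ i * X \<le> 4 ^ i * X\<^sup>2"
    proof (rule mult_mono)
      show "(2::nat) ^ i \<le> 4 ^ i" by (rule power_mono) auto
      show "X \<le> X\<^sup>2" by (cases X) (auto simp: power2_eq_square)
    qed auto
    ultimately have "real (2 ^ i * X) \<le> real (m i)" by (intro of_nat_mono) linarith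
    thus "2 ^ i * (\<Sum>j<i. real (m j) * (real (Suc j))\<^sup>2) \<le> real (m i)"
      by (simp add: X_def)
  qed
  \<comment> \<open>By orthogonality the second moment is \<open>R * (R + 1) / 4\<close>, and
    \<open>|T| \<le> T^2 / (2 * R) + R / 2\<close>. The bound pays for replacing the normalisation
    \<open>R\<close> by \<open>sqrt N\<close>.\<close>
  have TL1: "(LINT x|unit_space. \<bar>T R x\<bar>) \<le> real R" for R
  proof (cases "R = 0")
    case False
    have c: "continuous_on UNIV (T R)" unfolding T_def by (intro continuous_intros)
    have eq: "T R x = (\<Sum>k<block_start Suc R. cos (2 * pi * real (block_freq l (uA k)) * x))" for x
      using sum_block_term_start[where w = Suc, OF S1, where f = "\<lambda>s. cos (2 * pi * real (block_freq l (\<alpha> (fst s), snd s)) * x)" and b = R]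
      by (simp only: fst_conv snd_conv sum_cos_block_freq uA_def T_def m_def)
    have "(LINT x|unit_space. (T R x)\<^sup>2) = real (card {..<block_start Suc R}) / 2"
      unfolding eq
    proof (rule integral_unit_cos_sum_sq)
      show "inj_on (\<lambda>k. block_freq l (uA k)) {..<block_start Suc R}"
        using inj_on_block_freq[where l = l, OF l] inj_uA uA_set by (auto simp: inj_on_def)
      show "block_freq l (uA k) > 0" for k using block_freq_pos[where l = l, OF l uA_set] .
    qed simp
    also have "\<dots> = real R * real (Suc R) / 4"
      using arg_cong[OF block_start_triangular[of R], of real] by (simp add: algebra_simps)
    finally have sq: "(LINT x|unit_space. (T R x)\<^sup>2) = real R * real (Suc R) / 4" .
    have "(LINT x|unit_space. \<bar>T R x\<bar>) \<le> (LINT x|unit_space. (T R x)\<^sup>2 * (1 / (2 * real R)) + real R / 2)"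
    proof (rule integral_mono)
      fix x
      have "0 \<le> (\<bar>T R x\<bar> - real R)\<^sup>2" by simp
      hence "2 * \<bar>T R x\<bar> * real R \<le> (T R x)\<^sup>2 + (real R)\<^sup>2" by (simp add: power2_diff)
      thus "\<bar>T R x\<bar> \<le> (T R x)\<^sup>2 * (1 / (2 * real R)) + real R / 2"
        using False by (simp add: field_simps power2_eq_square)
    qed (intro integrable_unit_continuous continuous_intros c)+
    also have "\<dots> = (LINT x|unit_space. (T R x)\<^sup>2) * (1 / (2 * real R)) + real R / 2"
      using prob_space False by (subst Bochner_Integration.integral_add)
        (auto intro!: integrable_unit_continuous continuous_intros c)
    also have "\<dots> \<le> real R" using False by (simp add: sq field_simps)
    finally show ?thesis .
  qed (simp add: T_def)
  define R where "R N = block_index Suc (Suc N div 2)" for N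
  define B where "B N = block_index p2 (N div 2)" for N
  define qA where "qA N = Suc N div 2 - block_start Suc (R N)" for N
  \<comment> \<open>Full length for the finished long blocks and the length reached so far for the
    current one, \<open>i = B N\<close>, so that all of them are estimated alike.\<close>
  define qD where "qD N i = (if i < B N then p2 i else N div 2 - block_start p2 (B N))" for N i
  \<comment> \<open>About \<open>N / 2\<close> terms fill blocks of total length
    \<open>R * (R + 1) / 2\<close>, so \<open>R\<close> is asymptotic to \<open>sqrt N\<close>. This
    is where the share of one half enters.\<close>
  have R1: "(real (R N))\<^sup>2 \<le> real N + 1" and R2: "real N \<le> (real (R N) + 2)\<^sup>2" for N
  proof -
    have "block_start Suc (R N) \<le> Suc N div 2" "Suc N div 2 < block_start Suc (Suc (R N))"
      unfolding R_def by (rule block_index_bounds[where w = Suc, OF S1])+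
    hence "R N * Suc (R N) \<le> Suc N" "N \<le> Suc (R N) * Suc (Suc (R N))"
      using block_start_triangular[of "R N"] block_start_triangular[of "Suc (R N)"] by linarith+
    hence "real (R N * Suc (R N)) \<le> real (Suc N)" "real N \<le> real (Suc (R N) * Suc (Suc (R N)))"
      by (simp_all only: of_nat_le_iff)
    thus "(real (R N))\<^sup>2 \<le> real N + 1" "real N \<le> (real (R N) + 2)\<^sup>2"
      by (simp_all add: power2_eq_square algebra_simps)
  qed
  have R_le: "real (R N) \<le> sqrt (real N + 1)" and R_ge: "sqrt (real N) - 2 \<le> real (R N)" for N
  proof -
    show "real (R N) \<le> sqrt (real N + 1)" using R1[of N] by (rule real_le_rsqrt)
    have "sqrt (real N) \<le> real (R N) + 2" by (rule real_le_lsqrt) (use R2[of N] in auto)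
    thus "sqrt (real N) - 2 \<le> real (R N)" by simp
  qed
  \<comment> \<open>Exponential lengths leave only logarithmically many kernels, each with the same
    bound from \<open>integral_min_dirichlet_le\<close>.\<close>
  have B_le: "real (B N) \<le> log 2 (real N + 1)" for N
  proof -
    have "block_start p2 (B N) \<le> N div 2" unfolding B_def by (rule block_index_bounds[where w = p2, OF p2])
    hence "2 ^ B N \<le> N + 1" using block_start_power2[of "B N"] by (simp add: p2_def[abs_def])
    hence "real (2 ^ B N) \<le> real (N + 1)" by (simp only: of_nat_le_iff)
    hence "(2::real) ^ B N \<le> real N + 1" by simp
    thus ?thesis by (simp add: le_log_iff powr_realpow)
  qed
  define S where "S N x = (\<Sum>k<N. cos (2 * pi * real (block_freq l (\<tau> k)) * x))" for N x
  have decomp: "\<bar>S N x - T (R N) x\<bar> \<le> 2 * real (sparse_count N) + (\<bar>dirichlet (qA N) (real (m (R N)) * x)\<bar> +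
      (\<Sum>i\<le>B N. \<bar>dirichlet (qD N i) (real (block_base l (\<delta> i)) * x)\<bar>))" for N x
  proof -
    define f where "f s = cos (2 * pi * real (block_freq l s) * x)" for s
    have "(\<Sum>k<N. f (u k)) = (\<Sum>k<Suc N div 2. f (uA k)) + (\<Sum>k<N div 2. f (uD k))"
      unfolding u_def by (rule sum_alternate)
    also have "(\<Sum>k<Suc N div 2. f (uA k)) = T (R N) x + dirichlet (qA N) (real (m (R N)) * x)"
      unfolding f_def uA_def T_def m_def R_def qA_def by (rule sum_cos_block_enumeration[where w = Suc, OF S1])
    also have "(\<Sum>k<N div 2. f (uD k)) = (\<Sum>i<B N. dirichlet (p2 i) (real (block_base l (\<delta> i)) * x)) +
        dirichlet (N div 2 - block_start p2 (B N)) (real (block_base l (\<delta> (B N))) * x)"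
      unfolding f_def uD_def B_def by (rule sum_cos_block_enumeration[where w = p2, OF p2])
    also have "\<dots> = (\<Sum>i\<le>B N. dirichlet (qD N i) (real (block_base l (\<delta> i)) * x))"
      unfolding lessThan_Suc_atMost[symmetric] by (simp add: qD_def)
    finally have "\<bar>(\<Sum>k<N. f (u k)) - T (R N) x\<bar> \<le> \<bar>dirichlet (qA N) (real (m (R N)) * x)\<bar> +
        (\<Sum>i\<le>B N. \<bar>dirichlet (qD N i) (real (block_base l (\<delta> i)) * x)\<bar>)"
      using sum_abs[of "\<lambda>i. dirichlet (qD N i) (real (block_base l (\<delta> i)) * x)" "{..B N}"] by linarith
    moreover have "\<bar>(\<Sum>k<N. f (\<tau> k)) - (\<Sum>k<N. f (u k))\<bar> \<le> 2 * real (sparse_count N)"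
      by (rule near) (simp add: f_def)
    ultimately show ?thesis by (simp add: S_def f_def)
  qed
  \<comment> \<open>The three errors come from the normalisation, from the inserted frequencies, and
    from \<open>B N + 2\<close> kernels: the long ones and the unfinished block of the first kind.
    Each of these kernels costs a multiple of \<open>sqrt a\<close> with
    \<open>a = |t| / sqrt N\<close>, so their total is of order
    \<open>ln N / N powr (1/4)\<close>.\<close>
  have close: "norm ((LINT x|unit_space. iexp (t * (real N powr (- 1 / 2) * S N x))) - C t (R N)) \<le>
      \<bar>t\<bar> * \<bar>real (R N) / sqrt (real N) - 1\<bar> + 2 * \<bar>t\<bar> * (real (sparse_count N) / sqrt (real N)) +
      2 * ((real (B N) + 2) * (5 / 2 * sqrt (\<bar>t\<bar> / sqrt (real N))))"
    if N: "N > 0" and RN: "R N > 0" for N t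
  proof -
    define a where "a = \<bar>t\<bar> / sqrt (real N)"
    have a: "a \<ge> 0" by (simp add: a_def)
    \<comment> \<open>Index \<open>0\<close> is the unfinished block of the first kind;
      \<open>Suc i\<close> is the \<open>i\<close>-th long block.\<close>
    define q where "q i = (case i of 0 \<Rightarrow> qA N | Suc i \<Rightarrow> qD N i)" for i
    define M where "M i = (case i of 0 \<Rightarrow> m (R N) | Suc i \<Rightarrow> block_base l (\<delta> i))" for i
    have Mpos: "M i > 0" for i using mpos block_base_pos[where l = l, OF l] by (simp add: M_def split: nat.split)
    have pw: "real N powr (- 1 / 2) = 1 / sqrt (real N)"
      using N by (simp add: powr_minus_divide powr_half_sqrt)
    define A where "A x = \<bar>t\<bar> * \<bar>1 / sqrt (real N) - 1 / real (R N)\<bar> * \<bar>T (R N) x\<bar> + a * (2 * real (sparse_count N))" for x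
    have cT: "continuous_on UNIV (T n)" for n unfolding T_def by (intro continuous_intros)
    have cS: "continuous_on UNIV (S n)" for n unfolding S_def by (intro continuous_intros)
    have cA: "continuous_on UNIV A" unfolding A_def by (intro continuous_intros cT)
    have point: "norm (iexp (t * (real N powr (- 1 / 2) * S N x)) - iexp (t * (T (R N) x / real (R N)))) \<le>
        A x + 2 * (\<Sum>i\<le>Suc (B N). min 1 (a * \<bar>dirichlet (q i) (real (M i) * x)\<bar>))" for x
    proof (rule norm_iexp_diff_le_sum)
      have "t * (real N powr (- 1 / 2) * S N x) - t * (T (R N) x / real (R N)) =
          t * (1 / sqrt (real N)) * (S N x - T (R N) x) + t * (1 / sqrt (real N) - 1 / real (R N)) * T (R N) x"
        unfolding pw by (simp add: algebra_simps)
      also have "\<bar>\<dots>\<bar> \<le> \<bar>t * (1 / sqrt (real N)) * (S N x - T (R N) x)\<bar> + \<bar>t * (1 / sqrt (real N) - 1 / real (R N)) * T (R N) x\<bar>"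
        by (rule abs_triangle_ineq)
      also have "\<bar>t * (1 / sqrt (real N)) * (S N x - T (R N) x)\<bar> = a * \<bar>S N x - T (R N) x\<bar>"
        by (simp add: a_def abs_mult)
      also have "\<dots> \<le> a * (2 * real (sparse_count N) + (\<Sum>i\<le>Suc (B N). \<bar>dirichlet (q i) (real (M i) * x)\<bar>))"
      proof (rule mult_left_mono[OF _ a])
        have "(\<Sum>i\<le>Suc (B N). \<bar>dirichlet (q i) (real (M i) * x)\<bar>) = \<bar>dirichlet (qA N) (real (m (R N)) * x)\<bar> +
            (\<Sum>i\<le>B N. \<bar>dirichlet (qD N i) (real (block_base l (\<delta> i)) * x)\<bar>)"
          by (subst sum.atMost_Suc_shift) (simp add: q_def M_def)
        thus "\<bar>S N x - T (R N) x\<bar> \<le> 2 * real (sparse_count N) + (\<Sum>i\<le>Suc (B N). \<bar>dirichlet (q i) (real (M i) * x)\<bar>)"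
          using decomp[of N x] by simp
      qed
      finally show "\<bar>t * (real N powr (- 1 / 2) * S N x) - t * (T (R N) x / real (R N))\<bar> \<le>
          A x + (\<Sum>i\<le>Suc (B N). a * \<bar>dirichlet (q i) (real (M i) * x)\<bar>)"
        by (simp add: A_def abs_mult distrib_left sum_distrib_left)
    qed (use a in \<open>auto simp: A_def\<close>)
    have "(LINT x|unit_space. iexp (t * (real N powr (- 1 / 2) * S N x))) - C t (R N) =
        (LINT x|unit_space. iexp (t * (real N powr (- 1 / 2) * S N x)) - iexp (t * (T (R N) x / real (R N))))"
      unfolding C_def divide_inverse
      by (intro Bochner_Integration.integral_diff[symmetric] integrable_unit_continuous continuous_intros cS cT)
    also have "norm \<dots> \<le> (LINT x|unit_space. norm (iexp (t * (real N powr (- 1 / 2) * S N x)) - iexp (t * (T (R N) x / real (R N)))))"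
      by (rule integral_norm_bound)
    also have "\<dots> \<le> (LINT x|unit_space. A x + 2 * (\<Sum>i\<le>Suc (B N). min 1 (a * \<bar>dirichlet (q i) (real (M i) * x)\<bar>)))"
      unfolding divide_inverse
      by (rule integral_mono[OF _ _ point[unfolded divide_inverse]])
        (intro integrable_unit_continuous continuous_intros cS cT cA)+
    also have "\<dots> = (LINT x|unit_space. A x) + 2 * (\<Sum>i\<le>Suc (B N). (LINT x|unit_space. min 1 (a * \<bar>dirichlet (q i) (real (M i) * x)\<bar>)))"
      by (subst Bochner_Integration.integral_add,
          (intro integrable_unit_continuous continuous_intros cA)+,
          subst integral_mult_right_zero, subst Bochner_Integration.integral_sum,
          (intro integrable_unit_continuous continuous_intros)+, rule refl)
    also have "\<dots> \<le> (\<bar>t\<bar> * \<bar>1 / sqrt (real N) - 1 / real (R N)\<bar> * real (R N) + a * (2 * real (sparse_count N))) +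
        2 * (\<Sum>i\<le>Suc (B N). 5 / 2 * sqrt a)"
    proof (intro add_mono mult_left_mono sum_mono integral_min_dirichlet_le a Mpos)
      have "(LINT x|unit_space. A x) = \<bar>t\<bar> * \<bar>1 / sqrt (real N) - 1 / real (R N)\<bar> * (LINT x|unit_space. \<bar>T (R N) x\<bar>) + a * (2 * real (sparse_count N))"
        unfolding A_def using prob_space
        by (subst Bochner_Integration.integral_add) (auto intro!: integrable_unit_continuous continuous_intros cT)
      also have "\<dots> \<le> \<bar>t\<bar> * \<bar>1 / sqrt (real N) - 1 / real (R N)\<bar> * real (R N) + a * (2 * real (sparse_count N))"
        by (intro add_right_mono mult_left_mono TL1) auto
      finally show "(LINT x|unit_space. A x) \<le> \<dots>" .
    qed auto
    also have "\<bar>t\<bar> * \<bar>1 / sqrt (real N) - 1 / real (R N)\<bar> * real (R N) = \<bar>t\<bar> * \<bar>real (R N) / sqrt (real N) - 1\<bar>"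
    proof -
      have "\<bar>1 / sqrt (real N) - 1 / real (R N)\<bar> * real (R N) = \<bar>(1 / sqrt (real N) - 1 / real (R N)) * real (R N)\<bar>"
        by (simp add: abs_mult)
      also have "(1 / sqrt (real N) - 1 / real (R N)) * real (R N) = real (R N) / sqrt (real N) - 1"
        using RN by (simp add: left_diff_distrib)
      finally show ?thesis by (simp add: mult.assoc)
    qed
    finally show ?thesis by (simp add: a_def mult_ac add_ac)
  qed
  have main: "(\<lambda>N. LINT x|unit_space. iexp (t * (real N powr (- 1 / 2) * S N x))) \<longlonglongrightarrow> exp (psi t)" for t
  proof -
    define E where "E N = \<bar>t\<bar> * (sqrt (real N + 1) / sqrt (real N) - 1 + 2 / sqrt (real N)) +
        2 * \<bar>t\<bar> * (log 2 (2 * (real N + 1)) / sqrt (real N)) +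
        5 * (sqrt \<bar>t\<bar> * ((log 2 (real N + 1) + 2) / sqrt (sqrt (real N))))" for N :: nat
    have R_top: "filterlim R at_top sequentially"
    proof -
      have "filterlim (\<lambda>N. sqrt (real N) - 2) at_top sequentially" by real_asymp
      hence "filterlim (\<lambda>N. real (R N)) at_top sequentially"
        by (rule filterlim_at_top_mono) (simp add: R_ge)
      thus ?thesis by (simp add: filterlim_sequentially_iff_filterlim_real)
    qed
    have "(\<lambda>N. (LINT x|unit_space. iexp (t * (real N powr (- 1 / 2) * S N x))) - C t (R N)) \<longlonglongrightarrow> 0"
    proof (rule Lim_null_comparison)
      have "\<forall>\<^sub>F N in sequentially. 1 \<le> R N" using R_top by (simp add: filterlim_at_top)
      thus "\<forall>\<^sub>F N in sequentially. norm ((LINT x|unit_space. iexp (t * (real N powr (- 1 / 2) * S N x))) - C t (R N)) \<le> E N"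
        using eventually_gt_at_top[of 0]
      proof eventually_elim
        case (elim N)
        have s: "sqrt (real N) > 0" using elim by simp
        have "real (R N) / sqrt (real N) \<le> sqrt (real N + 1) / sqrt (real N)"
          using R_le[of N] by (intro divide_right_mono) auto
        moreover have "(sqrt (real N) - 2) / sqrt (real N) \<le> real (R N) / sqrt (real N)"
          using R_ge[of N] by (intro divide_right_mono) auto
        hence "1 - 2 / sqrt (real N) \<le> real (R N) / sqrt (real N)" using s by (simp add: diff_divide_distrib)
        moreover have "1 \<le> sqrt (real N + 1) / sqrt (real N)" using s by (simp add: le_divide_eq_1)
        moreover have "0 \<le> 2 / sqrt (real N)" by simp
        ultimately have "\<bar>real (R N) / sqrt (real N) - 1\<bar> \<le> sqrt (real N + 1) / sqrt (real N) - 1 + 2 / sqrt (real N)"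
          by linarith
        hence 1: "\<bar>t\<bar> * \<bar>real (R N) / sqrt (real N) - 1\<bar> \<le> \<bar>t\<bar> * (sqrt (real N + 1) / sqrt (real N) - 1 + 2 / sqrt (real N))"
          by (rule mult_left_mono) simp
        have 2: "2 * \<bar>t\<bar> * (real (sparse_count N) / sqrt (real N)) \<le> 2 * \<bar>t\<bar> * (log 2 (2 * (real N + 1)) / sqrt (real N))"
          using sparse_count_le_log[of N] by (intro mult_left_mono divide_right_mono) auto
        have "2 * ((real (B N) + 2) * (5 / 2 * sqrt (\<bar>t\<bar> / sqrt (real N)))) =
            5 * (sqrt \<bar>t\<bar> * ((real (B N) + 2) / sqrt (sqrt (real N))))"
          by (simp add: real_sqrt_divide)
        also have "\<dots> \<le> 5 * (sqrt \<bar>t\<bar> * ((log 2 (real N + 1) + 2) / sqrt (sqrt (real N))))"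
          using B_le[of N] by (intro mult_left_mono divide_right_mono) auto
        finally show ?case using close[of N t] elim 1 2 by (simp add: E_def)
      qed
      have "(\<lambda>N. \<bar>t\<bar> * (sqrt (real N + 1) / sqrt (real N) - 1 + 2 / sqrt (real N))) \<longlonglongrightarrow> 0"
        by (rule tendsto_mult_right_zero) real_asymp
      moreover have "(\<lambda>N. 2 * \<bar>t\<bar> * (log 2 (2 * (real N + 1)) / sqrt (real N))) \<longlonglongrightarrow> 0"
        by (rule tendsto_mult_right_zero) real_asymp
      moreover have "(\<lambda>N. (log 2 (real N + 1) + 2) / sqrt (sqrt (real N))) \<longlonglongrightarrow> 0" by real_asymp
      hence "(\<lambda>N. 5 * (sqrt \<bar>t\<bar> * ((log 2 (real N + 1) + 2) / sqrt (sqrt (real N))))) \<longlonglongrightarrow> 0"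
        by (intro tendsto_mult_right_zero)
      ultimately have "E \<longlonglongrightarrow> 0 + 0 + 0" unfolding E_def by (intro tendsto_add)
      thus "E \<longlonglongrightarrow> 0" by simp
    qed
    moreover have "(\<lambda>N. C t (R N)) \<longlonglongrightarrow> exp (psi t)"
      using filterlim_compose[OF Clim R_top] .
    ultimately have "(\<lambda>N. ((LINT x|unit_space. iexp (t * (real N powr (- 1 / 2) * S N x))) - C t (R N)) + C t (R N)) \<longlonglongrightarrow> 0 + exp (psi t)"
      by (rule tendsto_add)
    thus ?thesis by simp
  qed
  show ?thesis using \<tau> main unfolding S_def by blast
qed

text \<open>Orthogonality bounds the second moments uniformly in \<open>N\<close>, and Chebyshev's
  inequality gives tightness.\<close>

lemma tight_normalised_cos_sum:
  fixes f :: "nat \<Rightarrow> nat"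
  assumes f: "inj f" "\<And>k. f k > 0"
  shows "tight (\<lambda>N. distr unit_space borel (\<lambda>x. real N powr (- 1 / 2) * (\<Sum>k<N. cos (2 * pi * real (f k) * x)) + c))"
proof -
  define X where "X N x = real N powr (- 1 / 2) * (\<Sum>k<N. cos (2 * pi * real (f k) * x)) + c" for N x
  interpret prob_space unit_space by (rule prob_space_unit)
  have cX: "continuous_on UNIV (X N)" for N unfolding X_def by (intro continuous_intros)
  have second: "(LINT x|unit_space. (X N x)\<^sup>2) \<le> 1 + 2 * c\<^sup>2" for N
  proof -
    define s where "s x = (\<Sum>k<N. cos (2 * pi * real (f k) * x))" for x
    have cs: "continuous_on UNIV s" unfolding s_def by (intro continuous_intros)
    have sq: "(LINT x|unit_space. (s x)\<^sup>2) = real N / 2"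
      unfolding s_def using f by (subst integral_unit_cos_sum_sq) (auto intro: inj_on_subset)
    have "(LINT x|unit_space. (X N x)\<^sup>2) \<le> (LINT x|unit_space. 2 * (real N powr (- 1 / 2))\<^sup>2 * (s x)\<^sup>2 + 2 * c\<^sup>2)"
    proof (rule integral_mono)
      fix x
      have "0 \<le> (real N powr (- 1 / 2) * s x - c)\<^sup>2" by simp
      thus "(X N x)\<^sup>2 \<le> 2 * (real N powr (- 1 / 2))\<^sup>2 * (s x)\<^sup>2 + 2 * c\<^sup>2"
        by (simp add: X_def s_def power2_sum power2_diff power_mult_distrib)
    qed (intro integrable_unit_continuous continuous_intros cX cs)+
    also have "\<dots> = 2 * (real N powr (- 1 / 2))\<^sup>2 * (real N / 2) + 2 * c\<^sup>2"
      using prob_space by (subst Bochner_Integration.integral_add)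
        (auto intro!: integrable_unit_continuous continuous_intros cs simp: sq)
    also have "(real N powr (- 1 / 2))\<^sup>2 * real N \<le> 1"
    proof (cases "N = 0")
      case False
      have "(real N powr (- 1 / 2))\<^sup>2 = real N powr (- 1)"
        by (simp add: power2_eq_square flip: powr_add)
      thus ?thesis using False by (simp add: powr_minus_divide)
    qed simp
    hence "2 * (real N powr (- 1 / 2))\<^sup>2 * (real N / 2) + 2 * c\<^sup>2 \<le> 1 + 2 * c\<^sup>2" by simp
    finally show ?thesis .
  qed
  have "\<exists>a b. a < b \<and> (\<forall>N. measure (distr unit_space borel (X N)) {a<..b} > 1 - \<epsilon>)" if \<epsilon>: "\<epsilon> > 0" for \<epsilon> :: real
  proof -
    \<comment> \<open>The second moments are at most \<open>1 + 2 * c^2\<close>; the larger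
      numerator makes the final inequality strict.\<close>
    define K where "K = sqrt ((2 + 2 * c\<^sup>2) / \<epsilon>)"
    have K: "K > 0" "K\<^sup>2 = (2 + 2 * c\<^sup>2) / \<epsilon>" using \<epsilon> by (auto simp: K_def add_pos_nonneg divide_nonneg_pos)
    have "measure (distr unit_space borel (X N)) {- K<..K} > 1 - \<epsilon>" for N
    proof -
      have Xm [measurable]: "X N \<in> borel_measurable unit_space"
        by (intro borel_measurable_unit borel_measurable_continuous_onI cX)
      define A where "A = X N -` {- K<..K} \<inter> space unit_space"
      have ev: "A \<in> events" unfolding A_def by (rule measurable_sets[OF Xm]) simp
      have "measure (distr unit_space borel (X N)) {- K<..K} = prob A"
        unfolding A_def by (rule measure_distr) auto
      also have "\<dots> = expectation (indicator A)"
        using ev by (simp add: sets.Int_space_eq2 del: space_unit)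
      also have "\<dots> \<ge> expectation (\<lambda>x. 1 - (X N x)\<^sup>2 / K\<^sup>2)"
      proof (rule integral_mono)
        show "integrable unit_space (\<lambda>x. 1 - (X N x)\<^sup>2 / K\<^sup>2)"
          using K by (intro integrable_unit_continuous continuous_intros cX) auto
        show "integrable unit_space (indicat_real A)"
          using ev by (intro integrable_real_indicator) (auto simp: emeasure_eq_measure)
        fix x assume x: "x \<in> space unit_space"
        show "1 - (X N x)\<^sup>2 / K\<^sup>2 \<le> indicat_real A x"
        proof (cases "X N x \<in> {- K<..K}")
          case False
          hence "K \<le> \<bar>X N x\<bar>" by auto
          hence "K\<^sup>2 \<le> (X N x)\<^sup>2" using K by (metis abs_le_square_iff abs_of_pos)
          hence "1 \<le> (X N x)\<^sup>2 / K\<^sup>2" using K(1) by (simp add: le_divide_eq_1)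
          moreover have "0 \<le> indicat_real A x" by simp
          ultimately show ?thesis by linarith
        qed (use x in \<open>auto simp: indicator_def A_def\<close>)
      qed
      also have "expectation (\<lambda>x. 1 - (X N x)\<^sup>2 / K\<^sup>2) = 1 - expectation (\<lambda>x. (X N x)\<^sup>2) / K\<^sup>2"
        using prob_space K(1) by (subst Bochner_Integration.integral_diff)
          (auto intro!: integrable_unit_continuous continuous_intros cX)
      finally have 1: "1 - expectation (\<lambda>x. (X N x)\<^sup>2) / K\<^sup>2 \<le> measure (distr unit_space borel (X N)) {- K<..K}" .
      have "expectation (\<lambda>x. (X N x)\<^sup>2) / K\<^sup>2 \<le> (1 + 2 * c\<^sup>2) / K\<^sup>2"
        using second by (intro divide_right_mono) auto
      also have "\<dots> < (2 + 2 * c\<^sup>2) / K\<^sup>2" using K(1) by (intro divide_strict_right_mono) auto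
      also have "\<dots> = \<epsilon>"
      proof -
        have "2 + 2 * c\<^sup>2 > 0" by (simp add: add_pos_nonneg)
        thus ?thesis unfolding K(2) using \<epsilon> by simp
      qed
      finally show ?thesis using 1 by linarith
    qed
    thus ?thesis using K by (intro exI[of _ "- K"] exI[of _ K]) auto
  qed
  thus ?thesis using real_distribution_unit[OF cX] unfolding tight_def X_def by blast
qed

subsection \<open>Failure of the law of the iterated logarithm\<close>

text \<open>A Lipschitz minorant of the indicator of the event that the kernel is at least
  \<open>r / 2\<close>. Writing it through \<open>cos\<close> makes it periodic and measures the
  distance to the nearest integer on the scale \<open>1 / r\<close>.\<close>

definition peak :: "nat \<Rightarrow> real \<Rightarrow> real" where
  "peak r y = max 0 (1 - 2 * (real r)\<^sup>2 * (1 - cos (2 * pi * y)))"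

lemma continuous_on_peak [continuous_intros]:
  fixes f :: "'a::t2_space \<Rightarrow> real"
  shows "continuous_on A f \<Longrightarrow> continuous_on A (\<lambda>x. peak r (f x))"
  unfolding peak_def by (intro continuous_intros)

lemma peak_periodic [simp]: "peak r (y + 1) = peak r y"
  using cos_2pi_periodic[of 1 y] by (simp add: peak_def)

lemma peak_nonneg: "0 \<le> peak r y" and peak_le_1: "peak r y \<le> 1"
proof -
  have "0 \<le> (real r)\<^sup>2 * (1 - cos (2 * pi * y))" by simp
  thus "0 \<le> peak r y" "peak r y \<le> 1" by (simp_all add: peak_def)
qed

lemma peak_lipschitz: "\<bar>peak r x - peak r y\<bar> \<le> 4 * pi * (real r)\<^sup>2 * \<bar>x - y\<bar>"
proof -
  have "\<bar>peak r x - peak r y\<bar> \<le> \<bar>2 * (real r)\<^sup>2 * (cos (2 * pi * x) - cos (2 * pi * y))\<bar>"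
    unfolding peak_def by (auto simp: algebra_simps abs_if max_def)
  also have "\<dots> = 2 * (real r)\<^sup>2 * \<bar>cos (2 * pi * x) - cos (2 * pi * y)\<bar>" by (simp add: abs_mult)
  also have "\<dots> \<le> 2 * (real r)\<^sup>2 * \<bar>2 * pi * x - 2 * pi * y\<bar>" by (intro mult_left_mono abs_cos_diff_le) simp
  also have "\<bar>2 * pi * x - 2 * pi * y\<bar> = 2 * pi * \<bar>x - y\<bar>" by (simp add: abs_mult flip: right_diff_distrib)
  finally show ?thesis by (simp add: mult_ac)
qed

lemma abs_sin_mult_le: "\<bar>sin (real j * x)\<bar> \<le> real j * \<bar>sin x\<bar>"
proof (induction j)
  case (Suc j)
  have "sin (real (Suc j) * x) = sin (real j * x) * cos x + cos (real j * x) * sin x"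
    by (simp add: algebra_simps sin_add)
  also have "\<bar>\<dots>\<bar> \<le> \<bar>sin (real j * x)\<bar> * \<bar>cos x\<bar> + \<bar>cos (real j * x)\<bar> * \<bar>sin x\<bar>"
    by (rule order_trans[OF abs_triangle_ineq]) (simp add: abs_mult)
  also have "\<dots> \<le> \<bar>sin (real j * x)\<bar> * 1 + 1 * \<bar>sin x\<bar>"
    by (intro add_mono mult_left_mono mult_right_mono) auto
  finally show ?case using Suc by (simp add: algebra_simps)
qed simp

lemma one_minus_cos_mult_le: "1 - cos (real j * x) \<le> (real j)\<^sup>2 * (1 - cos x)"
proof -
  have half: "1 - cos y = 2 * (sin (y / 2))\<^sup>2" for y :: real using cos_double_sin[of "y / 2"] by simp
  have "\<bar>sin (real j * (x / 2))\<bar> \<le> real j * \<bar>sin (x / 2)\<bar>" by (rule abs_sin_mult_le)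
  hence "\<bar>sin (real j * (x / 2))\<bar>\<^sup>2 \<le> (real j * \<bar>sin (x / 2)\<bar>)\<^sup>2" by (rule power_mono) simp
  thus ?thesis unfolding half by (simp add: power_mult_distrib)
qed

text \<open>Each of the \<open>r\<close> cosines is at least \<open>1 / 2\<close>, because
  \<open>1 - cos\<close> grows at most quadratically under multiples of the angle.\<close>

lemma dirichlet_ge_of_peak:
  assumes "peak r y > 0"
  shows "dirichlet r y \<ge> real r / 2"
proof -
  have p: "2 * ((real r)\<^sup>2 * (1 - cos (2 * pi * y))) < 1" using assms by (simp add: peak_def max_def split: if_splits)
  have "real r / 2 = (\<Sum>j=1..r. 1 / 2)" by simp
  also have "\<dots> \<le> dirichlet r y"
    unfolding dirichlet_def
  proof (rule sum_mono)
    fix j assume j: "j \<in> {1..r}"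
    have "1 - cos (real j * (2 * pi * y)) \<le> (real j)\<^sup>2 * (1 - cos (2 * pi * y))" by (rule one_minus_cos_mult_le)
    also have "\<dots> \<le> (real r)\<^sup>2 * (1 - cos (2 * pi * y))" using j by (intro mult_right_mono power_mono) auto
    finally have "1 / 2 \<le> cos (real j * (2 * pi * y))" using p by linarith
    thus "1 / 2 \<le> cos (2 * pi * real j * y)" by (simp add: mult_ac)
  qed
  finally show ?thesis .
qed

lemma integral_unit_peak_ge:
  assumes r: "r \<ge> 1"
  shows "integral\<^sup>L unit_space (peak r) \<ge> 1 / (30 * real r)"
proof -
  \<comment> \<open>Up to this \<open>d\<close>, \<open>1 - cos (2 * pi * x)\<close> is at most
    \<open>2 * (pi * d)^2 = 1 / (8 * r^2)\<close>, so \<open>peak\<close> is at least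
    \<open>3 / 4\<close>. The constant \<open>30\<close> is a rounding of
    \<open>3 / 4 * d = 3 / (16 * pi * r)\<close>.\<close>
  define d where "d = 1 / (4 * pi * real r)"
  have d: "0 < d" "d \<le> 1"
  proof -
    show "0 < d" using r by (simp add: d_def)
    have "1 * 1 \<le> (4 * pi) * real r" using r pi_gt3 by (intro mult_mono) auto
    thus "d \<le> 1" using r by (simp add: d_def)
  qed
  have c: "continuous_on UNIV (peak r)" using continuous_on_peak[of UNIV "\<lambda>x. x"] by simp
  have "(3 / 4) * d = (LINT x|lborel. (3 / 4) * indicator {0..d} x)" using d by simp
  also have "\<dots> \<le> (LINT x|lborel. indicator {0..1} x *\<^sub>R peak r x)"
  proof (rule integral_mono)
    show "integrable lborel (\<lambda>x. (3 / 4) * indicator {0..d} x :: real)" using d by simp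
    show "integrable lborel (\<lambda>x. indicator {0..1} x *\<^sub>R peak r x)"
      using integrable_unit_continuous[OF c] by (simp add: unit_integrable_eq)
    fix x :: real
    show "(3 / 4) * indicator {0..d} x \<le> indicator {0..1} x *\<^sub>R peak r x"
    proof (cases "x \<in> {0..d}")
      case True
      have "1 - cos (2 * pi * x) = 2 * (sin (pi * x))\<^sup>2" using cos_double_sin[of "pi * x"] by (simp add: mult_ac)
      also have "(sin (pi * x))\<^sup>2 \<le> (pi * x)\<^sup>2"
        using abs_sin_x_le_abs_x[of "pi * x"] by (rule abs_le_square_iff[THEN iffD1])
      also have "(pi * x)\<^sup>2 \<le> (pi * d)\<^sup>2" using True by (intro power_mono mult_left_mono) auto
      also have "(pi * d)\<^sup>2 = 1 / (16 * (real r)\<^sup>2)" by (simp add: d_def power_mult_distrib power_divide)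
      finally have "2 * (real r)\<^sup>2 * (1 - cos (2 * pi * x)) \<le> 2 * (real r)\<^sup>2 * (2 * (1 / (16 * (real r)\<^sup>2)))"
        by (intro mult_left_mono) auto
      also have "\<dots> = 1 / 4" using r by simp
      finally have "3 / 4 \<le> peak r x" by (simp add: peak_def)
      thus ?thesis using True d by (auto simp: indicator_def)
    qed (auto simp: indicator_def peak_nonneg)
  qed
  also have "\<dots> = integral\<^sup>L unit_space (peak r)" by (simp add: unit_integral_eq)
  finally have "3 / 4 * d \<le> integral\<^sup>L unit_space (peak r)" .
  moreover have "1 / (30 * real r) \<le> 3 / 4 * d"
    using r pi_less_4 pi_gt_zero by (simp add: d_def field_simps)
  ultimately show ?thesis by linarith
qed

section \<open>Block lengths of order \<open>b ln b\<close> and their two series\<close>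

definition lil_length :: "nat \<Rightarrow> nat" where
  "lil_length b = nat \<lceil>(real b + 3) * ln (real b + 3)\<rceil>"

text \<open>The purpose of the shift by \<open>3\<close> in \<open>lil_length\<close>: the argument
  exceeds \<open>exp 1\<close> for every \<open>b\<close>.\<close>

lemma ln_ge_1: "1 \<le> ln (real b + 3)"
proof -
  have "exp 1 \<le> real b + 3" using e_less_272 by simp
  thus ?thesis by (simp add: ln_ge_iff)
qed

lemma lil_length_bounds: "(real b + 3) * ln (real b + 3) \<le> real (lil_length b)"
  "real (lil_length b) \<le> 2 * ((real b + 3) * ln (real b + 3))" "lil_length b \<ge> 1"
proof -
  have "(real b + 3) * 1 \<le> (real b + 3) * ln (real b + 3)" using ln_ge_1 by (intro mult_left_mono) auto
  moreover have "3 \<le> (real b + 3) * 1" by simp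
  ultimately have 1: "3 \<le> (real b + 3) * ln (real b + 3)" by (rule order_trans[rotated])
  show 2: "(real b + 3) * ln (real b + 3) \<le> real (lil_length b)" unfolding lil_length_def by linarith
  have "real (lil_length b) \<le> (real b + 3) * ln (real b + 3) + 1" unfolding lil_length_def using 1 by linarith
  thus "real (lil_length b) \<le> 2 * ((real b + 3) * ln (real b + 3))" using 1 by linarith
  show "lil_length b \<ge> 1" using 1 2 by linarith
qed

lemma lil_length_mono: "a \<le> b \<Longrightarrow> lil_length a \<le> lil_length b"
proof -
  assume "a \<le> b"
  hence "(real a + 3) * ln (real a + 3) \<le> (real b + 3) * ln (real b + 3)"
    using ln_ge_1[of a] by (intro mult_mono) auto
  thus ?thesis unfolding lil_length_def by (intro nat_mono ceiling_mono)
qed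

lemma block_start_lil_le: "block_start lil_length b \<le> b * lil_length b"
  using sum_bounded_above[of "{..<b}" lil_length "lil_length b"] lil_length_mono
  by (auto simp: block_start_def)

text \<open>Comparison with the telescoping sum of increments of \<open>ln ln x\<close>: two
  applications of \<open>ln y \<le> y - 1\<close> bound an increment by
  \<open>1 / (x * ln x)\<close>. The offset \<open>I\<close> is there because peaks have to be found
  beyond every index.\<close>

lemma sum_inverse_lil_length_unbounded:
  "filterlim (\<lambda>n. \<Sum>b<n. 1 / real (lil_length (I + b))) at_top sequentially"
proof -
  define x where "x b = real (I + b) + 3" for b
  have step: "ln (ln (x (Suc b))) - ln (ln (x b)) \<le> 2 * (1 / real (lil_length (I + b)))" for b
  proof -
    have x: "x b > 0" "x (Suc b) = x b + 1" "1 < x b" by (simp_all add: x_def)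
    have l1: "1 \<le> ln (x b)" "1 \<le> ln (x (Suc b))" unfolding x_def by (rule ln_ge_1)+
    have "ln (ln (x (Suc b))) - ln (ln (x b)) = ln (ln (x (Suc b)) / ln (x b))" using l1 by (simp add: ln_div)
    also have "\<dots> \<le> ln (x (Suc b)) / ln (x b) - 1" using l1 by (intro ln_le_minus_one) simp
    also have "\<dots> = ln (x (Suc b) / x b) / ln (x b)" using l1 x by (simp add: ln_div diff_divide_distrib)
    also have "\<dots> \<le> (x (Suc b) / x b - 1) / ln (x b)"
      using l1 x by (intro divide_right_mono ln_le_minus_one) auto
    also have "\<dots> = 1 / (x b * ln (x b))" using x by (simp add: field_simps)
    also have "\<dots> \<le> 2 * (1 / real (lil_length (I + b)))"
    proof -
      have p: "0 < real (lil_length (I + b))" using lil_length_bounds(3)[of "I + b"] by simp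
      have "real (lil_length (I + b)) \<le> 2 * (x b * ln (x b))" unfolding x_def by (rule lil_length_bounds(2))
      thus ?thesis using p l1 x by (simp add: field_simps)
    qed
    finally show ?thesis .
  qed
  have low: "(ln (ln (x n)) - ln (ln (x 0))) / 2 \<le> (\<Sum>b<n. 1 / real (lil_length (I + b)))" for n
  proof -
    have "ln (ln (x n)) - ln (ln (x 0)) = (\<Sum>b<n. ln (ln (x (Suc b))) - ln (ln (x b)))"
      by (rule sum_lessThan_telescope[symmetric])
    also have "\<dots> \<le> (\<Sum>b<n. 2 * (1 / real (lil_length (I + b))))" by (intro sum_mono step)
    finally show ?thesis unfolding sum_distrib_left[symmetric] by simp
  qed
  have "filterlim (\<lambda>n. (ln (ln (x n)) - ln (ln (x 0))) / 2) at_top sequentially"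
    unfolding x_def of_nat_add by real_asymp
  thus ?thesis by (rule filterlim_at_top_mono) (intro always_eventually allI low)
qed

text \<open>The terms are at most \<open>1 / (x * (ln x)^2)\<close> with \<open>x = b + 3\<close>,
  which telescopes against \<open>1 / ln\<close>. By \<open>N_b \<le> b * r_b\<close> this series
  dominates the sum of \<open>N_b / r_b^3\<close>.\<close>

lemma summable_lil: "summable (\<lambda>b. (real b + 3) / (real (lil_length b))\<^sup>2)"
proof -
  define y where "y b = 1 / ln (real b + 2)" for b
  have bound: "(real b + 3) / (real (lil_length b))\<^sup>2 \<le> y b - y (Suc b)" for b
  proof -
    define x where "x = real b + 3"
    have l: "1 \<le> ln x" "x > 1" unfolding x_def using ln_ge_1 by auto
    have p: "0 < lil_length b" using lil_length_bounds(3)[of b] by simp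
    have l0: "0 < ln (x - 1)" unfolding x_def by simp
    have le: "ln (x - 1) \<le> ln x" using x_def by simp
    have "x * ln x \<le> real (lil_length b)" unfolding x_def by (rule lil_length_bounds(1))
    moreover have "0 \<le> x * ln x" using l by (intro mult_nonneg_nonneg) linarith+
    ultimately have "(x * ln x)\<^sup>2 \<le> (real (lil_length b))\<^sup>2" by (rule power_mono)
    hence "x / (real (lil_length b))\<^sup>2 \<le> x / (x * ln x)\<^sup>2"
      using l p by (intro divide_left_mono) (auto intro!: mult_pos_pos zero_less_power)
    also have "\<dots> = (1 / x) / (ln x * ln x)" using l by (simp add: power2_eq_square field_simps)
    also have "\<dots> \<le> (ln x - ln (x - 1)) / (ln x * ln x)"
    proof (rule divide_right_mono)
      have "ln ((x - 1) / x) \<le> (x - 1) / x - 1" using x_def by (intro ln_le_minus_one) simp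
      hence "ln (x - 1) - ln x \<le> (x - 1) / x - 1" using x_def by (simp add: ln_div)
      also have "\<dots> = - (1 / x)" using l by (simp add: field_simps)
      finally show "1 / x \<le> ln x - ln (x - 1)" by linarith
    qed simp
    also have "\<dots> \<le> (ln x - ln (x - 1)) / (ln (x - 1) * ln x)"
      using l l0 le by (intro divide_left_mono mult_right_mono) auto
    also have "\<dots> = 1 / ln (x - 1) - 1 / ln x" using l l0 by (simp add: field_simps)
    finally show ?thesis by (simp add: y_def x_def algebra_simps)
  qed
  have "y \<longlonglongrightarrow> 0" unfolding y_def by real_asymp
  hence "summable (\<lambda>b. y b - y (Suc b))" using telescope_summable'[of y 0] by simp
  thus ?thesis by (rule summable_comparison_test'[where N = 0]) (use bound in auto)
qed

context
  fixes m :: "nat \<Rightarrow> nat"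
  assumes m_pos: "\<And>b. m b > 0"
    and m_growth: "\<And>b. 4 ^ b * (\<Sum>j<b. real (m j) * (real (lil_length j))\<^sup>2)\<^sup>2 \<le> real (m b)"
begin

lemma weight_le: "(\<Sum>j<b. real (m j) * (real (lil_length j))\<^sup>2) / real (m b) \<le> (1 / 4) ^ b"
proof -
  define X where "X = (\<Sum>j<b. m j * (lil_length j)\<^sup>2)"
  have X: "(\<Sum>j<b. real (m j) * (real (lil_length j))\<^sup>2) = real X" by (simp add: X_def)
  have "real X \<le> (real X)\<^sup>2" by (cases X) (auto simp: power2_eq_square)
  hence "4 ^ b * real X \<le> 4 ^ b * (real X)\<^sup>2" by (rule mult_left_mono) simp
  hence "4 ^ b * real X \<le> real (m b)" by (rule order_trans[OF _ m_growth[of b, unfolded X]])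
  thus ?thesis using m_pos[of b] unfolding X by (simp add: field_simps power_one_over)
qed

text \<open>The second Borel-Cantelli lemma in integrated form. The probability of no peak from
  \<open>I\<close> on is at most the integral of a product of factors \<open>1 - peak\<close>;
  decoupled, this is at most \<open>exp (- s n / 30)\<close> plus an error geometric in
  \<open>I\<close>.\<close>

lemma AE_infinitely_many_peaks:
  "AE x in unit_space. \<exists>\<^sub>\<infinity>b. peak (lil_length b) (real (m b) * x) > 0"
proof -
  interpret prob_space unit_space by (rule prob_space_unit)
  define A where "A I = {x \<in> space unit_space. \<forall>b\<ge>I. peak (lil_length b) (real (m b) * x) \<le> 0}" for I
  have cp: "continuous_on UNIV (\<lambda>x. peak (lil_length b) (real (m b) * x))" for b
    by (intro continuous_intros)
  have pm [measurable]: "(\<lambda>x. peak (lil_length b) (real (m b) * x)) \<in> borel_measurable unit_space" for b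
    by (intro borel_measurable_unit borel_measurable_continuous_onI cp)
  have Am: "A I \<in> events" for I unfolding A_def by measurable
  have A_le: "prob (A I) \<le> 8 * pi * (1 / 4) ^ I" for I
  proof -
    define f where "f i y = 1 - peak (lil_length (I + i)) y" for i y
    have cf: "continuous_on UNIV (f i)" for i unfolding f_def by (intro continuous_intros)
    define s where "s n = (\<Sum>b<n. 1 / real (lil_length (I + b)))" for n
    have fin: "prob (A I) \<le> exp (- s n / 30) + 8 * pi * (1 / 4) ^ I" for n
    proof -
      have "prob (A I) = (LINT x|unit_space. indicat_real (A I) x)"
        using Am[of I] by (simp add: sets.Int_space_eq2 del: space_unit)
      also have "\<dots> \<le> (LINT x|unit_space. (\<Prod>i<n. f i (real (m (I + i)) * x)))"
      proof (rule integral_mono)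
        show "integrable unit_space (indicat_real (A I))"
          using Am by (intro integrable_real_indicator) (auto simp: emeasure_eq_measure)
        show "integrable unit_space (\<lambda>x. \<Prod>i<n. f i (real (m (I + i)) * x))"
          by (intro integrable_unit_continuous continuous_intros continuous_on_compose2[OF cf]) auto
        fix x
        show "indicat_real (A I) x \<le> (\<Prod>i<n. f i (real (m (I + i)) * x))"
        proof (cases "x \<in> A I")
          case True
          have "peak (lil_length b) (real (m b) * x) = 0" if "b \<ge> I" for b
            using True that peak_nonneg by (auto simp: A_def intro!: antisym)
          thus ?thesis by (simp add: f_def)
        next
          case False
          thus ?thesis by (auto simp: f_def peak_le_1 intro!: prod_nonneg)
        qed
      qed
      also have "\<dots> \<le> (\<Prod>i<n. integral\<^sup>L unit_space (f i)) +
          (\<Sum>i<n. (\<Sum>j<i. (4 * pi * (real (lil_length (I + j)))\<^sup>2) * real (m (I + j))) / real (m (I + i)))"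
      proof -
        have "norm ((LINT x|unit_space. (\<Prod>i<n. f i (real (m (I + i)) * x))) - (\<Prod>i<n. integral\<^sup>L unit_space (f i))) \<le>
          (\<Sum>i<n. (\<Sum>j<i. (4 * pi * (real (lil_length (I + j)))\<^sup>2) * real (m (I + j))) / real (m (I + i)))"
        proof (rule mixing_prod[OF cf])
          show "norm (f i x) \<le> 1" for i x
            using peak_nonneg[of "lil_length (I + i)" x] peak_le_1[of "lil_length (I + i)" x] by (simp add: f_def)
          show "norm (f i x - f i y) \<le> 4 * pi * (real (lil_length (I + i)))\<^sup>2 * \<bar>x - y\<bar>" for i x y
            using peak_lipschitz[of "lil_length (I + i)" y x] by (simp add: f_def abs_minus_commute)
          show "f i (x + 1) = f i x" for i x by (simp add: f_def)
        qed (rule m_pos)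
        thus ?thesis by (simp add: abs_le_iff)
      qed
      also have "(\<Prod>i<n. integral\<^sup>L unit_space (f i)) \<le> exp (- s n / 30)"
      proof -
        have "(\<Prod>i<n. integral\<^sup>L unit_space (f i)) \<le> (\<Prod>i<n. exp (- (1 / (30 * real (lil_length (I + i))))))"
        proof (rule prod_mono, safe)
          fix i
          show "0 \<le> integral\<^sup>L unit_space (f i)"
            by (rule Bochner_Integration.integral_nonneg) (simp add: f_def peak_le_1)
          have "integral\<^sup>L unit_space (f i) = 1 - integral\<^sup>L unit_space (peak (lil_length (I + i)))"
            unfolding f_def using prob_space
            by (subst Bochner_Integration.integral_diff) (auto intro!: integrable_unit_continuous continuous_intros)
          also have "\<dots> \<le> 1 + - (1 / (30 * real (lil_length (I + i))))"
            using integral_unit_peak_ge[OF lil_length_bounds(3)[of "I + i"]] by simp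
          also have "\<dots> \<le> exp (- (1 / (30 * real (lil_length (I + i)))))" by (rule exp_ge_add_one_self)
          finally show "integral\<^sup>L unit_space (f i) \<le> exp (- (1 / (30 * real (lil_length (I + i)))))" .
        qed
        also have "\<dots> = exp (- s n / 30)"
          by (simp add: s_def sum_divide_distrib sum_negf mult.commute flip: exp_sum)
        finally show ?thesis .
      qed
      also have "(\<Sum>i<n. (\<Sum>j<i. (4 * pi * (real (lil_length (I + j)))\<^sup>2) * real (m (I + j))) / real (m (I + i))) \<le>
          (\<Sum>i<n. 4 * pi * (1 / 4) ^ (I + i))"
      proof (rule sum_mono)
        fix i
        have "(\<Sum>j<i. (4 * pi * (real (lil_length (I + j)))\<^sup>2) * real (m (I + j))) =
            4 * pi * (\<Sum>j<i. real (m (I + j)) * (real (lil_length (I + j)))\<^sup>2)"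
          by (simp add: sum_distrib_left mult_ac)
        also have "(\<Sum>j<i. real (m (I + j)) * (real (lil_length (I + j)))\<^sup>2) =
            (\<Sum>b\<in>(+) I ` {..<i}. real (m b) * (real (lil_length b))\<^sup>2)"
          by (subst sum.reindex) auto
        also have "\<dots> \<le> (\<Sum>b<I + i. real (m b) * (real (lil_length b))\<^sup>2)"
          by (rule sum_mono2) auto
        finally have "(\<Sum>j<i. (4 * pi * (real (lil_length (I + j)))\<^sup>2) * real (m (I + j))) / real (m (I + i)) \<le>
            4 * pi * ((\<Sum>b<I + i. real (m b) * (real (lil_length b))\<^sup>2) / real (m (I + i)))"
          by (simp add: divide_right_mono)
        also have "\<dots> \<le> 4 * pi * (1 / 4) ^ (I + i)" by (intro mult_left_mono weight_le) simp
        finally show "(\<Sum>j<i. (4 * pi * (real (lil_length (I + j)))\<^sup>2) * real (m (I + j))) / real (m (I + i)) \<le>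
            4 * pi * (1 / 4) ^ (I + i)" .
      qed
      also have "\<dots> = 4 * pi * (1 / 4) ^ I * (\<Sum>i<n. (1 / 4) ^ i)"
        by (simp add: sum_distrib_left power_add mult_ac)
      also have "\<dots> \<le> 4 * pi * (1 / 4) ^ I * 2"
      proof (rule mult_left_mono)
        define a :: real where "a = (1 / 4) ^ n"
        have "(\<Sum>i<n. (1 / 4) ^ i) = (a - 1) / (1 / 4 - 1)" unfolding a_def by (rule geometric_sum) simp
        moreover have "0 \<le> a" by (simp add: a_def)
        moreover have "(a - 1) / (1 / 4 - 1) = 4 / 3 - 4 / 3 * a" by (simp add: field_simps)
        ultimately show "(\<Sum>i<n. (1 / 4) ^ i) \<le> (2 :: real)" by linarith
      qed simp
      finally show ?thesis by simp
    qed
    have "(\<lambda>n. exp (- s n / 30)) \<longlonglongrightarrow> 0"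
    proof -
      have "filterlim s at_top sequentially" unfolding s_def by (rule sum_inverse_lil_length_unbounded)
      hence "filterlim (\<lambda>n. (1 / 30) * s n) at_top sequentially"
        by (intro filterlim_tendsto_pos_mult_at_top[OF tendsto_const]) auto
      hence "filterlim (\<lambda>n. - ((1 / 30) * s n)) at_bot sequentially" by (simp add: filterlim_uminus_at_bot)
      hence "(\<lambda>n. exp (- ((1 / 30) * s n))) \<longlonglongrightarrow> 0" by (rule filterlim_compose[OF exp_at_bot])
      thus ?thesis by simp
    qed
    hence "(\<lambda>n. exp (- s n / 30) + 8 * pi * (1 / 4) ^ I) \<longlonglongrightarrow> 0 + 8 * pi * (1 / 4) ^ I"
      by (intro tendsto_add tendsto_const)
    hence "prob (A I) \<le> 0 + 8 * pi * (1 / 4) ^ I"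
      by (rule tendsto_lowerbound) (use fin in auto)
    thus ?thesis by simp
  qed
  have "prob (A I) = 0" for I
  proof -
    \<comment> \<open>For fixed \<open>I\<close> the decoupling error survives the limit in the
      number of factors. It disappears because the events \<open>A I\<close> increase with
      \<open>I\<close>.\<close>
    have bnd: "prob (A I) \<le> 8 * pi * (1 / 4) ^ (I + n)" for n
    proof -
      have "prob (A I) \<le> prob (A (I + n))"
        by (rule finite_measure_mono[OF _ Am]) (auto simp: A_def)
      thus ?thesis using A_le[of "I + n"] by linarith
    qed
    have "(\<lambda>n. 8 * pi * (1 / 4) ^ (I + n)) \<longlonglongrightarrow> 0" by real_asymp
    hence "prob (A I) \<le> 0" by (rule LIMSEQ_le_const) (use bnd in blast)
    thus ?thesis by (simp add: measure_le_0_iff)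
  qed
  hence "AE x in unit_space. x \<notin> A I" for I
    using Am[of I] by (intro AE_not_in) (auto simp: null_sets_def emeasure_eq_measure)
  hence "AE x in unit_space. \<forall>I. x \<notin> A I" by (simp add: AE_all_countable)
  moreover have "AE x in unit_space. x \<in> space unit_space" by (rule AE_space)
  ultimately show ?thesis
  proof eventually_elim
    case (elim x)
    show ?case unfolding INFM_nat_le
    proof
      fix I
      show "\<exists>b\<ge>I. 0 < peak (lil_length b) (real (m b) * x)"
        using elim by (auto simp: A_def not_le)
    qed
  qed
qed

text \<open>At a peak of the \<open>b\<close>-th kernel, a large sum of the preceding kernels would make this
  product large, so almost surely this happens only finitely often.\<close>

lemma AE_products_null:
  assumes freq: "\<And>b. (LINT x|unit_space. (\<Sum>i<b. dirichlet (lil_length i) (real (m i) * x))\<^sup>2) =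
      real (block_start lil_length b) / 2"
  shows "AE x in unit_space. (\<lambda>b. (dirichlet (lil_length b) (real (m b) * x))\<^sup>2 *
      (\<Sum>i<b. dirichlet (lil_length i) (real (m i) * x))\<^sup>2 / (real (lil_length b)) ^ 4) \<longlonglongrightarrow> 0"
proof -
  interpret prob_space unit_space by (rule prob_space_unit)
  define S where "S b x = (\<Sum>i<b. dirichlet (lil_length i) (real (m i) * x))" for b x
  have cS: "continuous_on UNIV (S b)" for b unfolding S_def by (intro continuous_intros)
  define g where "g b x = (dirichlet (lil_length b) (real (m b) * x))\<^sup>2 * (S b x)\<^sup>2 / (real (lil_length b)) ^ 4" for b x
  have r: "real (lil_length b) \<ge> 1" for b using lil_length_bounds(3)[of b] by simp
  have cg: "continuous_on UNIV (g b)" for b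
    unfolding g_def divide_inverse by (intro continuous_intros cS)
  have gnn: "g b x \<ge> 0" for b x by (simp add: g_def)
  have int_le: "integral\<^sup>L unit_space (g b) \<le> 8 * ((real b + 3) / (real (lil_length b))\<^sup>2)" for b
  proof -
    define X where "X = (\<Sum>j<b. real (m j) * (real (lil_length j))\<^sup>2)"
    define q where "q = real (lil_length b)"
    have q: "q \<ge> 1" using r by (simp add: q_def)
    have X0: "X \<ge> 0" unfolding X_def by (intro sum_nonneg) auto
    have SX: "\<bar>S b x\<bar> \<le> X" for x
    proof -
      have "\<bar>S b x\<bar> \<le> (\<Sum>i<b. \<bar>dirichlet (lil_length i) (real (m i) * x)\<bar>)" unfolding S_def by (rule sum_abs)
      also have "\<dots> \<le> X" unfolding X_def
      proof (rule sum_mono)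
        fix i
        have "real (lil_length i) \<le> (real (lil_length i))\<^sup>2" using r[of i] by (simp add: power2_eq_square)
        also have "1 * \<dots> \<le> real (m i) * \<dots>" using m_pos[of i] by (intro mult_right_mono) auto
        finally have "real (lil_length i) \<le> real (m i) * (real (lil_length i))\<^sup>2" by simp
        thus "\<bar>dirichlet (lil_length i) (real (m i) * x)\<bar> \<le> real (m i) * (real (lil_length i))\<^sup>2"
          using abs_dirichlet_le[of "lil_length i" "real (m i) * x"] by linarith
      qed
      finally show ?thesis .
    qed
    have SL: "\<bar>S b x - S b y\<bar> \<le> 2 * pi * X * \<bar>x - y\<bar>" for x y
    proof -
      have "\<bar>S b x - S b y\<bar> \<le> (\<Sum>i<b. \<bar>dirichlet (lil_length i) (real (m i) * x) - dirichlet (lil_length i) (real (m i) * y)\<bar>)"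
        unfolding S_def by (simp add: sum_abs flip: sum_subtractf)
      also have "\<dots> \<le> (\<Sum>i<b. 2 * pi * (real (m i) * (real (lil_length i))\<^sup>2) * \<bar>x - y\<bar>)"
      proof (rule sum_mono)
        fix i
        have "\<bar>dirichlet (lil_length i) (real (m i) * x) - dirichlet (lil_length i) (real (m i) * y)\<bar> \<le>
           2 * pi * real ((lil_length i)\<^sup>2) * \<bar>real (m i) * x - real (m i) * y\<bar>" by (rule dirichlet_lipschitz)
        also have "\<bar>real (m i) * x - real (m i) * y\<bar> = real (m i) * \<bar>x - y\<bar>" by (simp add: abs_mult flip: right_diff_distrib)
        finally show "\<bar>dirichlet (lil_length i) (real (m i) * x) - dirichlet (lil_length i) (real (m i) * y)\<bar> \<le>
            2 * pi * (real (m i) * (real (lil_length i))\<^sup>2) * \<bar>x - y\<bar>" by (simp add: mult_ac)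
      qed
      finally show ?thesis by (simp add: X_def sum_distrib_left sum_distrib_right mult_ac)
    qed
    have lip: "norm ((S b x)\<^sup>2 - (S b y)\<^sup>2) \<le> 4 * pi * X\<^sup>2 * \<bar>x - y\<bar>" for x y
    proof -
      have "(S b x)\<^sup>2 - (S b y)\<^sup>2 = (S b x - S b y) * (S b x + S b y)" by (simp add: power2_eq_square algebra_simps)
      hence "norm ((S b x)\<^sup>2 - (S b y)\<^sup>2) = \<bar>S b x - S b y\<bar> * \<bar>S b x + S b y\<bar>" by (simp add: abs_mult)
      also have "\<dots> \<le> (2 * pi * X * \<bar>x - y\<bar>) * (2 * X)"
      proof (intro mult_mono SL)
        show "\<bar>S b x + S b y\<bar> \<le> 2 * X" using SX[of x] SX[of y] by linarith
      qed (use X0 in auto)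
      finally show ?thesis by (simp add: power2_eq_square mult_ac)
    qed
    \<comment> \<open>Squared sum and squared kernel are decoupled: the main term is the product of
      their second moments \<open>N_b / 2\<close> and \<open>r_b / 2\<close>, and the error is at
      most \<open>4 * pi * r_b / 2\<close>, because the base is at least \<open>X^2\<close>.\<close>
    have "norm ((LINT x|unit_space. (S b x)\<^sup>2 * (dirichlet (lil_length b) (real (m b) * x))\<^sup>2) -
        (LINT x|unit_space. (S b x)\<^sup>2) * (LINT x|unit_space. (dirichlet (lil_length b) x)\<^sup>2))
      \<le> 4 * pi * X\<^sup>2 / real (m b) * (LINT x|unit_space. norm ((dirichlet (lil_length b) x)\<^sup>2))"
      by (rule mixing[where h = "\<lambda>x. (S b x)\<^sup>2" and g = "\<lambda>x. (dirichlet (lil_length b) x)\<^sup>2", OF _ lip _ _ m_pos])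
        (auto intro!: continuous_intros cS)
    hence "(LINT x|unit_space. (S b x)\<^sup>2 * (dirichlet (lil_length b) (real (m b) * x))\<^sup>2) \<le>
        real (block_start lil_length b) / 2 * (q / 2) + 4 * pi * X\<^sup>2 / real (m b) * (q / 2)"
      using freq[of b] by (simp add: S_def q_def integral_unit_dirichlet_sq abs_le_iff)
    also have "4 * pi * X\<^sup>2 / real (m b) * (q / 2) \<le> 4 * pi * (q / 2)"
    proof (intro mult_right_mono)
      have "1 * X\<^sup>2 \<le> 4 ^ b * X\<^sup>2" by (intro mult_right_mono) (auto simp: one_le_power)
      hence "X\<^sup>2 \<le> real (m b)" using m_growth[of b] unfolding X_def[symmetric] by linarith
      hence "4 * pi * (X\<^sup>2 / real (m b)) \<le> 4 * pi * 1" using m_pos[of b] by (intro mult_left_mono) (auto simp: divide_le_eq_1)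
      thus "4 * pi * X\<^sup>2 / real (m b) \<le> 4 * pi" by simp
    qed (use q in simp)
    also have "real (block_start lil_length b) / 2 * (q / 2) \<le> (real b * q) / 2 * (q / 2)"
    proof (intro mult_right_mono divide_right_mono)
      have "real (block_start lil_length b) \<le> real (b * lil_length b)" using block_start_lil_le by (simp only: of_nat_le_iff)
      thus "real (block_start lil_length b) \<le> real b * q" by (simp add: q_def)
    qed (use q in auto)
    also have "4 * pi * (q / 2) \<le> 8 * q\<^sup>2"
    proof -
      have "pi * q \<le> 4 * q" using pi_less_4 q by (intro mult_right_mono) auto
      moreover have "q \<le> q\<^sup>2" using q by (simp add: power2_eq_square)
      ultimately show ?thesis by linarith
    qed
    finally have le0: "(LINT x|unit_space. (S b x)\<^sup>2 * (dirichlet (lil_length b) (real (m b) * x))\<^sup>2) \<le>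
        real b * q / 2 * (q / 2) + 8 * q\<^sup>2" by simp
    have le: "(LINT x|unit_space. (S b x)\<^sup>2 * (dirichlet (lil_length b) (real (m b) * x))\<^sup>2) \<le> 8 * (real b + 3) * q\<^sup>2"
    proof -
      have "real b * q / 2 * (q / 2) = (real b * q\<^sup>2) / 4" by (simp add: power2_eq_square)
      moreover have "8 * (real b + 3) * q\<^sup>2 = 8 * (real b * q\<^sup>2) + 24 * q\<^sup>2" by (simp add: algebra_simps)
      moreover have "0 \<le> real b * q\<^sup>2" "0 \<le> q\<^sup>2" by simp_all
      ultimately show ?thesis using le0 by linarith
    qed
    have "integral\<^sup>L unit_space (g b) = (LINT x|unit_space. (S b x)\<^sup>2 * (dirichlet (lil_length b) (real (m b) * x))\<^sup>2) / q ^ 4"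
      unfolding g_def q_def by (subst integral_divide_zero) (simp add: mult.commute)
    also have "\<dots> \<le> 8 * (real b + 3) * q\<^sup>2 / q ^ 4" using le by (rule divide_right_mono) simp
    also have "\<dots> = 8 * ((real b + 3) / q\<^sup>2)" using q by (simp add: power2_eq_square power4_eq_xxxx)
    finally show ?thesis by (simp add: q_def)
  qed
  have gm [measurable]: "g b \<in> borel_measurable unit_space" for b
    by (intro borel_measurable_unit borel_measurable_continuous_onI cg)
  \<comment> \<open>The expectations of the \<open>g b\<close> are summable, so the series of the
    \<open>g b x\<close> converges for almost every \<open>x\<close> and its terms tend to
    \<open>0\<close>.\<close>
  have "(\<integral>\<^sup>+x. (\<Sum>b. ennreal (g b x)) \<partial>unit_space) = (\<Sum>b. \<integral>\<^sup>+x. ennreal (g b x) \<partial>unit_space)"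
    by (rule nn_integral_suminf) measurable
  also have "\<dots> = (\<Sum>b. ennreal (integral\<^sup>L unit_space (g b)))"
    by (intro suminf_cong nn_integral_eq_integral integrable_unit_continuous cg) (use gnn in auto)
  also have "\<dots> < \<infinity>"
  proof -
    have "summable (\<lambda>b. integral\<^sup>L unit_space (g b))"
    proof (rule summable_comparison_test'[where N = 0])
      show "summable (\<lambda>b. 8 * ((real b + 3) / (real (lil_length b))\<^sup>2))" by (intro summable_mult summable_lil)
      show "norm (integral\<^sup>L unit_space (g b)) \<le> 8 * ((real b + 3) / (real (lil_length b))\<^sup>2)" for b
        using int_le[of b] gnn by (simp add: abs_of_nonneg Bochner_Integration.integral_nonneg)
    qed
    thus ?thesis using gnn by (subst suminf_ennreal_eq[OF _ summable_sums]) (auto simp: Bochner_Integration.integral_nonneg)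
  qed
  finally have "(\<integral>\<^sup>+x. (\<Sum>b. ennreal (g b x)) \<partial>unit_space) \<noteq> \<infinity>" by simp
  hence "AE x in unit_space. (\<Sum>b. ennreal (g b x)) \<noteq> \<infinity>"
    by (intro nn_integral_noteq_infinite) auto
  thus ?thesis
  proof eventually_elim
    case (elim x)
    have "summable (\<lambda>b. g b x)" using elim gnn by (intro summable_suminf_not_top) auto
    hence "(\<lambda>b. g b x) \<longlonglongrightarrow> 0" by (rule summable_LIMSEQ_zero)
    thus ?case by (simp add: g_def S_def)
  qed
qed

end

text \<open>The sums are inspected at the ends of blocks whose kernel peaks: for large
  \<open>b\<close> the last block contributes at least \<open>r / 2\<close>, the earlier ones at
  most \<open>r / 8\<close> in modulus, and the completion to all frequencies changes this by a
  logarithm of \<open>N\<close> only.\<close>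

lemma lil_rearrangement:
  assumes l: "\<And>c. l c \<ge> 1" and l_inf: "\<And>r. r \<ge> 1 \<Longrightarrow> infinite {c. l c = r}"
  shows "\<exists>\<tau>. bij_betw \<tau> UNIV (block_set l) \<and> (AE x in unit_space. limsup (\<lambda>N. ereal
    ((\<Sum>k<N. cos (2 * pi * real (block_freq l (\<tau> k)) * x)) / sqrt (2 * real N * ln (ln (real N))))) = \<infinity>)"
proof -
  have "\<exists>e. (\<forall>i. l (e i) = lil_length i) \<and> (\<forall>i. Suc (e i) < e (Suc i))"
    by (rule ex_block_selection[OF l_inf lil_length_bounds(3)])
  then obtain e where e: "\<And>i. l (e i) = lil_length i" "\<And>i. Suc (e i) < e (Suc i)" by blast
  have mono: "strict_mono e" using e(2) by (auto simp: strict_mono_Suc_iff intro: Suc_lessD)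
  have e_less: "e i < e (Suc i)" for i using e(2)[of i] by simp
  define u where "u k = (e (fst (block_term lil_length k)), snd (block_term lil_length k))" for k
  have inj_u: "inj u"
    unfolding u_def by (rule inj_block_enumeration[where w = lil_length, OF lil_length_bounds(3) strict_mono_imp_inj_on[OF mono]])
  have u_set: "u k \<in> block_set l" for k
    using snd_block_term[where w = lil_length and k = k, OF lil_length_bounds(3)] by (auto simp: u_def block_set_def e(1))
  have "\<exists>\<tau>. bij_betw \<tau> UNIV (block_set l) \<and> (\<forall>(f :: nat \<times> nat \<Rightarrow> real) N. (\<forall>s. \<bar>f s\<bar> \<le> 1) \<longrightarrow>
    \<bar>(\<Sum>k<N. f (\<tau> k)) - (\<Sum>k<N. f (u k))\<bar> \<le> 2 * real (sparse_count N))"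
  proof (rule ex_sparse_completion[OF inj_u])
    show "range u \<subseteq> block_set l" using u_set by auto
    show "infinite (block_set l - range u)"
      by (rule infinite_block_set_diff[where e = e and l = l, OF l e(2)]) (auto simp: u_def)
  qed
  then obtain \<tau> where \<tau>: "bij_betw \<tau> UNIV (block_set l)"
    and near: "\<And>(f :: nat \<times> nat \<Rightarrow> real) N. (\<forall>s. \<bar>f s\<bar> \<le> 1) \<Longrightarrow>
      \<bar>(\<Sum>k<N. f (\<tau> k)) - (\<Sum>k<N. f (u k))\<bar> \<le> 2 * real (sparse_count N)" by blast
  define m where "m b = block_base l (e b)" for b
  have m_pos: "m b > 0" for b unfolding m_def by (rule block_base_pos[where l = l, OF l])
  have m_growth: "4 ^ b * (\<Sum>j<b. real (m j) * (real (lil_length j))\<^sup>2)\<^sup>2 \<le> real (m b)" for b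
  proof -
    have "4 ^ b * (\<Sum>j<b. m j * (lil_length j)\<^sup>2)\<^sup>2 \<le> m b"
      using block_base_growth[where l = l and e = e and i = b, OF l e_less] by (simp add: m_def e(1))
    hence "real (4 ^ b * (\<Sum>j<b. m j * (lil_length j)\<^sup>2)\<^sup>2) \<le> real (m b)" by (simp only: of_nat_le_iff)
    thus ?thesis by simp
  qed
  define S where "S b x = (\<Sum>i<b. dirichlet (lil_length i) (real (m i) * x))" for b x
  have S_eq: "S b x = (\<Sum>k<block_start lil_length b. cos (2 * pi * real (block_freq l (u k)) * x))" for b x
    using sum_block_term_start[where w = lil_length, OF lil_length_bounds(3),
        where f = "\<lambda>s. cos (2 * pi * real (block_freq l (e (fst s), snd s)) * x)" and b = b]
    by (simp only: fst_conv snd_conv sum_cos_block_freq u_def S_def m_def)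
  have freq: "(LINT x|unit_space. (S b x)\<^sup>2) = real (block_start lil_length b) / 2" for b
  proof -
    have "(LINT x|unit_space. (S b x)\<^sup>2) = real (card {..<block_start lil_length b}) / 2"
      unfolding S_eq
    proof (rule integral_unit_cos_sum_sq)
      show "inj_on (\<lambda>k. block_freq l (u k)) {..<block_start lil_length b}"
        using inj_on_block_freq[where l = l, OF l] inj_u u_set by (auto simp: inj_on_def)
      show "block_freq l (u k) > 0" for k using block_freq_pos[where l = l, OF l u_set] .
    qed simp
    thus ?thesis by simp
  qed
  \<comment> \<open>A lower bound for the quotient in terms of \<open>b\<close> alone:
    \<open>r\<close> is at least \<open>(b + 3) * ln (b + 3)\<close>, and \<open>N\<close> is at
    most \<open>2 * (b + 3)^2 * ln (b + 3)\<close>.\<close>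
  define F where "F b = (3 / 8 * ((real b + 3) * ln (real b + 3)) - 2 * log 2 (2 * (2 * (real b + 3)\<^sup>2 * ln (real b + 3) + 1))) /
      sqrt (2 * (2 * (real b + 3)\<^sup>2 * ln (real b + 3)) * ln (ln (2 * (real b + 3)\<^sup>2 * ln (real b + 3))))" for b :: nat
  have F_top: "filterlim F at_top sequentially" unfolding F_def by real_asymp
  have num_pos: "\<forall>\<^sub>F b in sequentially. 0 < 3 / 8 * ((real b + 3) * ln (real b + 3)) -
      2 * log 2 (2 * (2 * (real b + 3)\<^sup>2 * ln (real b + 3) + 1))" by real_asymp
  define X where "X x N = (\<Sum>k<N. cos (2 * pi * real (block_freq l (\<tau> k)) * x)) / sqrt (2 * real N * ln (ln (real N)))" for x N
  \<comment> \<open>\<open>1 / 256 = (1 / 2)^2 * (1 / 8)^2\<close>: with a kernel of at least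
    \<open>r / 2\<close>, smallness of the product forces \<open>|S b x| \<le> r / 8\<close>, and
    \<open>1 / 2 - 1 / 8 = 3 / 8\<close> of \<open>r\<close> remains.\<close>
  have lower: "F b \<le> X x (block_start lil_length (Suc b))"
    if peak: "0 < peak (lil_length b) (real (m b) * x)"
      and small: "(dirichlet (lil_length b) (real (m b) * x))\<^sup>2 * (S b x)\<^sup>2 / (real (lil_length b)) ^ 4 < 1 / 256"
      and num: "0 < 3 / 8 * ((real b + 3) * ln (real b + 3)) - 2 * log 2 (2 * (2 * (real b + 3)\<^sup>2 * ln (real b + 3) + 1))"
    for x b
  proof -
    define r where "r = real (lil_length b)"
    define d where "d = dirichlet (lil_length b) (real (m b) * x)"
    define N where "N = block_start lil_length (Suc b)"
    define z where "z = real b + 3"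
    have lz: "1 \<le> ln z" unfolding z_def by (rule ln_ge_1)
    have z3: "3 \<le> z" by (simp add: z_def)
    have r: "z * ln z \<le> r" "r \<le> 2 * (z * ln z)" unfolding r_def z_def by (rule lil_length_bounds)+
    have r1: "1 \<le> r" using lil_length_bounds(3)[of b] by (simp add: r_def)
    have d: "r / 2 \<le> d" unfolding r_def d_def by (rule dirichlet_ge_of_peak[OF peak])
    have "\<bar>S b x\<bar> \<le> r / 8"
    proof -
      have "(r / 2)\<^sup>2 \<le> d\<^sup>2" using d r1 by (intro power_mono) auto
      hence "(r / 2)\<^sup>2 * (S b x)\<^sup>2 \<le> d\<^sup>2 * (S b x)\<^sup>2" by (rule mult_right_mono) simp
      also have "\<dots> \<le> r ^ 4 / 256" using small r1 by (simp add: r_def d_def field_simps)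
      finally have "(r / 2)\<^sup>2 * (S b x)\<^sup>2 \<le> (r / 2)\<^sup>2 * (r / 8)\<^sup>2" by (simp add: power_divide power2_eq_square power4_eq_xxxx)
      hence "(S b x)\<^sup>2 \<le> (r / 8)\<^sup>2" using r1 by (subst (asm) mult_le_cancel_left_pos) auto
      thus ?thesis using r1 by (simp add: abs_le_square_iff[symmetric])
    qed
    hence "3 / 8 * r \<le> S (Suc b) x" using d by (simp add: S_def r_def[symmetric] d_def[symmetric])
    moreover have "\<bar>(\<Sum>k<N. cos (2 * pi * real (block_freq l (\<tau> k)) * x)) - S (Suc b) x\<bar> \<le> 2 * real (sparse_count N)"
      unfolding S_eq N_def by (rule near) simp
    ultimately have sum_ge: "3 / 8 * r - 2 * real (sparse_count N) \<le> (\<Sum>k<N. cos (2 * pi * real (block_freq l (\<tau> k)) * x))"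
      by linarith
    have N_le: "real N \<le> 2 * z\<^sup>2 * ln z"
    proof -
      have "N \<le> Suc b * lil_length b" using block_start_lil_le[of b] by (simp add: N_def block_start_Suc)
      hence "real N \<le> real (Suc b * lil_length b)" by (simp only: of_nat_le_iff)
      also have "\<dots> = real (Suc b) * r" by (simp only: of_nat_mult r_def)
      also have "\<dots> \<le> z * r" using r1 by (intro mult_right_mono) (auto simp: z_def)
      also have "\<dots> \<le> z * (2 * (z * ln z))" using r z3 by (intro mult_left_mono) auto
      finally show ?thesis by (simp add: power2_eq_square mult_ac)
    qed
    \<comment> \<open>Beyond \<open>exp 1\<close> the iterated logarithm is positive, so the
      denominator of the quotient is positive too.\<close>
    have N3: "3 \<le> real N"
    proof -
      have "3 * 1 \<le> z * ln z" using z3 lz by (intro mult_mono) auto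
      moreover have "r \<le> real N" by (simp add: N_def r_def block_start_Suc)
      ultimately show ?thesis using r by linarith
    qed
    have lnN: "1 < ln (real N)"
    proof -
      have "exp 1 < real N" using e_less_272 N3 by simp
      thus ?thesis using N3 ln_less_cancel_iff[of "exp 1" "real N"] by simp
    qed
    hence llN: "0 < ln (ln (real N))" by simp
    have ll_le: "ln (ln (real N)) \<le> ln (ln (2 * z\<^sup>2 * ln z))"
    proof -
      have "ln (real N) \<le> ln (2 * z\<^sup>2 * ln z)"
        using N_le N3 by (intro ln_le_cancel_iff[THEN iffD2]) linarith+
      thus ?thesis using lnN by simp
    qed
    have "(3 / 8 * (z * ln z) - 2 * log 2 (2 * (2 * z\<^sup>2 * ln z + 1))) / sqrt (2 * (2 * z\<^sup>2 * ln z) * ln (ln (2 * z\<^sup>2 * ln z))) \<le>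
        (\<Sum>k<N. cos (2 * pi * real (block_freq l (\<tau> k)) * x)) / sqrt (2 * real N * ln (ln (real N)))"
    proof (rule frac_le)
      have "log 2 (2 * (real N + 1)) \<le> log 2 (2 * (M + 1))" if "real N \<le> M" for M using that N3 by simp
      from this[OF N_le] show le: "3 / 8 * (z * ln z) - 2 * log 2 (2 * (2 * z\<^sup>2 * ln z + 1)) \<le> (\<Sum>k<N. cos (2 * pi * real (block_freq l (\<tau> k)) * x))"
        using sum_ge sparse_count_le_log[of N] r(1) by linarith
      thus "0 \<le> (\<Sum>k<N. cos (2 * pi * real (block_freq l (\<tau> k)) * x))" using num unfolding z_def by linarith
      show "0 < sqrt (2 * real N * ln (ln (real N)))" using N3 llN by simp
      show "sqrt (2 * real N * ln (ln (real N))) \<le> sqrt (2 * (2 * z\<^sup>2 * ln z) * ln (ln (2 * z\<^sup>2 * ln z)))"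
        using N_le N3 llN ll_le by (intro real_sqrt_le_mono mult_mono) auto
    qed
    thus ?thesis by (simp add: F_def X_def N_def z_def)
  qed
  have "AE x in unit_space. limsup (\<lambda>N. ereal (X x N)) = \<infinity>"
    using AE_infinitely_many_peaks[where m = m, OF m_pos m_growth]
      AE_products_null[where m = m, OF m_pos m_growth freq[unfolded S_def]]
  proof eventually_elim
    case (elim x)
    have ev: "\<forall>\<^sub>F b in sequentially. (dirichlet (lil_length b) (real (m b) * x))\<^sup>2 * (S b x)\<^sup>2 / (real (lil_length b)) ^ 4 < 1 / 256"
      using elim(2) unfolding S_def by (rule order_tendstoD) simp
    have freq_gt: "\<exists>\<^sub>F N in sequentially. C < X x N" for C
    proof -
      have evC: "\<forall>\<^sub>F b in sequentially. C < F b" using F_top by (simp add: filterlim_at_top_dense)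
      have inf: "\<exists>\<^sub>F b in sequentially. 0 < peak (lil_length b) (real (m b) * x)"
        using elim(1) by (simp add: cofinite_eq_sequentially)
      have sub: "\<exists>\<^sub>F b in sequentially. C < X x (block_start lil_length (Suc b))"
      proof (rule frequently_mp[OF _ inf])
        show "\<forall>\<^sub>F b in sequentially. 0 < peak (lil_length b) (real (m b) * x) \<longrightarrow>
            C < X x (block_start lil_length (Suc b))"
          using ev num_pos evC
        proof eventually_elim
          case (elim b)
          show ?case
          proof
            assume "0 < peak (lil_length b) (real (m b) * x)"
            from lower[OF this elim(1,2)] elim(3) show "C < X x (block_start lil_length (Suc b))" by linarith
          qed
        qed
      qed
      have top: "filterlim (\<lambda>b. block_start lil_length (Suc b)) at_top sequentially"
      proof (rule filterlim_at_top_mono[OF filterlim_ident])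
        show "\<forall>\<^sub>F b in sequentially. b \<le> block_start lil_length (Suc b)"
          by (intro always_eventually allI Suc_leD[OF le_block_start[where w = lil_length, OF lil_length_bounds(3)]])
      qed
      show ?thesis
        unfolding frequently_def
      proof
        assume "\<forall>\<^sub>F N in sequentially. \<not> C < X x N"
        hence "\<forall>\<^sub>F b in sequentially. \<not> C < X x (block_start lil_length (Suc b))"
          by (rule eventually_compose_filterlim[OF _ top])
        thus False using sub by (simp add: frequently_def)
      qed
    qed
    show "limsup (\<lambda>N. ereal (X x N)) = \<infinity>"
    proof (rule ereal_top)
      fix B
      show "ereal B \<le> limsup (\<lambda>N. ereal (X x N))"
      proof (rule ccontr)
        assume "\<not> ereal B \<le> limsup (\<lambda>N. ereal (X x N))"
        hence "limsup (\<lambda>N. ereal (X x N)) < ereal B" by simp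
        hence "\<forall>\<^sub>F N in sequentially. ereal (X x N) < ereal B" by (rule Limsup_lessD)
        hence "\<forall>\<^sub>F N in sequentially. \<not> B < X x N" by eventually_elim simp
        thus False using freq_gt[of B] by (simp add: frequently_def)
      qed
    qed
  qed
  thus ?thesis using \<tau> unfolding X_def by blast
qed

theorem theorem1:
  fixes \<epsilon> :: "nat \<Rightarrow> real"
  assumes "\<forall>k\<ge>1. \<epsilon> k > 0"
    and "\<epsilon> \<longlonglongrightarrow> 0"
  shows "real_distribution G \<and> (\<forall>t. char G t = G_char t) \<and> \<not> gaussian G \<and>
    (\<exists>(n :: nat \<Rightarrow> nat) (k0 :: nat). k0 \<ge> 1 \<and> (\<forall>k\<ge>1. n k > 0) \<and>
      (\<forall>k\<ge>k0. real (n (k + 1)) / real (n k) \<ge> 1 + \<epsilon> k) \<and>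
      (\<exists>(\<sigma> :: nat \<Rightarrow> nat) (b :: nat \<Rightarrow> real).
        permutation_of_pos \<sigma> \<and> bounded (b ` {1..}) \<and>
        weak_conv_m
          (\<lambda>N. distr unit_space borel
            (\<lambda>x. real N powr (- 1 / 2) * cos_sum (n \<circ> \<sigma>) N x - b N)) G) \<and>
      (\<exists>\<sigma> :: nat \<Rightarrow> nat. permutation_of_pos \<sigma> \<and>
        (AE x in unit_space.
          limsup (\<lambda>N. ereal (cos_sum (n \<circ> \<sigma>) N x / sqrt (2 * real N * ln (ln (real N))))) = \<infinity>)))"
proof -
  obtain l :: "nat \<Rightarrow> nat" where l: "\<And>c. l c \<ge> 1"
    and l_\<epsilon>: "\<And>c k. l c \<ge> 2 \<Longrightarrow> c \<le> k \<Longrightarrow> \<epsilon> k * real (l c) \<le> 1"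
    and l_inf: "\<And>r. r \<ge> 1 \<Longrightarrow> infinite {c. l c = r}"
    using ex_block_lengths[OF assms(2)] by blast
  define V where "V = block_freq l ` block_set l"
  \<comment> \<open>\<open>enumerate\<close> starts at \<open>0\<close>, the sequence at index
    \<open>1\<close>. Both rearrangements act on this one sequence.\<close>
  define n where "n k = enumerate V (k - 1)" for k
  have V: "infinite V" unfolding V_def by (rule infinite_block_freq[where l = l, OF l])
  have freq_bij: "bij_betw (block_freq l) (block_set l) V"
    using inj_on_block_freq[where l = l, OF l] by (simp add: bij_betw_def V_def)
  have "\<forall>\<^sub>F k in sequentially. \<epsilon> k < 1" using assms(2) by (rule order_tendstoD) simp
  then obtain K where K: "\<And>k. k \<ge> K \<Longrightarrow> \<epsilon> k < 1" by (auto simp: eventually_sequentially)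
  \<comment> \<open>Beyond \<open>K\<close> the required ratios are below \<open>2\<close>, which
    the gaps between blocks provide; the maximum with \<open>1\<close> keeps the index
    positive.\<close>
  define k0 where "k0 = max 1 K"
  have ratio: "real (n (k + 1)) / real (n k) \<ge> 1 + \<epsilon> k" if "k \<ge> k0" for k
  proof -
    have "\<epsilon> k \<le> 1" using K[of k] that by (simp add: k0_def)
    thus ?thesis
      using block_freq_ratio[where l = l and k = k, OF l l_\<epsilon>] that unfolding n_def V_def k0_def by simp
  qed
  have n_pos: "n k > 0" for k
  proof -
    have "n k \<in> V" unfolding n_def by (rule enumerate_in_set[OF V])
    thus ?thesis using block_freq_pos[where l = l, OF l] by (auto simp: V_def)
  qed
  have perm: "\<exists>\<sigma>. permutation_of_pos \<sigma> \<and>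
      (\<forall>N x. cos_sum (n \<circ> \<sigma>) N x = (\<Sum>k<N. cos (2 * pi * real (block_freq l (\<tau> k)) * x)))"
    if "bij_betw \<tau> UNIV (block_set l)" for \<tau>
  proof -
    have "bij_betw (block_freq l \<circ> \<tau>) UNIV V" using that freq_bij by (rule bij_betw_trans)
    then obtain \<sigma> where \<sigma>: "permutation_of_pos \<sigma>"
      and eq: "\<And>k. k \<ge> 1 \<Longrightarrow> enumerate V (\<sigma> k - 1) = (block_freq l \<circ> \<tau>) (k - 1)"
      using ex_permutation_of_enumeration[OF V] by blast
    have "(n \<circ> \<sigma>) k = block_freq l (\<tau> (k - 1))" if "k \<ge> 1" for k
      using eq[OF that] by (simp add: n_def)
    hence "cos_sum (n \<circ> \<sigma>) N x = (\<Sum>k<N. cos (2 * pi * real (block_freq l (\<tau> k)) * x))" for N x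
      by (rule cos_sum_Suc_shift[of "n \<circ> \<sigma>" "\<lambda>k. block_freq l (\<tau> k)"])
    with \<sigma> show ?thesis by blast
  qed
  obtain \<tau> where \<tau>: "bij_betw \<tau> UNIV (block_set l)"
    and clt: "\<And>t. (\<lambda>N. LINT x|unit_space. iexp (t * (real N powr (- 1 / 2) *
      (\<Sum>k<N. cos (2 * pi * real (block_freq l (\<tau> k)) * x))))) \<longlonglongrightarrow> exp (psi t)"
    using clt_rearrangement[OF l l_inf] by blast
  \<comment> \<open>Adding \<open>levy_shift\<close> corresponds to the constant choice
    \<open>b N = - levy_shift\<close>, which turns the limit \<open>exp (psi t)\<close> into
    \<open>G_char t\<close>.\<close>
  define X where "X N x = real N powr (- 1 / 2) * (\<Sum>k<N. cos (2 * pi * real (block_freq l (\<tau> k)) * x)) + levy_shift" for N x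
  define \<mu> where "\<mu> N = distr unit_space borel (X N)" for N
  have cX: "continuous_on UNIV (X N)" for N unfolding X_def by (intro continuous_intros)
  have \<mu>: "tight \<mu>"
  proof -
    have inj: "inj (\<lambda>k. block_freq l (\<tau> k))"
      using bij_betw_trans[OF \<tau> freq_bij] by (simp add: bij_betw_def comp_def)
    have pos: "block_freq l (\<tau> k) > 0" for k
      by (rule block_freq_pos[where l = l, OF l]) (use \<tau> in \<open>auto simp: bij_betw_def\<close>)
    show ?thesis unfolding \<mu>_def X_def by (rule tight_normalised_cos_sum[OF inj pos])
  qed
  have char_lim: "(\<lambda>N. char (\<mu> N) t) \<longlonglongrightarrow> G_char t" for t
  proof -
    have "char (\<mu> N) t = iexp (t * levy_shift) * (LINT x|unit_space. iexp (t * (real N powr (- 1 / 2) *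
        (\<Sum>k<N. cos (2 * pi * real (block_freq l (\<tau> k)) * x)))))" for N
    proof -
      have "char (\<mu> N) t = (LINT x|unit_space. iexp (t * X N x))"
        unfolding \<mu>_def by (rule char_distr_unit[OF cX])
      also have "\<dots> = (LINT x|unit_space. iexp (t * levy_shift) * iexp (t * (real N powr (- 1 / 2) *
        (\<Sum>k<N. cos (2 * pi * real (block_freq l (\<tau> k)) * x)))))"
        by (simp add: X_def distrib_left add.commute flip: exp_add)
      finally show ?thesis by (simp only: integral_mult_right_zero)
    qed
    moreover have "iexp (t * levy_shift) * exp (psi t) = G_char t"
      by (simp add: G_char_eq exp_add mult.commute)
    ultimately show ?thesis using tendsto_mult_left[OF clt[of t], of "iexp (t * levy_shift)"] by simp
  qed
  have G: "real_distribution G" "\<And>t. char G t = G_char t"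
    using ex_G[OF \<mu> char_lim] by blast+
  obtain \<sigma> where \<sigma>: "permutation_of_pos \<sigma>"
    and \<sigma>_sum: "\<And>N x. cos_sum (n \<circ> \<sigma>) N x = (\<Sum>k<N. cos (2 * pi * real (block_freq l (\<tau> k)) * x))"
    using perm[OF \<tau>] by blast
  have "weak_conv_m \<mu> G"
    using \<mu> by (intro levy_continuity G(1)) (auto simp: tight_def G(2) char_lim)
  moreover have "\<mu> = (\<lambda>N. distr unit_space borel (\<lambda>x. real N powr (- 1 / 2) * cos_sum (n \<circ> \<sigma>) N x - (- levy_shift)))"
    by (rule ext) (simp add: \<mu>_def X_def[abs_def] \<sigma>_sum)
  moreover have "bounded ((\<lambda>_. - levy_shift) ` {1::nat..})" by (simp add: image_constant_conv)
  ultimately have part_i: "\<exists>(\<sigma> :: nat \<Rightarrow> nat) (b :: nat \<Rightarrow> real). permutation_of_pos \<sigma> \<and> bounded (b ` {1..}) \<and>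
      weak_conv_m (\<lambda>N. distr unit_space borel (\<lambda>x. real N powr (- 1 / 2) * cos_sum (n \<circ> \<sigma>) N x - b N)) G"
    using \<sigma> by (intro exI[of _ \<sigma>] exI[of _ "\<lambda>_. - levy_shift"]) simp
  obtain \<tau>' where \<tau>': "bij_betw \<tau>' UNIV (block_set l)"
    and lil: "AE x in unit_space. limsup (\<lambda>N. ereal
      ((\<Sum>k<N. cos (2 * pi * real (block_freq l (\<tau>' k)) * x)) / sqrt (2 * real N * ln (ln (real N))))) = \<infinity>"
    using lil_rearrangement[OF l l_inf] by blast
  obtain \<sigma>' where \<sigma>': "permutation_of_pos \<sigma>'"
    and \<sigma>'_sum: "\<And>N x. cos_sum (n \<circ> \<sigma>') N x = (\<Sum>k<N. cos (2 * pi * real (block_freq l (\<tau>' k)) * x))"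
    using perm[OF \<tau>'] by blast
  have part_ii: "\<exists>\<sigma> :: nat \<Rightarrow> nat. permutation_of_pos \<sigma> \<and> (AE x in unit_space.
      limsup (\<lambda>N. ereal (cos_sum (n \<circ> \<sigma>) N x / sqrt (2 * real N * ln (ln (real N))))) = \<infinity>)"
    using \<sigma>' lil unfolding \<sigma>'_sum[symmetric] by blast
  have k0: "k0 \<ge> 1" by (simp add: k0_def)
  have charG: "\<forall>t. char G t = G_char t" using G(2) by blast
  have pos: "\<forall>k\<ge>1. n k > 0" using n_pos by blast
  have gap: "\<forall>k\<ge>k0. real (n (k + 1)) / real (n k) \<ge> 1 + \<epsilon> k" using ratio by blast
  show ?thesis
    by (rule conjI[OF G(1)], rule conjI[OF charG], rule conjI[OF not_gaussian_G[OF G(2)]],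
        rule exI[of _ n], rule exI[of _ k0], rule conjI[OF k0], rule conjI[OF pos], rule conjI[OF gap],
        rule conjI[OF part_i part_ii])
qed

end
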